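(* Let $G$ be a finite group. The functor $R\mapsto R(G/e)$ from $G$-Tambara functors to $G$-rings reflects products in the following sense: if $R$ is a $G$-Tambara functor and $R(G/e)\cong S_1\times S_2$ is an isomorphism of $G$-rings, then there is a (canonical) isomorphism $R\cong R_1\times R_2$ of $G$-Tambara functors, with $R_i(G/e)=S_i$ for $i=1,2$, which on the bottom level $G/e$ is given by the specified isomorphism $R(G/e)\cong S_1\times S_2=R_1(G/e)\times R_2(G/e)$.
   Context: Rings are commutative with unit; a $G$-ring is a ring with an action of $G$ by ring automorphisms. Let $\mathrm{bispan}(G\text{-}\mathrm{Set}^{\mathrm{fin}})$ be the category whose objects are finite $G$-sets and whose morphisms from $X$ to $Y$ are isomorphism classes of diagrams $X\leftarrow A\to B\to Y$ of finite $G$-sets, with the usual composition of bispans (polynomials), defined via pullbacks and exponential diagrams. A $G$-Tambara functor is a product-preserving functor $R:\mathrm{bispan}(G\text{-}\mathrm{Set}^{\mathrm{fin}})\to \mathrm{Set}$ such that the additive monoid $R(X)$ is a group for each finite $G$-set $X$; morphisms are natural transformations. Transfer (image of $X\sqcup X= X\sqcup X= X\sqcup X\to X$) and norm (image of $X\sqcup X= X\sqcup X\to X= X$) along the fold map give addition and multiplication, making $R(X)$ a commutative ring. $R(G/e)$ is a $G$-ring via $\mathrm{Aut}_G(G/e)\cong G$. Products of Tambara functors are computed levelwise. *)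

theory Defs
  imports "HOL-Algebra.Group_Action" "HOL-Algebra.QuotRing" "HOL-Algebra.Chinese_Remainder"
begin

section \<open>Finite G-sets\<close>

text \<open>
  The points of all finite G-sets are taken from one infinite universe, which contains the elements
  of the group and is closed under binary disjoint unions.  Every finite G-set is isomorphic to one
  with points in this universe, so the category of G-sets below is equivalent to that of all finite
  G-sets.
\<close>

datatype 'g pt = Elt 'g | InL "'g pt" | InR "'g pt"

record 'g gset =
  pts :: "'g pt set"
  act :: "'g \<Rightarrow> 'g pt \<Rightarrow> 'g pt"

definition fin_gset :: "('g, 'm) monoid_scheme \<Rightarrow> 'g gset \<Rightarrow> bool" where
  "fin_gset G X \<longleftrightarrow> finite (pts X) \<and> group_action G (pts X) (act X)"

definition gmap :: "('g, 'm) monoid_scheme \<Rightarrow> 'g gset \<Rightarrow> 'g gset \<Rightarrow> ('g pt \<Rightarrow> 'g pt) \<Rightarrow> bool" where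
  "gmap G X Y f \<longleftrightarrow> fin_gset G X \<and> fin_gset G Y \<and> f \<in> pts X \<rightarrow> pts Y \<and>
     (\<forall>g \<in> carrier G. \<forall>x \<in> pts X. f (act X g x) = act Y g (f x))"

definition gempty :: "'g gset" where
  "gempty = \<lparr>pts = {}, act = (\<lambda>g. \<lambda>x\<in>{}. x)\<rparr>"

definition gsum :: "'g gset \<Rightarrow> 'g gset \<Rightarrow> 'g gset" where
  "gsum X Y = \<lparr>pts = InL ` pts X \<union> InR ` pts Y,
     act = (\<lambda>g. \<lambda>x \<in> InL ` pts X \<union> InR ` pts Y.
       case x of InL a \<Rightarrow> InL (act X g a) | InR b \<Rightarrow> InR (act Y g b) | Elt h \<Rightarrow> Elt h)\<rparr>"

fun gfold :: "'g pt \<Rightarrow> 'g pt" where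
  "gfold (InL x) = x"
| "gfold (InR x) = x"
| "gfold (Elt h) = Elt h"

text \<open>The free orbit \<open>G/e\<close> is the set G with left translation.\<close>

definition free_orbit :: "('g, 'm) monoid_scheme \<Rightarrow> 'g gset" where
  "free_orbit G = \<lparr>pts = Elt ` carrier G,
     act = (\<lambda>g. \<lambda>x \<in> Elt ` carrier G. case x of Elt h \<Rightarrow> Elt (g \<otimes>\<^bsub>G\<^esub> h) | _ \<Rightarrow> x)\<rparr>"

fun right_mult :: "('g, 'm) monoid_scheme \<Rightarrow> 'g \<Rightarrow> 'g pt \<Rightarrow> 'g pt" where
  "right_mult G g (Elt h) = Elt (h \<otimes>\<^bsub>G\<^esub> g)"
| "right_mult G g x = x"


section \<open>Pullbacks and exponential diagrams\<close>

text \<open>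
  The square with \<open>p : P \<rightarrow> A\<close>, \<open>q : P \<rightarrow> B\<close>, \<open>f : A \<rightarrow> C\<close>, \<open>g : B \<rightarrow> C\<close> identifies \<open>P\<close> with the
  fibre product of \<open>A\<close> and \<open>B\<close> over \<open>C\<close>.
\<close>

definition pullback_square ::
  "('g, 'm) monoid_scheme \<Rightarrow> 'g gset \<Rightarrow> 'g gset \<Rightarrow> 'g gset \<Rightarrow> 'g gset \<Rightarrow>
   ('g pt \<Rightarrow> 'g pt) \<Rightarrow> ('g pt \<Rightarrow> 'g pt) \<Rightarrow> ('g pt \<Rightarrow> 'g pt) \<Rightarrow> ('g pt \<Rightarrow> 'g pt) \<Rightarrow> bool" where
  "pullback_square G P A B C p q f g \<longleftrightarrow>
     gmap G P A p \<and> gmap G P B q \<and> gmap G A C f \<and> gmap G B C g \<and>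
     (\<forall>x \<in> pts P. f (p x) = g (q x)) \<and>
     (\<forall>a \<in> pts A. \<forall>b \<in> pts B. f a = g b \<longrightarrow> (\<exists>!x. x \<in> pts P \<and> p x = a \<and> q x = b))"

text \<open>
  For \<open>f : P \<rightarrow> C\<close> and \<open>v : C \<rightarrow> D\<close>, the diagram

    \<open>C \<leftarrow>f\<leftarrow> P \<leftarrow>e\<leftarrow> E \<rightarrow>t\<rightarrow> Q \<rightarrow>h\<rightarrow> D\<close>

  is exponential if \<open>E\<close> is the fibre product of \<open>C\<close> and \<open>Q\<close> over \<open>D\<close> (with projections \<open>f \<circ> e\<close> and \<open>t\<close>)
  and \<open>Q\<close> is the dependent product of \<open>f\<close> along \<open>v\<close>: evaluation by \<open>e\<close> identifies the points of \<open>Q\<close>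
  over \<open>d \<in> D\<close> with the sections of \<open>f\<close> over the fibre of \<open>v\<close> at \<open>d\<close>.  The action on \<open>Q\<close> is the
  conjugation action on sections because \<open>e\<close>, \<open>t\<close>, \<open>h\<close> are equivariant.
\<close>

definition exponential_diagram ::
  "('g, 'm) monoid_scheme \<Rightarrow> 'g gset \<Rightarrow> 'g gset \<Rightarrow> 'g gset \<Rightarrow> 'g gset \<Rightarrow> 'g gset \<Rightarrow>
   ('g pt \<Rightarrow> 'g pt) \<Rightarrow> ('g pt \<Rightarrow> 'g pt) \<Rightarrow>
   ('g pt \<Rightarrow> 'g pt) \<Rightarrow> ('g pt \<Rightarrow> 'g pt) \<Rightarrow> ('g pt \<Rightarrow> 'g pt) \<Rightarrow> bool" where
  "exponential_diagram G P C D E Q f v e t h \<longleftrightarrow>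
     gmap G P C f \<and> gmap G C D v \<and> gmap G E P e \<and>
     pullback_square G E C Q D (f \<circ> e) t v h \<and>
     (\<forall>d \<in> pts D. \<forall>s. (\<forall>c \<in> pts C. v c = d \<longrightarrow> s c \<in> pts P \<and> f (s c) = c) \<longrightarrow>
        (\<exists>!\<pi>. \<pi> \<in> pts Q \<and> h \<pi> = d \<and> (\<forall>x \<in> pts E. t x = \<pi> \<longrightarrow> e x = s (f (e x)))))"


section \<open>The category of bispans\<close>

text \<open>A bispan \<open>X \<leftarrow> A \<rightarrow> B \<rightarrow> Y\<close>, with legs \<open>b_res\<close>, \<open>b_nrm\<close>, \<open>b_trf\<close> from left to right.\<close>

record 'g bispan =
  b_src :: "'g gset"
  b_top :: "'g gset"
  b_bot :: "'g gset"
  b_tgt :: "'g gset"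
  b_res :: "'g pt \<Rightarrow> 'g pt"
  b_nrm :: "'g pt \<Rightarrow> 'g pt"
  b_trf :: "'g pt \<Rightarrow> 'g pt"

definition is_bispan :: "('g, 'm) monoid_scheme \<Rightarrow> 'g bispan \<Rightarrow> bool" where
  "is_bispan G \<omega> \<longleftrightarrow>
     gmap G (b_top \<omega>) (b_src \<omega>) (b_res \<omega>) \<and>
     gmap G (b_top \<omega>) (b_bot \<omega>) (b_nrm \<omega>) \<and>
     gmap G (b_bot \<omega>) (b_tgt \<omega>) (b_trf \<omega>)"

definition bispan_iso :: "('g, 'm) monoid_scheme \<Rightarrow> 'g bispan \<Rightarrow> 'g bispan \<Rightarrow> bool" where
  "bispan_iso G \<omega> \<omega>' \<longleftrightarrow>
     b_src \<omega> = b_src \<omega>' \<and> b_tgt \<omega> = b_tgt \<omega>' \<and>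
     (\<exists>\<alpha> \<beta>. gmap G (b_top \<omega>) (b_top \<omega>') \<alpha> \<and> bij_betw \<alpha> (pts (b_top \<omega>)) (pts (b_top \<omega>')) \<and>
            gmap G (b_bot \<omega>) (b_bot \<omega>') \<beta> \<and> bij_betw \<beta> (pts (b_bot \<omega>)) (pts (b_bot \<omega>')) \<and>
            (\<forall>a \<in> pts (b_top \<omega>). b_res \<omega>' (\<alpha> a) = b_res \<omega> a \<and> b_nrm \<omega>' (\<alpha> a) = \<beta> (b_nrm \<omega> a)) \<and>
            (\<forall>b \<in> pts (b_bot \<omega>). b_trf \<omega>' (\<beta> b) = b_trf \<omega> b))"

definition bispan_class :: "('g, 'm) monoid_scheme \<Rightarrow> 'g bispan \<Rightarrow> 'g bispan set" where
  "bispan_class G \<omega> = {\<omega>'. is_bispan G \<omega>' \<and> bispan_iso G \<omega> \<omega>'}"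

definition bispan_hom ::
  "('g, 'm) monoid_scheme \<Rightarrow> 'g gset \<Rightarrow> 'g gset \<Rightarrow> 'g bispan set set" where
  "bispan_hom G X Y = {bispan_class G \<omega> | \<omega>. is_bispan G \<omega> \<and> b_src \<omega> = X \<and> b_tgt \<omega> = Y}"

definition bispan_id :: "('g, 'm) monoid_scheme \<Rightarrow> 'g gset \<Rightarrow> 'g bispan set" where
  "bispan_id G X = bispan_class G
     \<lparr>b_src = X, b_top = X, b_bot = X, b_tgt = X, b_res = id, b_nrm = id, b_trf = id\<rparr>"

text \<open>
  \<open>\<omega>''\<close> is a composite of \<open>\<omega> = (X \<leftarrow> A \<rightarrow> B \<rightarrow> Y)\<close> followed by \<open>\<omega>' = (Y \<leftarrow> C \<rightarrow> D \<rightarrow> Z)\<close>: with pullbacks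
  \<open>P\<close> of \<open>B\<close> and \<open>C\<close> over \<open>Y\<close>, and \<open>A'\<close> of \<open>A\<close> and \<open>P\<close> over \<open>B\<close>, an exponential diagram
  \<open>C \<leftarrow> P \<leftarrow> E \<rightarrow> Q \<rightarrow> D\<close>, and the pullback \<open>M\<close> of \<open>A'\<close> and \<open>E\<close> over \<open>P\<close>, it is the bispan
  \<open>X \<leftarrow> M \<rightarrow> Q \<rightarrow> Z\<close> whose legs are \<open>M \<rightarrow> A' \<rightarrow> A \<rightarrow> X\<close>, \<open>M \<rightarrow> E \<rightarrow> Q\<close> and \<open>Q \<rightarrow> D \<rightarrow> Z\<close>.
\<close>

definition is_composite ::
  "('g, 'm) monoid_scheme \<Rightarrow> 'g bispan \<Rightarrow> 'g bispan \<Rightarrow> 'g bispan \<Rightarrow> bool" where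
  "is_composite G \<omega> \<omega>' \<omega>'' \<longleftrightarrow>
     (\<exists>P A' E Q M pB pC aA aP e t h mA mE.
        pullback_square G P (b_bot \<omega>) (b_top \<omega>') (b_tgt \<omega>) pB pC (b_trf \<omega>) (b_res \<omega>') \<and>
        pullback_square G A' (b_top \<omega>) P (b_bot \<omega>) aA aP (b_nrm \<omega>) pB \<and>
        exponential_diagram G P (b_top \<omega>') (b_bot \<omega>') E Q pC (b_nrm \<omega>') e t h \<and>
        pullback_square G M A' E P mA mE aP e \<and>
        \<omega>'' = \<lparr>b_src = b_src \<omega>, b_top = M, b_bot = Q, b_tgt = b_tgt \<omega>',
               b_res = b_res \<omega> \<circ> aA \<circ> mA, b_nrm = t \<circ> mE, b_trf = b_trf \<omega>' \<circ> h\<rparr>)"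

text \<open>
  Composition of isomorphism classes, in the order of function composition: all bispans isomorphic
  to a composite of representatives.
\<close>

definition bispan_comp ::
  "('g, 'm) monoid_scheme \<Rightarrow> 'g bispan set \<Rightarrow> 'g bispan set \<Rightarrow> 'g bispan set" where
  "bispan_comp G \<Psi> \<Phi> =
     \<Union> {bispan_class G \<omega>'' | \<omega> \<omega>' \<omega>''. \<omega> \<in> \<Phi> \<and> \<omega>' \<in> \<Psi> \<and> is_composite G \<omega> \<omega>' \<omega>''}"

definition bispan_product ::
  "('g, 'm) monoid_scheme \<Rightarrow> 'g gset \<Rightarrow> 'g bispan set \<Rightarrow> 'g bispan set \<Rightarrow> 'g gset \<Rightarrow> 'g gset \<Rightarrow> bool"
where
  "bispan_product G P \<Phi> \<Psi> X Y \<longleftrightarrow>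
     fin_gset G P \<and> \<Phi> \<in> bispan_hom G P X \<and> \<Psi> \<in> bispan_hom G P Y \<and>
     (\<forall>Z. fin_gset G Z \<longrightarrow> (\<forall>A \<in> bispan_hom G Z X. \<forall>B \<in> bispan_hom G Z Y.
        \<exists>!C. C \<in> bispan_hom G Z P \<and> bispan_comp G \<Phi> C = A \<and> bispan_comp G \<Psi> C = B))"

definition bispan_terminal :: "('g, 'm) monoid_scheme \<Rightarrow> 'g gset \<Rightarrow> bool" where
  "bispan_terminal G T \<longleftrightarrow>
     fin_gset G T \<and> (\<forall>Z. fin_gset G Z \<longrightarrow> (\<exists>!C. C \<in> bispan_hom G Z T))"

definition restriction ::
  "('g, 'm) monoid_scheme \<Rightarrow> 'g gset \<Rightarrow> 'g gset \<Rightarrow> ('g pt \<Rightarrow> 'g pt) \<Rightarrow> 'g bispan set" where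
  "restriction G X Y f = bispan_class G
     \<lparr>b_src = Y, b_top = X, b_bot = X, b_tgt = X, b_res = f, b_nrm = id, b_trf = id\<rparr>"

definition norm_along ::
  "('g, 'm) monoid_scheme \<Rightarrow> 'g gset \<Rightarrow> 'g gset \<Rightarrow> ('g pt \<Rightarrow> 'g pt) \<Rightarrow> 'g bispan set" where
  "norm_along G X Y f = bispan_class G
     \<lparr>b_src = X, b_top = X, b_bot = Y, b_tgt = Y, b_res = id, b_nrm = f, b_trf = id\<rparr>"

definition transfer_along ::
  "('g, 'm) monoid_scheme \<Rightarrow> 'g gset \<Rightarrow> 'g gset \<Rightarrow> ('g pt \<Rightarrow> 'g pt) \<Rightarrow> 'g bispan set" where
  "transfer_along G X Y f = bispan_class G
     \<lparr>b_src = X, b_top = X, b_bot = X, b_tgt = Y, b_res = id, b_nrm = id, b_trf = f\<rparr>"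


section \<open>Tambara functors\<close>

text \<open>
  A functor from bispans to sets.  The type \<open>'u\<close> plays the role of the universe in which the sets
  live; only the values of \<open>t_map\<close> at morphisms between finite G-sets, on elements of the source,
  are meaningful.
\<close>

record ('g, 'u) bifun =
  t_obj :: "'g gset \<Rightarrow> 'u set"
  t_map :: "'g bispan set \<Rightarrow> 'u \<Rightarrow> 'u"

definition set_functor :: "('g, 'm) monoid_scheme \<Rightarrow> ('g, 'u) bifun \<Rightarrow> bool" where
  "set_functor G R \<longleftrightarrow>
     (\<forall>X Y. \<forall>\<Phi> \<in> bispan_hom G X Y. t_map R \<Phi> \<in> t_obj R X \<rightarrow> t_obj R Y) \<and>
     (\<forall>X. fin_gset G X \<longrightarrow> (\<forall>x \<in> t_obj R X. t_map R (bispan_id G X) x = x)) \<and>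
     (\<forall>X Y Z. \<forall>\<Phi> \<in> bispan_hom G X Y. \<forall>\<Psi> \<in> bispan_hom G Y Z. \<forall>x \<in> t_obj R X.
        t_map R (bispan_comp G \<Psi> \<Phi>) x = t_map R \<Psi> (t_map R \<Phi> x))"

definition product_preserving :: "('g, 'm) monoid_scheme \<Rightarrow> ('g, 'u) bifun \<Rightarrow> bool" where
  "product_preserving G R \<longleftrightarrow>
     (\<forall>T. bispan_terminal G T \<longrightarrow> (\<exists>!x. x \<in> t_obj R T)) \<and>
     (\<forall>P \<Phi> \<Psi> X Y. fin_gset G X \<longrightarrow> fin_gset G Y \<longrightarrow> bispan_product G P \<Phi> \<Psi> X Y \<longrightarrow>
        bij_betw (\<lambda>z. (t_map R \<Phi> z, t_map R \<Psi> z)) (t_obj R P) (t_obj R X \<times> t_obj R Y))"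

definition t_pair :: "('g, 'm) monoid_scheme \<Rightarrow> ('g, 'u) bifun \<Rightarrow> 'g gset \<Rightarrow> 'u \<Rightarrow> 'u \<Rightarrow> 'u" where
  "t_pair G R X a b = (THE z. z \<in> t_obj R (gsum X X) \<and>
     t_map R (restriction G X (gsum X X) InL) z = a \<and>
     t_map R (restriction G X (gsum X X) InR) z = b)"

text \<open>
  Transfer and norm along the binary fold map \<open>X \<squnion> X \<rightarrow> X\<close> are addition and multiplication; along the
  nullary fold map \<open>\<emptyset> \<rightarrow> X\<close> they give zero and one.
\<close>

definition level_ring :: "('g, 'm) monoid_scheme \<Rightarrow> ('g, 'u) bifun \<Rightarrow> 'g gset \<Rightarrow> 'u ring" where
  "level_ring G R X =
     \<lparr>carrier = t_obj R X,
      mult = (\<lambda>a b. t_map R (norm_along G (gsum X X) X gfold) (t_pair G R X a b)),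
      one = t_map R (norm_along G gempty X id) (THE z. z \<in> t_obj R gempty),
      zero = t_map R (transfer_along G gempty X id) (THE z. z \<in> t_obj R gempty),
      add = (\<lambda>a b. t_map R (transfer_along G (gsum X X) X gfold) (t_pair G R X a b))\<rparr>"

definition tambara_functor :: "('g, 'm) monoid_scheme \<Rightarrow> ('g, 'u) bifun \<Rightarrow> bool" where
  "tambara_functor G R \<longleftrightarrow> set_functor G R \<and> product_preserving G R \<and>
     (\<forall>X. fin_gset G X \<longrightarrow> group (add_monoid (level_ring G R X)))"

definition tambara_hom ::
  "('g, 'm) monoid_scheme \<Rightarrow> ('g, 'u) bifun \<Rightarrow> ('g, 'v) bifun \<Rightarrow> ('g gset \<Rightarrow> 'u \<Rightarrow> 'v) \<Rightarrow> bool" where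
  "tambara_hom G R R' \<eta> \<longleftrightarrow> tambara_functor G R \<and> tambara_functor G R' \<and>
     (\<forall>X. fin_gset G X \<longrightarrow> \<eta> X \<in> t_obj R X \<rightarrow> t_obj R' X) \<and>
     (\<forall>X Y. \<forall>\<Phi> \<in> bispan_hom G X Y. \<forall>x \<in> t_obj R X. \<eta> Y (t_map R \<Phi> x) = t_map R' \<Phi> (\<eta> X x))"

definition tambara_iso ::
  "('g, 'm) monoid_scheme \<Rightarrow> ('g, 'u) bifun \<Rightarrow> ('g, 'v) bifun \<Rightarrow> ('g gset \<Rightarrow> 'u \<Rightarrow> 'v) \<Rightarrow> bool" where
  "tambara_iso G R R' \<eta> \<longleftrightarrow> tambara_hom G R R' \<eta> \<and>
     (\<forall>X. fin_gset G X \<longrightarrow> bij_betw (\<eta> X) (t_obj R X) (t_obj R' X))"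

definition tambara_prod :: "('g, 'u) bifun \<Rightarrow> ('g, 'v) bifun \<Rightarrow> ('g, 'u \<times> 'v) bifun" where
  "tambara_prod R R' =
     \<lparr>t_obj = (\<lambda>X. t_obj R X \<times> t_obj R' X), t_map = (\<lambda>\<Phi>. map_prod (t_map R \<Phi>) (t_map R' \<Phi>))\<rparr>"


section \<open>G-rings\<close>

definition G_ring ::
  "('g, 'm) monoid_scheme \<Rightarrow> ('a, 'k) ring_scheme \<Rightarrow> ('g \<Rightarrow> 'a \<Rightarrow> 'a) \<Rightarrow> bool" where
  "G_ring G S \<rho> \<longleftrightarrow> cring S \<and> group_action G (carrier S) \<rho> \<and> (\<forall>g \<in> carrier G. \<rho> g \<in> ring_iso S S)"

definition G_ring_iso ::
  "('g, 'm) monoid_scheme \<Rightarrow> ('a, 'k) ring_scheme \<Rightarrow> ('g \<Rightarrow> 'a \<Rightarrow> 'a) \<Rightarrow>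
   ('b, 'l) ring_scheme \<Rightarrow> ('g \<Rightarrow> 'b \<Rightarrow> 'b) \<Rightarrow> ('a \<Rightarrow> 'b) set" where
  "G_ring_iso G S \<rho> S' \<rho>' =
     {\<phi> \<in> ring_iso S S'. \<forall>g \<in> carrier G. \<forall>s \<in> carrier S. \<phi> (\<rho> g s) = \<rho>' g (\<phi> s)}"

text \<open>
  Equality of G-rings ignores the values of the operations outside the carrier, so it is not
  equality of records.
\<close>

definition G_ring_eq ::
  "('g, 'm) monoid_scheme \<Rightarrow> ('a, 'k) ring_scheme \<Rightarrow> ('g \<Rightarrow> 'a \<Rightarrow> 'a) \<Rightarrow>
   ('a, 'l) ring_scheme \<Rightarrow> ('g \<Rightarrow> 'a \<Rightarrow> 'a) \<Rightarrow> bool" where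
  "G_ring_eq G S \<rho> S' \<rho>' \<longleftrightarrow>
     carrier S = carrier S' \<and> \<one>\<^bsub>S\<^esub> = \<one>\<^bsub>S'\<^esub> \<and> \<zero>\<^bsub>S\<^esub> = \<zero>\<^bsub>S'\<^esub> \<and>
     (\<forall>x \<in> carrier S. \<forall>y \<in> carrier S. x \<oplus>\<^bsub>S\<^esub> y = x \<oplus>\<^bsub>S'\<^esub> y \<and> x \<otimes>\<^bsub>S\<^esub> y = x \<otimes>\<^bsub>S'\<^esub> y) \<and>
     (\<forall>g \<in> carrier G. \<forall>x \<in> carrier S. \<rho> g x = \<rho>' g x)"

definition prod_act :: "('g \<Rightarrow> 'a \<Rightarrow> 'a) \<Rightarrow> ('g \<Rightarrow> 'b \<Rightarrow> 'b) \<Rightarrow> 'g \<Rightarrow> 'a \<times> 'b \<Rightarrow> 'a \<times> 'b" where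
  "prod_act \<rho> \<sigma> g = map_prod (\<rho> g) (\<sigma> g)"

text \<open>
  The element g corresponds to the automorphism \<open>x \<mapsto> x g\<inverse>\<close> of \<open>G/e\<close>, and it acts on \<open>R(G/e)\<close> by
  transfer along this automorphism, that is, by restriction along its inverse \<open>x \<mapsto> x g\<close>.
\<close>

definition underlying_ring :: "('g, 'm) monoid_scheme \<Rightarrow> ('g, 'u) bifun \<Rightarrow> 'u ring" where
  "underlying_ring G R = level_ring G R (free_orbit G)"

definition underlying_act :: "('g, 'm) monoid_scheme \<Rightarrow> ('g, 'u) bifun \<Rightarrow> 'g \<Rightarrow> 'u \<Rightarrow> 'u" where
  "underlying_act G R g = (\<lambda>x \<in> t_obj R (free_orbit G).
     t_map R (restriction G (free_orbit G) (free_orbit G) (right_mult G g)) x)"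

end

theory Submission
  imports Defs
begin

text \<open>
  Write \<open>\<Gamma>\<close> for \<open>G/e\<close>.  The isomorphism turns \<open>(1,0)\<close> and \<open>(0,1)\<close> into two orthogonal idempotents
  \<open>e1 + e2 = 1\<close> of \<open>R(\<Gamma>)\<close> which are fixed by \<open>G\<close>.  The point is to extend them to all levels.  For a
  finite G-set \<open>X\<close> choose a surjection \<open>v : A \<rightarrow> X\<close> from a free G-set, given with a map \<open>\<gamma> : A \<rightarrow> \<Gamma>\<close>, and
  let \<open>lift X\<close> be the norm along \<open>v\<close> of \<open>\<gamma>\<^sup>*e\<close>.  The key fact is \<open>nrm_absorb\<close>: such a norm absorbs the
  norm of a restriction of \<open>e\<close> along any other map to \<open>X\<close> from a free G-set.  Indeed this second source
  consists of free orbits, each of which can be moved into \<open>A\<close> over \<open>X\<close>; since \<open>e\<close> is invariant, the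
  restricted elements match, and then \<open>e\<cdot>e = e\<close> applies.  Consequently \<open>lift X\<close> does not depend on the choice
  of \<open>A\<close>, it is an idempotent, it equals \<open>e\<close> at the bottom level, it is stable under restriction, and
  \<open>lift Y\<close> absorbs the norm of \<open>lift X\<close> along every map \<open>X \<rightarrow> Y\<close>.

  The lifts of \<open>e1\<close> and \<open>e2\<close> are again complementary (\<open>lift_orthogonal\<close>, \<open>lift_complete\<close>).  Their product is
  the norm of \<open>e1\<cdot>e2 = 0\<close>.  For their sum, expand the norm of \<open>1 = e1 + e2\<close> along \<open>v\<close> by distributivity: the
  summands are indexed by the functions from the fibres of \<open>v\<close> to \<open>{1,2}\<close>; the constant functions give the two
  lifts, and in every other summand a norm of \<open>e1\<close> meets a norm of \<open>e2\<close>, so that it is \<open>0\<close> by absorption.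

  Multiplication by \<open>lift X\<close> therefore splits each \<open>R(X)\<close>, and its kernel is a congruence for restrictions,
  for transfers (Frobenius reciprocity) and for norms (absorption), hence for all bispans
  (\<open>lift_mul_cong\<close>).  The two quotients of \<open>R\<close> are the required factors.

  These arguments need the usual calculus of restrictions, norms and transfers, which has to be derived from
  the composition of bispans: functoriality, base change, distributivity, and the fact that disjoint
  unions of G-sets are products of bispans.  For this, composites of bispans are described pointwise
  (locale \<open>composite\<close>), and shown to exist and to be unique up to isomorphism.
\<close>

section \<open>Finite G-sets inside the universe of points\<close>

context group
begin

lemma fin_gset_iff:
  "fin_gset G X \<longleftrightarrow> finite (pts X) \<and>
     (\<forall>g \<in> carrier G. act X g \<in> extensional (pts X) \<and> (\<forall>x \<in> pts X. act X g x \<in> pts X)) \<and>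
     (\<forall>x \<in> pts X. act X \<one> x = x) \<and>
     (\<forall>g \<in> carrier G. \<forall>h \<in> carrier G. \<forall>x \<in> pts X. act X (g \<otimes> h) x = act X g (act X h x))"
    (is "_ \<longleftrightarrow> ?R")
proof
  assume "fin_gset G X"
  then have fin: "finite (pts X)" and ga: "group_action G (pts X) (act X)"
    by (auto simp: fin_gset_def)
  interpret group_action G "pts X" "act X" by (fact ga)
  have "act X g \<in> extensional (pts X)" if "g \<in> carrier G" for g
    using bij_prop0[OF that] by (simp add: Bij_def)
  moreover have "act X \<one> x = x" if "x \<in> pts X" for x
    using id_eq_one that by (metis restrict_apply')
  moreover have "act X g x \<in> pts X" if "g \<in> carrier G" "x \<in> pts X" for g x
    using surj_prop[OF that(1)] that(2) by blast
  ultimately show ?R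
    using fin composition_rule by (intro conjI ballI) auto
next
  assume R: ?R
  have inv: "act X (inv g) (act X g x) = x" "act X g (act X (inv g) x) = x"
    if "g \<in> carrier G" "x \<in> pts X" for g x
    using R that by (metis inv_closed l_inv r_inv)+
  have bij: "act X g \<in> Bij (pts X)" if g: "g \<in> carrier G" for g
  proof -
    have "bij_betw (act X g) (pts X) (pts X)"
      by (rule bij_betw_byWitness[where f' = "act X (inv g)"]) (use R g inv in auto)
    then show ?thesis using R g by (simp add: Bij_def)
  qed
  have "act X (g \<otimes> h) = compose (pts X) (act X g) (act X h)"
    if gh: "g \<in> carrier G" "h \<in> carrier G" for g h
  proof (rule extensionalityI[where A = "pts X"])
    show "act X (g \<otimes> h) \<in> extensional (pts X)" using R gh by blast
  qed (use R gh in \<open>auto simp: compose_eq\<close>)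
  then have "group_hom G (BijGroup (pts X)) (act X)"
    using bij group_BijGroup
    by (intro group_hom.intro group_hom_axioms.intro homI) (auto simp: BijGroup_def group_BijGroup)
  then show "fin_gset G X"
    using R by (simp add: fin_gset_def group_action_def)
qed

lemma fin_gset_finite: "fin_gset G X \<Longrightarrow> finite (pts X)"
  and act_closed: "fin_gset G X \<Longrightarrow> g \<in> carrier G \<Longrightarrow> x \<in> pts X \<Longrightarrow> act X g x \<in> pts X"
  and act_one: "fin_gset G X \<Longrightarrow> x \<in> pts X \<Longrightarrow> act X \<one> x = x"
  and act_mult: "fin_gset G X \<Longrightarrow> g \<in> carrier G \<Longrightarrow> h \<in> carrier G \<Longrightarrow> x \<in> pts X \<Longrightarrow>
    act X (g \<otimes> h) x = act X g (act X h x)"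
  by (simp_all add: fin_gset_iff)

lemma act_inv:
  assumes "fin_gset G X" "g \<in> carrier G" "x \<in> pts X"
  shows "act X (inv g) (act X g x) = x" "act X g (act X (inv g) x) = x"
  using assms by (metis act_mult act_one inv_closed l_inv r_inv)+

lemma act_inject:
  assumes "fin_gset G X" "g \<in> carrier G" "x \<in> pts X" "y \<in> pts X"
  shows "act X g x = act X g y \<longleftrightarrow> x = y"
  using assms by (metis act_inv(1))

lemma fin_gsetI:
  assumes "finite (pts X)"
    and "\<And>g. g \<in> carrier G \<Longrightarrow> act X g \<in> extensional (pts X)"
    and "\<And>g x. g \<in> carrier G \<Longrightarrow> x \<in> pts X \<Longrightarrow> act X g x \<in> pts X"
    and "\<And>x. x \<in> pts X \<Longrightarrow> act X \<one> x = x"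
    and "\<And>g h x. g \<in> carrier G \<Longrightarrow> h \<in> carrier G \<Longrightarrow> x \<in> pts X \<Longrightarrow>
           act X (g \<otimes> h) x = act X g (act X h x)"
  shows "fin_gset G X"
  using assms by (simp add: fin_gset_iff)

lemma gmapI:
  assumes "fin_gset G X" "fin_gset G Y" "\<And>x. x \<in> pts X \<Longrightarrow> f x \<in> pts Y"
    and "\<And>g x. g \<in> carrier G \<Longrightarrow> x \<in> pts X \<Longrightarrow> f (act X g x) = act Y g (f x)"
  shows "gmap G X Y f"
  using assms by (auto simp: gmap_def)

lemma gmap_fin: "gmap G X Y f \<Longrightarrow> fin_gset G X" "gmap G X Y f \<Longrightarrow> fin_gset G Y"
  and gmap_in: "gmap G X Y f \<Longrightarrow> x \<in> pts X \<Longrightarrow> f x \<in> pts Y"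
  and gmap_act: "gmap G X Y f \<Longrightarrow> g \<in> carrier G \<Longrightarrow> x \<in> pts X \<Longrightarrow> f (act X g x) = act Y g (f x)"
  by (auto simp: gmap_def)

lemma gmap_id: "fin_gset G X \<Longrightarrow> gmap G X X id"
  by (auto simp: gmap_def)

lemma gmap_cong: "gmap G X Y f \<Longrightarrow> (\<And>x. x \<in> pts X \<Longrightarrow> f x = f' x) \<Longrightarrow> gmap G X Y f'"
  unfolding gmap_def Pi_iff by (metis act_closed)

lemma gmap_comp: "gmap G X Y f \<Longrightarrow> gmap G Y Z f' \<Longrightarrow> gmap G X Z (f' \<circ> f)"
  by (rule gmapI) (auto simp: gmap_fin gmap_in gmap_act)

lemma gmap_inverse:
  assumes f: "gmap G X Y f" and inv: "\<And>x. x \<in> pts X \<Longrightarrow> f' (f x) = x"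
    and f': "\<And>y. y \<in> pts Y \<Longrightarrow> f' y \<in> pts X" "\<And>y. y \<in> pts Y \<Longrightarrow> f (f' y) = y"
  shows "gmap G Y X f'"
proof (rule gmapI)
  fix g y assume g: "g \<in> carrier G" and y: "y \<in> pts Y"
  have "f' (act Y g y) = f' (f (act X g (f' y)))" using f' y g by (simp add: gmap_act[OF f])
  also have "\<dots> = act X g (f' y)"
    using f g y f' by (intro inv) (simp add: gmap_fin act_closed)
  finally show "f' (act Y g y) = act X g (f' y)" .
qed (use f f' gmap_fin in auto)

lemma gmap_bij_inverse:
  assumes f: "gmap G X Y f" and bij: "bij_betw f (pts X) (pts Y)"
  obtains f' where "gmap G Y X f'" "\<And>x. x \<in> pts X \<Longrightarrow> f' (f x) = x" "\<And>y. y \<in> pts Y \<Longrightarrow> f (f' y) = y"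
proof
  let ?f' = "inv_into (pts X) f"
  show i: "?f' (f x) = x" if "x \<in> pts X" for x
    using bij that by (simp add: bij_betw_inv_into_left)
  show j: "f (?f' y) = y" if "y \<in> pts Y" for y
    using bij that by (simp add: bij_betw_inv_into_right)
  show "gmap G Y X ?f'"
    by (rule gmap_inverse[OF f i _ j]) (use bij in \<open>auto simp: bij_betw_def intro: inv_into_into\<close>)
qed

text \<open>
  Constructions such as fibre products naturally live on sets of tuples or functions.  As the universe
  of points is infinite, every abstract finite set with a G-action can be copied into it.
\<close>

lemma infinite_pt: "infinite (UNIV :: 'c pt set)"
proof -
  have "InL ` (UNIV :: 'c pt set) \<subset> UNIV" by auto
  moreover have "inj (InL :: 'c pt \<Rightarrow> 'c pt)" by (simp add: inj_on_def)
  ultimately show ?thesis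
    by (metis endo_inj_surj psubset_eq subset_UNIV)
qed

lemma gset_realization:
  fixes S :: "'s set" and \<alpha> :: "'a \<Rightarrow> 's \<Rightarrow> 's"
  assumes fin: "finite S"
    and closed: "\<forall>g \<in> carrier G. \<forall>s \<in> S. \<alpha> g s \<in> S"
    and one: "\<forall>s \<in> S. \<alpha> \<one> s = s"
    and mult: "\<forall>g \<in> carrier G. \<forall>h \<in> carrier G. \<forall>s \<in> S. \<alpha> (g \<otimes> h) s = \<alpha> g (\<alpha> h s)"
  shows "\<exists>X dec. fin_gset G X \<and> bij_betw dec (pts X) S \<and>
    (\<forall>g \<in> carrier G. \<forall>x \<in> pts X. dec (act X g x) = \<alpha> g (dec x))"
proof -
  obtain T :: "'a pt set" where T: "finite T" "card T = card S"
    using infinite_arbitrarily_large[OF infinite_pt] by blast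
  then obtain dec where dec: "bij_betw dec T S"
    using fin finite_same_card_bij by blast
  define enc where "enc = inv_into T dec"
  have enc: "enc s \<in> T" "dec (enc s) = s" if "s \<in> S" for s
    using dec that unfolding enc_def
    by (auto simp: bij_betw_inv_into_right bij_betw_def inv_into_into)
  have dec': "dec x \<in> S" "enc (dec x) = x" if "x \<in> T" for x
    using dec that unfolding enc_def by (auto simp: bij_betw_inv_into_left bij_betw_def)
  define X where "X = \<lparr>pts = T, act = (\<lambda>g. \<lambda>x\<in>T. enc (\<alpha> g (dec x)))\<rparr>"
  have "fin_gset G X"
    by (rule fin_gsetI) (simp_all add: X_def T enc dec' closed one mult)
  moreover have "bij_betw dec (pts X) S" using dec by (simp add: X_def)
  moreover have "dec (act X g x) = \<alpha> g (dec x)" if "g \<in> carrier G" "x \<in> pts X" for g x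
    using that by (simp add: X_def enc dec' closed)
  ultimately show ?thesis by blast
qed

text \<open>
  Maps are evaluated only on points, so the inclusion of a sub-G-set is the function \<open>id\<close>, and the
  restriction of a map to a sub-G-set is given by the same function.
\<close>

definition subgset :: "'a gset \<Rightarrow> 'a pt set \<Rightarrow> 'a gset" where
  "subgset X S = \<lparr>pts = S, act = (\<lambda>g. restrict (act X g) S)\<rparr>"

lemma pts_subgset [simp]: "pts (subgset X S) = S"
  and act_subgset [simp]: "x \<in> S \<Longrightarrow> act (subgset X S) g x = act X g x"
  by (simp_all add: subgset_def)

lemma fin_subgset:
  assumes "fin_gset G X" "S \<subseteq> pts X" "\<And>g x. g \<in> carrier G \<Longrightarrow> x \<in> S \<Longrightarrow> act X g x \<in> S"
  shows "fin_gset G (subgset X S)"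
proof (rule fin_gsetI)
  show "finite (pts (subgset X S))"
    using assms finite_subset fin_gset_finite by fastforce
  show "act (subgset X S) g \<in> extensional (pts (subgset X S))" for g
    by (simp add: subgset_def)
qed (use assms in \<open>auto simp: subsetD act_one act_mult\<close>)

lemma gmap_subgset:
  assumes f: "gmap G X Y f" and S: "S \<subseteq> pts X" "\<And>g x. g \<in> carrier G \<Longrightarrow> x \<in> S \<Longrightarrow> act X g x \<in> S"
  shows "gmap G (subgset X S) Y f"
  by (rule gmapI) (use assms in \<open>auto simp: fin_subgset gmap_fin gmap_in gmap_act subsetD\<close>)

lemma gmap_into_subgset:
  assumes f: "gmap G X Y f" and S: "fin_gset G (subgset Y S)" "\<And>x. x \<in> pts X \<Longrightarrow> f x \<in> S"
  shows "gmap G X (subgset Y S) f"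
  by (rule gmapI) (use assms in \<open>auto simp: gmap_fin gmap_act\<close>)

lemma fin_gempty: "fin_gset G gempty"
  by (rule fin_gsetI) (auto simp: gempty_def)

lemma pts_gempty [simp]: "pts gempty = {}"
  by (simp add: gempty_def)

lemma gmap_empty: "fin_gset G X \<Longrightarrow> fin_gset G Y \<Longrightarrow> pts X = {} \<Longrightarrow> gmap G X Y f"
  by (rule gmapI) auto

lemma pts_gsum: "pts (gsum X Y) = InL ` pts X \<union> InR ` pts Y"
  and act_InL [simp]: "x \<in> pts X \<Longrightarrow> act (gsum X Y) g (InL x) = InL (act X g x)"
  and act_InR [simp]: "y \<in> pts Y \<Longrightarrow> act (gsum X Y) g (InR y) = InR (act Y g y)"
  by (auto simp: gsum_def)

lemma fin_gsum:
  assumes "fin_gset G X" "fin_gset G Y"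
  shows "fin_gset G (gsum X Y)"
proof (rule fin_gsetI)
  show "finite (pts (gsum X Y))"
    using assms by (simp add: pts_gsum fin_gset_finite)
  show "act (gsum X Y) g \<in> extensional (pts (gsum X Y))" for g
    by (simp add: gsum_def)
qed (use assms in \<open>auto simp: pts_gsum act_closed act_one act_mult\<close>)

lemma gmap_InL: "fin_gset G X \<Longrightarrow> fin_gset G Y \<Longrightarrow> gmap G X (gsum X Y) InL"
  and gmap_InR: "fin_gset G X \<Longrightarrow> fin_gset G Y \<Longrightarrow> gmap G Y (gsum X Y) InR"
  by (rule gmapI; simp add: fin_gsum pts_gsum)+

lemma gmap_gsum:
  assumes "gmap G X Z (\<lambda>x. f (InL x))" "gmap G Y Z (\<lambda>y. f (InR y))"
  shows "gmap G (gsum X Y) Z f"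
proof (rule gmapI)
  fix g x assume "g \<in> carrier G" "x \<in> pts (gsum X Y)"
  then show "f (act (gsum X Y) g x) = act Z g (f x)"
    using gmap_act[OF assms(1)] gmap_act[OF assms(2)] by (auto simp: pts_gsum)
next
  fix x assume "x \<in> pts (gsum X Y)"
  then show "f x \<in> pts Z"
    using gmap_in[OF assms(1)] gmap_in[OF assms(2)] by (auto simp: pts_gsum)
qed (use assms gmap_fin fin_gsum in blast)+

lemma gmap_gfold: "fin_gset G X \<Longrightarrow> gmap G (gsum X X) X gfold"
  by (rule gmap_gsum) (auto intro: gmapI)

lemma pts_free_orbit: "pts (free_orbit G) = Elt ` carrier G"
  and act_free_orbit [simp]:
    "h \<in> carrier G \<Longrightarrow> act (free_orbit G) g (Elt h) = Elt (g \<otimes> h)"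
  by (auto simp: free_orbit_def)

lemma fin_free_orbit: "finite (carrier G) \<Longrightarrow> fin_gset G (free_orbit G)"
proof (rule fin_gsetI)
  show "act (free_orbit G) g \<in> extensional (pts (free_orbit G))" for g
    by (simp add: free_orbit_def)
qed (auto simp: pts_free_orbit m_assoc)

lemma gmap_right_mult:
  "finite (carrier G) \<Longrightarrow> k \<in> carrier G \<Longrightarrow>
   gmap G (free_orbit G) (free_orbit G) (right_mult G k)"
  by (rule gmapI) (auto simp: fin_free_orbit pts_free_orbit m_assoc)


section \<open>Pullbacks and exponential diagrams exist\<close>

lemma pullback_exists:
  assumes f: "gmap G A C f" and f': "gmap G B C f'"
  obtains P p q where "pullback_square G P A B C p q f f'"
proof -
  let ?S = "{(a, b). a \<in> pts A \<and> b \<in> pts B \<and> f a = f' b}"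
  let ?\<alpha> = "\<lambda>g. map_prod (act A g) (act B g)"
  note fins = gmap_fin[OF f] gmap_fin[OF f']
  have fin: "finite ?S"
    by (rule finite_subset[of _ "pts A \<times> pts B"]) (use fins fin_gset_finite in auto)
  have closed: "\<forall>g \<in> carrier G. \<forall>s \<in> ?S. ?\<alpha> g s \<in> ?S"
    using fins by (auto simp: act_closed gmap_act[OF f] gmap_act[OF f'])
  have one: "\<forall>s \<in> ?S. ?\<alpha> \<one> s = s"
    using fins by (auto simp: act_one)
  have mult: "\<forall>g \<in> carrier G. \<forall>h \<in> carrier G. \<forall>s \<in> ?S. ?\<alpha> (g \<otimes> h) s = ?\<alpha> g (?\<alpha> h s)"
    using fins by (auto simp: act_mult)
  obtain P dec where real: "fin_gset G P \<and> bij_betw dec (pts P) ?S \<and>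
      (\<forall>g \<in> carrier G. \<forall>x \<in> pts P. dec (act P g x) = ?\<alpha> g (dec x))"
    using gset_realization[OF fin closed one mult] by (elim exE) (rule that)
  then have P: "fin_gset G P" "bij_betw dec (pts P) ?S"
    "\<And>g x. g \<in> carrier G \<Longrightarrow> x \<in> pts P \<Longrightarrow> dec (act P g x) = ?\<alpha> g (dec x)"
    by simp_all
  have dec: "dec x \<in> ?S" if "x \<in> pts P" for x
    using bspec[OF bij_betwE[OF P(2)] that] .
  have "pullback_square G P A B C (fst \<circ> dec) (snd \<circ> dec) f f'"
    unfolding pullback_square_def
  proof (intro conjI ballI impI)
    show "gmap G P A (fst \<circ> dec)" "gmap G P B (snd \<circ> dec)"
      using fins P dec by (auto intro!: gmapI simp: split_beta)
    show "f ((fst \<circ> dec) x) = f' ((snd \<circ> dec) x)" if "x \<in> pts P" for x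
      using dec[OF that] by auto
    fix a b assume "a \<in> pts A" "b \<in> pts B" "f a = f' b"
    then have "(a, b) \<in> dec ` pts P"
      using P(2) by (simp add: bij_betw_def)
    then have "\<exists>!x. x \<in> pts P \<and> dec x = (a, b)"
      using bij_betw_imp_inj_on[OF P(2)] by (auto simp: inj_on_def)
    then show "\<exists>!x. x \<in> pts P \<and> (fst \<circ> dec) x = a \<and> (snd \<circ> dec) x = b"
      by (simp add: prod_eq_iff)
  qed (use f f' in auto)
  then show thesis by (rule that)
qed

text \<open>
  A point of \<open>Q\<close> over \<open>d\<close> is a section \<open>s\<close> of \<open>f\<close> over the fibre \<open>F d\<close> of \<open>v\<close>, on which \<open>G\<close> acts by conjugation.
  Sections are taken as extensional functions, so that they are determined by their values on the fibre
  and form a finite set.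
\<close>

lemma exponential_exists:
  assumes f: "gmap G P C f" and v: "gmap G C D v"
  obtains E Q e t h where "exponential_diagram G P C D E Q f v e t h"
proof -
  define F where "F d = {c \<in> pts C. v c = d}" for d
  define S where "S = (SIGMA d : pts D. {s \<in> F d \<rightarrow>\<^sub>E pts P. \<forall>c \<in> F d. f (s c) = c})"
  define \<alpha> where "\<alpha> g = (\<lambda>(d, s). (act D g d,
    \<lambda>c \<in> F (act D g d). act P g (s (act C (inv g) c))))" for g
  note fins = gmap_fin[OF f] gmap_fin[OF v]
  have F_act: "act C g c \<in> F (act D g d) \<longleftrightarrow> c \<in> F d"
    if "g \<in> carrier G" "c \<in> pts C" "d \<in> pts D" for g c d
    using that fins act_inject[of D g "v c" d]
    by (simp add: F_def act_closed gmap_act[OF v] gmap_in[OF v])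
  have F_inv: "act C (inv g) c \<in> F d" if "g \<in> carrier G" "d \<in> pts D" "c \<in> F (act D g d)" for g c d
    using F_act[of g "act C (inv g) c" d] that fins
    by (simp add: F_def act_closed act_inv)
  have finS: "finite S" unfolding S_def
  proof (rule finite_SigmaI)
    show "finite (pts D)" using fins by (simp add: fin_gset_finite)
    fix d
    have "finite (F d)" using fins by (simp add: F_def fin_gset_finite)
    then have "finite (F d \<rightarrow>\<^sub>E pts P)"
      using fins fin_gset_finite by (intro finite_PiE) auto
    then show "finite {s \<in> F d \<rightarrow>\<^sub>E pts P. \<forall>c \<in> F d. f (s c) = c}" by simp
  qed
  have closed: "\<forall>g \<in> carrier G. \<forall>z \<in> S. \<alpha> g z \<in> S"
  proof (intro ballI)
    fix g z assume g: "g \<in> carrier G" and z: "z \<in> S"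
    obtain d s where z_eq: "z = (d, s)" and d: "d \<in> pts D" and s: "s \<in> F d \<rightarrow>\<^sub>E pts P"
      and sec: "\<And>c. c \<in> F d \<Longrightarrow> f (s c) = c"
      using z by (auto simp: S_def)
    have "act P g (s (act C (inv g) c)) \<in> pts P" "f (act P g (s (act C (inv g) c))) = c"
      if c: "c \<in> F (act D g d)" for c
    proof -
      have i: "act C (inv g) c \<in> F d" using F_inv g d c by blast
      then have p: "s (act C (inv g) c) \<in> pts P" using s by (auto simp: PiE_def)
      then show "act P g (s (act C (inv g) c)) \<in> pts P" using fins g by (simp add: act_closed)
      show "f (act P g (s (act C (inv g) c))) = c"
        using gmap_act[OF f g p] sec[OF i] c fins g by (simp add: F_def act_inv)
    qed
    then show "\<alpha> g z \<in> S"
      unfolding S_def \<alpha>_def z_eq using d g fins by (auto simp: act_closed)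
  qed
  have one: "\<forall>z \<in> S. \<alpha> \<one> z = z"
  proof
    fix z assume z: "z \<in> S"
    obtain d s where z_eq: "z = (d, s)" and d: "d \<in> pts D" and s: "s \<in> F d \<rightarrow>\<^sub>E pts P"
      using z by (auto simp: S_def)
    have "act P \<one> (s (act C (inv \<one>) c)) = s c" if "c \<in> F d" for c
      using that s fins by (auto simp: F_def PiE_def Pi_def act_one)
    then have "(\<lambda>c \<in> F d. act P \<one> (s (act C (inv \<one>) c))) = s"
      using s by (intro extensionalityI[of _ "F d"]) (auto simp: PiE_def)
    then show "\<alpha> \<one> z = z" by (simp add: \<alpha>_def z_eq fins act_one d)
  qed
  have mult: "\<forall>g \<in> carrier G. \<forall>k \<in> carrier G. \<forall>z \<in> S. \<alpha> (g \<otimes> k) z = \<alpha> g (\<alpha> k z)"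
  proof (intro ballI)
    fix g k z assume g: "g \<in> carrier G" and k: "k \<in> carrier G" and z: "z \<in> S"
    obtain d s where z_eq: "z = (d, s)" and d: "d \<in> pts D" and s: "s \<in> F d \<rightarrow>\<^sub>E pts P"
      using z by (auto simp: S_def)
    have "act P (g \<otimes> k) (s (act C (inv (g \<otimes> k)) c)) =
        act P g ((\<lambda>c \<in> F (act D k d). act P k (s (act C (inv k) c))) (act C (inv g) c))"
      if c: "c \<in> F (act D (g \<otimes> k) d)" for c
    proof -
      have c1: "act C (inv g) c \<in> F (act D k d)"
        using F_inv[OF g _, of "act D k d" c] c d g k fins by (simp add: act_mult act_closed)
      have c2: "act C (inv k) (act C (inv g) c) \<in> F d"
        using F_inv[OF k d] c1 by blast
      have "act C (inv (g \<otimes> k)) c = act C (inv k) (act C (inv g) c)"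
        using c g k fins by (simp add: F_def act_mult inv_mult_group)
      moreover have "s (act C (inv k) (act C (inv g) c)) \<in> pts P"
        using c2 s by (auto simp: PiE_def)
      ultimately show ?thesis using c1 g k fins by (simp add: act_mult)
    qed
    then show "\<alpha> (g \<otimes> k) z = \<alpha> g (\<alpha> k z)"
      using d g k fins by (auto simp: \<alpha>_def z_eq act_mult act_closed intro!: restrict_ext)
  qed
  obtain Q dec where Q: "fin_gset G Q" "bij_betw dec (pts Q) S"
    and dec_act: "\<And>g x. g \<in> carrier G \<Longrightarrow> x \<in> pts Q \<Longrightarrow> dec (act Q g x) = \<alpha> g (dec x)"
    using gset_realization[OF finS closed one mult] by blast
  have dec_in: "dec \<pi> \<in> S" if "\<pi> \<in> pts Q" for \<pi>
    using bspec[OF bij_betwE[OF Q(2)] that] .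
  define h where "h = fst \<circ> dec"
  have h: "gmap G Q D h"
  proof (rule gmapI)
    show "h \<pi> \<in> pts D" if "\<pi> \<in> pts Q" for \<pi>
      using dec_in[OF that] by (auto simp: h_def S_def)
    show "h (act Q g \<pi>) = act D g (h \<pi>)" if "g \<in> carrier G" "\<pi> \<in> pts Q" for g \<pi>
      using dec_act that by (simp add: h_def \<alpha>_def split_beta)
  qed (use Q fins in auto)
  obtain E k t where E: "pullback_square G E C Q D k t v h"
    using pullback_exists[OF v h] .
  then have k: "gmap G E C k" and t: "gmap G E Q t" and vk: "\<And>x. x \<in> pts E \<Longrightarrow> v (k x) = h (t x)"
    by (auto simp: pullback_square_def)
  define e where "e x = snd (dec (t x)) (k x)" for x
  have k_F: "k x \<in> F (fst (dec (t x)))" if "x \<in> pts E" for x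
    using that k vk by (simp add: F_def gmap_in h_def)
  have e_in: "e x \<in> pts P" "f (e x) = k x" if x: "x \<in> pts E" for x
    using k_F[OF x] dec_in[OF gmap_in[OF t x]] by (auto simp: S_def e_def)
  have e: "gmap G E P e"
  proof (rule gmapI)
    fix g x assume g: "g \<in> carrier G" and x: "x \<in> pts E"
    have tx: "t x \<in> pts Q" using t x by (simp add: gmap_in)
    obtain d s where ds: "dec (t x) = (d, s)" and d: "d \<in> pts D"
      using dec_in[OF tx] by (auto simp: S_def)
    have kx: "k x \<in> F d" using k_F[OF x] ds by simp
    have "e (act E g x) = snd (\<alpha> g (d, s)) (act C g (k x))"
      using g x t k tx ds by (simp add: e_def gmap_act dec_act)
    also have "\<dots> = act P g (s (k x))"
      using F_act[of g "k x" d] kx g d fins by (simp add: \<alpha>_def F_def act_inv)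
    finally show "e (act E g x) = act P g (e x)" by (simp add: e_def ds)
  qed (use k f e_in gmap_fin in auto)
  have "exponential_diagram G P C D E Q f v e t h"
    unfolding exponential_diagram_def
  proof (intro conjI ballI allI impI)
    show "pullback_square G E C Q D (f \<circ> e) t v h"
    proof -
      have "gmap G E C (f \<circ> e)" using e f by (rule gmap_comp)
      then show ?thesis
        using E e_in(2) unfolding pullback_square_def by (simp add: o_def cong: conj_cong)
    qed
    fix d s assume d: "d \<in> pts D" and s: "\<forall>c \<in> pts C. v c = d \<longrightarrow> s c \<in> pts P \<and> f (s c) = c"
    have "(d, restrict s (F d)) \<in> S"
      using d s by (auto simp: S_def F_def)
    then obtain \<pi> where \<pi>: "\<pi> \<in> pts Q" "dec \<pi> = (d, restrict s (F d))"
      using Q(2) by (metis bij_betw_def imageE)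
    show "\<exists>!\<pi>. \<pi> \<in> pts Q \<and> h \<pi> = d \<and> (\<forall>x \<in> pts E. t x = \<pi> \<longrightarrow> e x = s (f (e x)))"
    proof (rule ex1I[of _ \<pi>])
      have "e x = s (f (e x))" if "x \<in> pts E" "t x = \<pi>" for x
        using that k_F[OF that(1)] \<pi> e_in[OF that(1)] by (simp add: e_def)
      then show "\<pi> \<in> pts Q \<and> h \<pi> = d \<and> (\<forall>x \<in> pts E. t x = \<pi> \<longrightarrow> e x = s (f (e x)))"
        using \<pi> by (auto simp: h_def)
      fix \<pi>' assume \<pi>': "\<pi>' \<in> pts Q \<and> h \<pi>' = d \<and> (\<forall>x \<in> pts E. t x = \<pi>' \<longrightarrow> e x = s (f (e x)))"
      obtain s' where s': "dec \<pi>' = (d, s')" "s' \<in> F d \<rightarrow>\<^sub>E pts P"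
        using \<pi>' dec_in[of \<pi>'] by (auto simp: h_def S_def)
      have "s' c = s c" if c: "c \<in> F d" for c
      proof -
        obtain x where "x \<in> pts E" "k x = c" "t x = \<pi>'"
          using E \<pi>' c unfolding pullback_square_def F_def by (metis (mono_tags, lifting) mem_Collect_eq)
        then show ?thesis using \<pi>' s' e_in by (metis e_def snd_conv)
      qed
      then have "s' = restrict s (F d)"
        using s'(2) by (intro extensionalityI[of _ "F d"]) (auto simp: PiE_def)
      then show "\<pi>' = \<pi>"
        using s' \<pi> \<pi>' Q(2) by (metis bij_betw_def inj_onD)
    qed
  qed (use f v e in auto)
  then show thesis by (rule that)
qed

end

section \<open>Composition of bispans\<close>

abbreviation "tops \<omega> \<equiv> pts (b_top \<omega>)"
abbreviation "bots \<omega> \<equiv> pts (b_bot \<omega>)"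

context group
begin

lemma pullback_ex:
  "pullback_square G P A B C p q f f' \<Longrightarrow> a \<in> pts A \<Longrightarrow> b \<in> pts B \<Longrightarrow> f a = f' b \<Longrightarrow>
   \<exists>x \<in> pts P. p x = a \<and> q x = b"
  unfolding pullback_square_def by blast

lemma pullback_unique:
  assumes "pullback_square G P A B C p q f f'" "x \<in> pts P" "y \<in> pts P" "p x = p y" "q x = q y"
  shows "x = y"
proof -
  have "\<exists>!z. z \<in> pts P \<and> p z = p y \<and> q z = q y"
    using assms unfolding pullback_square_def by (auto simp: gmap_def Pi_iff)
  then show ?thesis using assms by blast
qed

lemma pullback_gmaps:
  assumes "pullback_square G P A B C p q f f'"
  shows "gmap G P A p" "gmap G P B q" "gmap G A C f" "gmap G B C f'"
  using assms unfolding pullback_square_def by blast+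

lemma pullback_commutes:
  "pullback_square G P A B C p q f f' \<Longrightarrow> x \<in> pts P \<Longrightarrow> f (p x) = f' (q x)"
  unfolding pullback_square_def by blast

lemma pullbackI:
  assumes "gmap G P A p" "gmap G P B q" "gmap G A C f" "gmap G B C f'"
    and "\<And>x. x \<in> pts P \<Longrightarrow> f (p x) = f' (q x)"
    and "\<And>a b. a \<in> pts A \<Longrightarrow> b \<in> pts B \<Longrightarrow> f a = f' b \<Longrightarrow> \<exists>x \<in> pts P. p x = a \<and> q x = b"
    and "\<And>x y. x \<in> pts P \<Longrightarrow> y \<in> pts P \<Longrightarrow> p x = p y \<Longrightarrow> q x = q y \<Longrightarrow> x = y"
  shows "pullback_square G P A B C p q f f'"
  unfolding pullback_square_def
proof (intro conjI ballI impI)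
  fix a b assume "a \<in> pts A" "b \<in> pts B" "f a = f' b"
  then obtain x where "x \<in> pts P" "p x = a" "q x = b" using assms(6) by blast
  then show "\<exists>!x. x \<in> pts P \<and> p x = a \<and> q x = b" using assms(7) by (intro ex1I[of _ x]) auto
qed (use assms(1-5) in auto)

text \<open>
  Half of an isomorphism of bispans.  Two such maps in opposite directions that are inverse to each other
  are more convenient than a bijective one, since they make the relation visibly symmetric.
\<close>

definition bispan_map ::
  "'a bispan \<Rightarrow> 'a bispan \<Rightarrow> ('a pt \<Rightarrow> 'a pt) \<Rightarrow> ('a pt \<Rightarrow> 'a pt) \<Rightarrow> bool" where
  "bispan_map \<omega> \<omega>' a b \<longleftrightarrow> b_src \<omega> = b_src \<omega>' \<and> b_tgt \<omega> = b_tgt \<omega>' \<and>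
     gmap G (b_top \<omega>) (b_top \<omega>') a \<and> gmap G (b_bot \<omega>) (b_bot \<omega>') b \<and>
     (\<forall>x \<in> tops \<omega>. b_res \<omega>' (a x) = b_res \<omega> x \<and> b_nrm \<omega>' (a x) = b (b_nrm \<omega> x)) \<and>
     (\<forall>x \<in> bots \<omega>. b_trf \<omega>' (b x) = b_trf \<omega> x)"

lemma bispan_mapD:
  assumes "bispan_map \<omega> \<omega>' a b"
  shows "b_src \<omega> = b_src \<omega>'" "b_tgt \<omega> = b_tgt \<omega>'"
    and "gmap G (b_top \<omega>) (b_top \<omega>') a" "gmap G (b_bot \<omega>) (b_bot \<omega>') b"
    and "x \<in> tops \<omega> \<Longrightarrow> b_res \<omega>' (a x) = b_res \<omega> x" "x \<in> tops \<omega> \<Longrightarrow> b_nrm \<omega>' (a x) = b (b_nrm \<omega> x)"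
    and "x \<in> bots \<omega> \<Longrightarrow> b_trf \<omega>' (b x) = b_trf \<omega> x"
  using assms by (simp_all add: bispan_map_def)

lemma bispan_isoI:
  assumes m: "bispan_map \<omega> \<omega>' a b" and m': "bispan_map \<omega>' \<omega> a' b'"
    and "\<And>x. x \<in> tops \<omega> \<Longrightarrow> a' (a x) = x" "\<And>x. x \<in> tops \<omega>' \<Longrightarrow> a (a' x) = x"
    and "\<And>x. x \<in> bots \<omega> \<Longrightarrow> b' (b x) = x" "\<And>x. x \<in> bots \<omega>' \<Longrightarrow> b (b' x) = x"
  shows "bispan_iso G \<omega> \<omega>'"
proof -
  note g = bispan_mapD(3,4)[OF m] and g' = bispan_mapD(3,4)[OF m']
  have "bij_betw a (tops \<omega>) (tops \<omega>')"
    by (rule bij_betw_byWitness[where f' = a']) (use assms(3,4) gmap_in[OF g(1)] gmap_in[OF g'(1)] in auto)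
  moreover have "bij_betw b (bots \<omega>) (bots \<omega>')"
    by (rule bij_betw_byWitness[where f' = b']) (use assms(5,6) gmap_in[OF g(2)] gmap_in[OF g'(2)] in auto)
  ultimately show ?thesis using m unfolding bispan_iso_def bispan_map_def by blast
qed

lemma bispan_isoE:
  assumes "bispan_iso G \<omega> \<omega>'" and "is_bispan G \<omega>"
  obtains a b a' b' where "bispan_map \<omega> \<omega>' a b" "bispan_map \<omega>' \<omega> a' b'"
    "\<And>x. x \<in> tops \<omega> \<Longrightarrow> a' (a x) = x" "\<And>x. x \<in> tops \<omega>' \<Longrightarrow> a (a' x) = x"
    "\<And>x. x \<in> bots \<omega> \<Longrightarrow> b' (b x) = x" "\<And>x. x \<in> bots \<omega>' \<Longrightarrow> b (b' x) = x"
proof -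
  obtain a b where m: "bispan_map \<omega> \<omega>' a b" and bij: "bij_betw a (tops \<omega>) (tops \<omega>')"
      "bij_betw b (bots \<omega>) (bots \<omega>')"
    using assms(1) unfolding bispan_iso_def bispan_map_def by blast
  note g = bispan_mapD[OF m]
  obtain a' where a': "gmap G (b_top \<omega>') (b_top \<omega>) a'" "\<And>x. x \<in> tops \<omega> \<Longrightarrow> a' (a x) = x"
    "\<And>x. x \<in> tops \<omega>' \<Longrightarrow> a (a' x) = x"
    by (rule gmap_bij_inverse[OF g(3) bij(1)]) (rule that)
  obtain b' where b': "gmap G (b_bot \<omega>') (b_bot \<omega>) b'" "\<And>x. x \<in> bots \<omega> \<Longrightarrow> b' (b x) = x"
    "\<And>x. x \<in> bots \<omega>' \<Longrightarrow> b (b' x) = x"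
    by (rule gmap_bij_inverse[OF g(4) bij(2)]) (rule that)
  have n: "gmap G (b_top \<omega>) (b_bot \<omega>) (b_nrm \<omega>)" using assms(2) by (simp add: is_bispan_def)
  have "b_res \<omega> (a' x) = b_res \<omega>' x \<and> b_nrm \<omega> (a' x) = b' (b_nrm \<omega>' x)" if x: "x \<in> tops \<omega>'" for x
    using g(5,6)[OF gmap_in[OF a'(1) x]] a'(3)[OF x] b'(2)[OF gmap_in[OF n gmap_in[OF a'(1) x]]] by simp
  moreover have "b_trf \<omega> (b' x) = b_trf \<omega>' x" if x: "x \<in> bots \<omega>'" for x
    using g(7)[OF gmap_in[OF b'(1) x]] b'(3)[OF x] by simp
  ultimately have "bispan_map \<omega>' \<omega> a' b'"
    using a'(1) b'(1) g(1,2) by (simp add: bispan_map_def)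
  then show thesis by (rule that[OF m _ a'(2,3) b'(2,3)])
qed

lemma bispan_iso_refl: "is_bispan G \<omega> \<Longrightarrow> bispan_iso G \<omega> \<omega>"
  by (rule bispan_isoI[of _ _ id id id id]) (auto simp: bispan_map_def is_bispan_def gmap_id gmap_fin)

lemma bispan_iso_sym: "is_bispan G \<omega> \<Longrightarrow> bispan_iso G \<omega> \<omega>' \<Longrightarrow> bispan_iso G \<omega>' \<omega>"
  by (rule bispan_isoE) (auto intro: bispan_isoI)

lemma bispan_iso_trans:
  assumes iso: "bispan_iso G \<omega> \<omega>'" "bispan_iso G \<omega>' \<omega>''"
  shows "bispan_iso G \<omega> \<omega>''"
proof -
  obtain a b where m: "bispan_map \<omega> \<omega>' a b" "bij_betw a (tops \<omega>) (tops \<omega>')" "bij_betw b (bots \<omega>) (bots \<omega>')"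
    using iso(1) unfolding bispan_iso_def bispan_map_def by blast
  obtain c d where m': "bispan_map \<omega>' \<omega>'' c d" "bij_betw c (tops \<omega>') (tops \<omega>'')" "bij_betw d (bots \<omega>') (bots \<omega>'')"
    using iso(2) unfolding bispan_iso_def bispan_map_def by blast
  note g = bispan_mapD[OF m(1)] and g' = bispan_mapD[OF m'(1)]
  have "bispan_map \<omega> \<omega>'' (c \<circ> a) (d \<circ> b)"
    using g g' gmap_comp[OF g(3) g'(3)] gmap_comp[OF g(4) g'(4)] gmap_in[OF g(3)] gmap_in[OF g(4)]
    by (simp add: bispan_map_def)
  then show ?thesis
    using bij_betw_trans[OF m(2) m'(2)] bij_betw_trans[OF m(3) m'(3)]
    unfolding bispan_iso_def bispan_map_def by blast
qed

lemma bispan_class_self: "is_bispan G \<omega> \<Longrightarrow> \<omega> \<in> bispan_class G \<omega>"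
  by (simp add: bispan_class_def bispan_iso_refl)

lemma bispan_class_eqI:
  assumes "is_bispan G \<omega>" "is_bispan G \<omega>'" "bispan_iso G \<omega> \<omega>'"
  shows "bispan_class G \<omega> = bispan_class G \<omega>'"
  using assms unfolding bispan_class_def by (auto intro: bispan_iso_trans bispan_iso_sym)

lemma bispan_class_iso:
  "is_bispan G \<omega>' \<Longrightarrow> bispan_class G \<omega> = bispan_class G \<omega>' \<Longrightarrow> bispan_iso G \<omega> \<omega>'"
  using bispan_class_self[of \<omega>'] by (auto simp: bispan_class_def)

lemma bispan_hom_classI:
  "is_bispan G \<omega> \<Longrightarrow> b_src \<omega> = X \<Longrightarrow> b_tgt \<omega> = Y \<Longrightarrow> bispan_class G \<omega> \<in> bispan_hom G X Y"
  by (auto simp: bispan_hom_def)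

lemma bispan_homE:
  assumes "\<Phi> \<in> bispan_hom G X Y"
  obtains \<omega> where "is_bispan G \<omega>" "b_src \<omega> = X" "b_tgt \<omega> = Y" "\<Phi> = bispan_class G \<omega>"
  using assms by (auto simp: bispan_hom_def)

lemma bispan_hom_fin: "\<Phi> \<in> bispan_hom G X Y \<Longrightarrow> fin_gset G X \<and> fin_gset G Y"
  by (auto simp: bispan_hom_def is_bispan_def dest: gmap_fin)

end

text \<open>
  The points of a composite, described without the auxiliary pullbacks: with
  \<open>\<omega> = (X \<leftarrow> A \<rightarrow> B \<rightarrow> Y)\<close> and \<open>\<omega>' = (Y \<leftarrow> C \<rightarrow> D \<rightarrow> Z)\<close>, a point \<open>\<pi>\<close> of the bottom of \<open>\<omega>''\<close> is a point
  \<open>h \<pi>\<close> of \<open>D\<close> together with a lift \<open>ev \<pi>\<close> to \<open>B\<close> of the map \<open>C \<rightarrow> Y\<close> on the fibre over \<open>h \<pi>\<close>, and a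
  point of the top is such a \<open>\<pi>\<close> together with a point \<open>c\<close> of this fibre and a point of \<open>A\<close> over
  \<open>ev \<pi> c\<close>.  This form is invariant under isomorphism of all three bispans, and it can be verified
  for concrete bispans by writing down \<open>ev\<close>, \<open>h\<close>, \<open>\<kappa>\<close>, \<open>\<alpha>\<close>.
\<close>

locale composite = group G for G (structure) +
  fixes \<omega> \<omega>' \<omega>'' :: "'a bispan"
    and ev :: "'a pt \<Rightarrow> 'a pt \<Rightarrow> 'a pt" and h \<kappa> \<alpha> :: "'a pt \<Rightarrow> 'a pt"
  assumes src: "b_src \<omega>'' = b_src \<omega>" and tgt: "b_tgt \<omega>'' = b_tgt \<omega>'"
    and h: "gmap G (b_bot \<omega>'') (b_bot \<omega>') h"
    and ev_in: "\<And>\<pi> c. \<pi> \<in> bots \<omega>'' \<Longrightarrow> c \<in> tops \<omega>' \<Longrightarrow> b_nrm \<omega>' c = h \<pi> \<Longrightarrow>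
      ev \<pi> c \<in> bots \<omega>"
    and ev_over: "\<And>\<pi> c. \<pi> \<in> bots \<omega>'' \<Longrightarrow> c \<in> tops \<omega>' \<Longrightarrow> b_nrm \<omega>' c = h \<pi> \<Longrightarrow>
      b_trf \<omega> (ev \<pi> c) = b_res \<omega>' c"
    and ev_act: "\<And>g \<pi> c. g \<in> carrier G \<Longrightarrow> \<pi> \<in> bots \<omega>'' \<Longrightarrow> c \<in> tops \<omega>' \<Longrightarrow>
      b_nrm \<omega>' c = h \<pi> \<Longrightarrow>
      ev (act (b_bot \<omega>'') g \<pi>) (act (b_top \<omega>') g c) = act (b_bot \<omega>) g (ev \<pi> c)"
    and section_ex: "\<And>d s. d \<in> bots \<omega>' \<Longrightarrow>
      (\<And>c. c \<in> tops \<omega>' \<Longrightarrow> b_nrm \<omega>' c = d \<Longrightarrow> s c \<in> bots \<omega> \<and> b_trf \<omega> (s c) = b_res \<omega>' c) \<Longrightarrow>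
      \<exists>\<pi> \<in> bots \<omega>''. h \<pi> = d \<and> (\<forall>c \<in> tops \<omega>'. b_nrm \<omega>' c = d \<longrightarrow> ev \<pi> c = s c)"
    and section_unique: "\<And>\<pi> \<pi>'. \<pi> \<in> bots \<omega>'' \<Longrightarrow> \<pi>' \<in> bots \<omega>'' \<Longrightarrow> h \<pi> = h \<pi>' \<Longrightarrow>
      (\<And>c. c \<in> tops \<omega>' \<Longrightarrow> b_nrm \<omega>' c = h \<pi> \<Longrightarrow> ev \<pi> c = ev \<pi>' c) \<Longrightarrow> \<pi> = \<pi>'"
    and \<kappa>: "gmap G (b_top \<omega>'') (b_top \<omega>') \<kappa>" and \<alpha>: "gmap G (b_top \<omega>'') (b_top \<omega>) \<alpha>"
    and nrm_\<kappa>: "\<And>m. m \<in> tops \<omega>'' \<Longrightarrow> b_nrm \<omega>' (\<kappa> m) = h (b_nrm \<omega>'' m)"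
    and nrm_\<alpha>: "\<And>m. m \<in> tops \<omega>'' \<Longrightarrow> b_nrm \<omega> (\<alpha> m) = ev (b_nrm \<omega>'' m) (\<kappa> m)"
    and top_ex: "\<And>\<pi> c a. \<pi> \<in> bots \<omega>'' \<Longrightarrow> c \<in> tops \<omega>' \<Longrightarrow> a \<in> tops \<omega> \<Longrightarrow>
      b_nrm \<omega>' c = h \<pi> \<Longrightarrow> b_nrm \<omega> a = ev \<pi> c \<Longrightarrow>
      \<exists>m \<in> tops \<omega>''. b_nrm \<omega>'' m = \<pi> \<and> \<kappa> m = c \<and> \<alpha> m = a"
    and top_unique: "\<And>m m'. m \<in> tops \<omega>'' \<Longrightarrow> m' \<in> tops \<omega>'' \<Longrightarrow>
      b_nrm \<omega>'' m = b_nrm \<omega>'' m' \<Longrightarrow> \<kappa> m = \<kappa> m' \<Longrightarrow> \<alpha> m = \<alpha> m' \<Longrightarrow> m = m'"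
    and res: "\<And>m. m \<in> tops \<omega>'' \<Longrightarrow> b_res \<omega>'' m = b_res \<omega> (\<alpha> m)"
    and trf: "\<And>\<pi>. \<pi> \<in> bots \<omega>'' \<Longrightarrow> b_trf \<omega>'' \<pi> = b_trf \<omega>' (h \<pi>)"

context group
begin

text \<open>
  A point of \<open>P\<close> over \<open>c \<in> C\<close> is a point of \<open>B\<close> with the same image in \<open>Y\<close>, so a section of \<open>P \<rightarrow> C\<close> over a fibre
  of \<open>C \<rightarrow> D\<close> is a lift \<open>ev\<close>.  A point of \<open>E\<close> is a pair of a point \<open>\<pi>\<close> of \<open>Q\<close> and a point \<open>c\<close> of the fibre over
  \<open>h \<pi>\<close>, and \<open>ev \<pi> c\<close> is the image of this point in \<open>B\<close>.
\<close>

lemma is_composite_composite: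
  assumes comp: "is_composite G \<omega> \<omega>' \<omega>''" and bi: "is_bispan G \<omega>" "is_bispan G \<omega>'"
  shows "is_bispan G \<omega>'' \<and> (\<exists>ev h \<kappa> \<alpha>. composite G \<omega> \<omega>' \<omega>'' ev h \<kappa> \<alpha>)"
proof -
  obtain P A' E Q M pB pC aA aP e t h mA mE where
    P: "pullback_square G P (b_bot \<omega>) (b_top \<omega>') (b_tgt \<omega>) pB pC (b_trf \<omega>) (b_res \<omega>')" and
    A': "pullback_square G A' (b_top \<omega>) P (b_bot \<omega>) aA aP (b_nrm \<omega>) pB" and
    exp: "exponential_diagram G P (b_top \<omega>') (b_bot \<omega>') E Q pC (b_nrm \<omega>') e t h" and
    M: "pullback_square G M A' E P mA mE aP e" and
    w: "\<omega>'' = \<lparr>b_src = b_src \<omega>, b_top = M, b_bot = Q, b_tgt = b_tgt \<omega>',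
               b_res = b_res \<omega> \<circ> aA \<circ> mA, b_nrm = t \<circ> mE, b_trf = b_trf \<omega>' \<circ> h\<rparr>"
    using comp unfolding is_composite_def by (elim exE conjE) (rule that)
  let ?v = "b_nrm \<omega>'"
  have E: "pullback_square G E (b_top \<omega>') Q (b_bot \<omega>') (pC \<circ> e) t ?v h"
    and univ: "\<And>d s. d \<in> bots \<omega>' \<Longrightarrow>
      \<forall>c \<in> tops \<omega>'. ?v c = d \<longrightarrow> s c \<in> pts P \<and> pC (s c) = c \<Longrightarrow>
      \<exists>!\<pi>. \<pi> \<in> pts Q \<and> h \<pi> = d \<and> (\<forall>x \<in> pts E. t x = \<pi> \<longrightarrow> e x = s (pC (e x)))"
    using exp unfolding exponential_diagram_def by blast+
  note gP = pullback_gmaps[OF P] and gA = pullback_gmaps[OF A'] and gE = pullback_gmaps[OF E]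
    and gM = pullback_gmaps[OF M]
  have vC: "?v (pC (e x)) = h (t x)" if "x \<in> pts E" for x
    using pullback_commutes[OF E that] by simp
  define ev where "ev \<pi> c = pB (e (THE x. x \<in> pts E \<and> pC (e x) = c \<and> t x = \<pi>))" for \<pi> c
  have ev: "ev (t x) (pC (e x)) = pB (e x)" if "x \<in> pts E" for x
  proof -
    have "(THE y. y \<in> pts E \<and> pC (e y) = pC (e x) \<and> t y = t x) = x"
      using that pullback_unique[OF E] by (intro the_equality) auto
    then show ?thesis by (simp add: ev_def)
  qed
  have ex: "\<exists>x \<in> pts E. pC (e x) = c \<and> t x = \<pi>"
    if "\<pi> \<in> pts Q" "c \<in> tops \<omega>'" "?v c = h \<pi>" for \<pi> c
    using pullback_ex[OF E that(2,1,3)] by simp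
  have aP_mA: "aP (mA m) = e (mE m)" if "m \<in> pts M" for m
    using pullback_commutes[OF M that] .
  have res: "gmap G (b_top \<omega>) (b_src \<omega>) (b_res \<omega>)" and trf: "gmap G (b_bot \<omega>') (b_tgt \<omega>') (b_trf \<omega>')"
    using bi by (auto simp: is_bispan_def)
  have "is_bispan G \<omega>''"
    unfolding is_bispan_def w using res trf gA gE gM by (auto intro!: gmap_comp)
  moreover have "composite G \<omega> \<omega>' \<omega>'' ev h (pC \<circ> e \<circ> mE) (aA \<circ> mA)"
  proof (unfold_locales; (unfold w bispan.simps)?)
    show "gmap G Q (b_bot \<omega>') h" by (fact gE(4))
    show "gmap G M (b_top \<omega>') (pC \<circ> e \<circ> mE)" "gmap G M (b_top \<omega>) (aA \<circ> mA)"
      using gE(1) gM(1,2) gA(1) by (auto intro: gmap_comp)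
  next
    fix \<pi> c assume pc: "\<pi> \<in> pts Q" "c \<in> tops \<omega>'" "?v c = h \<pi>"
    obtain x where x: "x \<in> pts E" "pC (e x) = c" "t x = \<pi>" using ex[OF pc] by blast
    have ex: "e x \<in> pts P" using gmap_in[OF gM(4) x(1)] .
    show "ev \<pi> c \<in> bots \<omega>" using ev[OF x(1)] x gmap_in[OF gP(1) ex] by simp
    show "b_trf \<omega> (ev \<pi> c) = b_res \<omega>' c" using ev[OF x(1)] x pullback_commutes[OF P ex] by simp
    fix g assume g: "g \<in> carrier G"
    have gx: "act E g x \<in> pts E" using g x(1) gmap_fin(1)[OF gE(2)] act_closed by blast
    have "pC (e (act E g x)) = act (b_top \<omega>') g c" "t (act E g x) = act Q g \<pi>"
      "pB (e (act E g x)) = act (b_bot \<omega>) g (pB (e x))"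
      using g x ex gmap_act[OF gM(4) g x(1)] gmap_act[OF gP(2) g ex] gmap_act[OF gP(1) g ex]
        gmap_act[OF gE(2) g x(1)] by simp_all
    then show "ev (act Q g \<pi>) (act (b_top \<omega>') g c) = act (b_bot \<omega>) g (ev \<pi> c)"
      using ev[OF gx] ev[OF x(1)] x by simp
  next
    fix d s assume d: "d \<in> bots \<omega>'"
      and s: "\<And>c. c \<in> tops \<omega>' \<Longrightarrow> ?v c = d \<Longrightarrow> s c \<in> bots \<omega> \<and> b_trf \<omega> (s c) = b_res \<omega>' c"
    define s' where "s' c = (SOME x. x \<in> pts P \<and> pB x = s c \<and> pC x = c)" for c
    have s': "s' c \<in> pts P \<and> pB (s' c) = s c \<and> pC (s' c) = c"
      if "c \<in> tops \<omega>'" "?v c = d" for c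
    proof -
      have "\<exists>x. x \<in> pts P \<and> pB x = s c \<and> pC x = c"
        using pullback_ex[OF P, of "s c" c] s[OF that] that by blast
      then show ?thesis unfolding s'_def by (rule someI_ex)
    qed
    obtain \<pi> where \<pi>: "\<pi> \<in> pts Q" "h \<pi> = d" "\<And>x. x \<in> pts E \<Longrightarrow> t x = \<pi> \<Longrightarrow> e x = s' (pC (e x))"
      using univ[OF d, of s'] s' by blast
    have "ev \<pi> c = s c" if c: "c \<in> tops \<omega>'" "?v c = d" for c
    proof -
      obtain x where x: "x \<in> pts E" "pC (e x) = c" "t x = \<pi>" using ex \<pi> c by metis
      then show ?thesis using ev[OF x(1)] \<pi>(3)[OF x(1,3)] s'[OF c] by simp
    qed
    then show "\<exists>\<pi> \<in> pts Q. h \<pi> = d \<and> (\<forall>c \<in> tops \<omega>'. ?v c = d \<longrightarrow> ev \<pi> c = s c)"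
      using \<pi> by blast
  next
    fix \<pi> \<pi>' assume \<pi>: "\<pi> \<in> pts Q" "\<pi>' \<in> pts Q" "h \<pi> = h \<pi>'"
      and eq: "\<And>c. c \<in> tops \<omega>' \<Longrightarrow> ?v c = h \<pi> \<Longrightarrow> ev \<pi> c = ev \<pi>' c"
    \<comment> \<open>Both points of \<open>Q\<close> satisfy the universal property for the section of \<open>P\<close> defined by the first one.\<close>
    define s where "s c = (SOME y. \<exists>x \<in> pts E. pC (e x) = c \<and> t x = \<pi> \<and> y = e x)" for c
    have s: "s (pC (e x)) = e x" if "x \<in> pts E" "t x = \<pi>" for x
      unfolding s_def
    proof (rule some_equality)
      show "\<exists>x' \<in> pts E. pC (e x') = pC (e x) \<and> t x' = \<pi> \<and> e x = e x'" using that by blast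
      fix y assume "\<exists>x' \<in> pts E. pC (e x') = pC (e x) \<and> t x' = \<pi> \<and> y = e x'"
      then show "y = e x" using pullback_unique[OF E, of _ x] that by auto
    qed
    have sec: "\<forall>c \<in> tops \<omega>'. ?v c = h \<pi> \<longrightarrow> s c \<in> pts P \<and> pC (s c) = c"
      using ex[OF \<pi>(1)] s gmap_in[OF gM(4)] by metis
    have s_\<pi>': "e x = s (pC (e x))" if x: "x \<in> pts E" "t x = \<pi>'" for x
    proof -
      have c: "pC (e x) \<in> tops \<omega>'" "?v (pC (e x)) = h \<pi>"
        using vC[OF x(1)] x \<pi> gmap_in[OF gE(1) x(1)] by auto
      then obtain y where y: "y \<in> pts E" "pC (e y) = pC (e x)" "t y = \<pi>"
        using ex[OF \<pi>(1)] by metis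
      have "pB (e y) = pB (e x)"
        using eq[OF c] ev[OF x(1)] ev[OF y(1)] x y by simp
      then have "e y = e x"
        using pullback_unique[OF P, of "e y" "e x"] gmap_in[OF gM(4)] x y by simp
      then show ?thesis using s[OF y(1,3)] by simp
    qed
    have "h \<pi> \<in> bots \<omega>'" using \<pi> gE(4) gmap_in by blast
    from univ[OF this sec] show "\<pi> = \<pi>'"
      using \<pi> s s_\<pi>' by (metis (no_types, lifting))
  next
    fix m assume m: "m \<in> pts M"
    then have mE: "mE m \<in> pts E" and mA: "mA m \<in> pts A'"
      using gM gmap_in by blast+
    show "?v ((pC \<circ> e \<circ> mE) m) = h ((t \<circ> mE) m)" using vC[OF mE] by simp
    show "b_nrm \<omega> ((aA \<circ> mA) m) = ev ((t \<circ> mE) m) ((pC \<circ> e \<circ> mE) m)"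
      using ev[OF mE] pullback_commutes[OF A' mA] aP_mA[OF m] by simp
  next
    fix \<pi> c a assume pc: "\<pi> \<in> pts Q" "c \<in> tops \<omega>'" and a: "a \<in> tops \<omega>"
      and vc: "?v c = h \<pi>" and na: "b_nrm \<omega> a = ev \<pi> c"
    obtain x where x: "x \<in> pts E" "pC (e x) = c" "t x = \<pi>" using ex[OF pc vc] by blast
    have ex: "e x \<in> pts P" using gmap_in[OF gM(4) x(1)] .
    obtain a' where a': "a' \<in> pts A'" "aA a' = a" "aP a' = e x"
      using pullback_ex[OF A' a ex] na ev[OF x(1)] x by auto
    obtain m where "m \<in> pts M" "mA m = a'" "mE m = x"
      using pullback_ex[OF M a'(1) x(1) a'(3)] by blast
    then show "\<exists>m \<in> pts M. (t \<circ> mE) m = \<pi> \<and> (pC \<circ> e \<circ> mE) m = c \<and> (aA \<circ> mA) m = a"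
      using a' x by auto
  next
    fix m m' assume m: "m \<in> pts M" "m' \<in> pts M"
      and eq: "(t \<circ> mE) m = (t \<circ> mE) m'" "(pC \<circ> e \<circ> mE) m = (pC \<circ> e \<circ> mE) m'" "(aA \<circ> mA) m = (aA \<circ> mA) m'"
    have mE: "mE m = mE m'"
      using pullback_unique[OF E, of "mE m" "mE m'"] gmap_in[OF gM(2)] m eq by simp
    moreover have "mA m = mA m'"
      using pullback_unique[OF A', of "mA m" "mA m'"] gmap_in[OF gM(1)] m eq aP_mA mE by simp
    ultimately show "m = m'" using pullback_unique[OF M m] by simp
  qed simp_all
  ultimately show ?thesis by blast
qed

text \<open>
  A point of the bottom of a composite amounts to a lift, so isomorphisms of the two factors, which
  transport lifts, induce a map between the composites.  The map obtained from the inverse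
  isomorphisms is inverse to it, because a composite has only one point for each lift.
\<close>

lemma composite_mediator:
  assumes "composite G \<omega>1 \<omega>1' \<omega>1'' ev1 h1 \<kappa>1 \<alpha>1" and "composite G \<omega>2 \<omega>2' \<omega>2'' ev2 h2 \<kappa>2 \<alpha>2"
    and bi: "is_bispan G \<omega>1'" "is_bispan G \<omega>1''" "is_bispan G \<omega>2''"
    and m: "bispan_map \<omega>1 \<omega>2 a b" and m': "bispan_map \<omega>1' \<omega>2' c d" and "bispan_map \<omega>2' \<omega>1' c' d'"
    and inv: "\<forall>x \<in> tops \<omega>1'. c' (c x) = x" "\<forall>x \<in> tops \<omega>2'. c (c' x) = x" "\<forall>x \<in> bots \<omega>1'. d' (d x) = x"
  obtains A B where "bispan_map \<omega>1'' \<omega>2'' A B"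
    "\<And>\<pi>. \<pi> \<in> bots \<omega>1'' \<Longrightarrow> h2 (B \<pi>) = d (h1 \<pi>)"
    "\<And>\<pi> x. \<pi> \<in> bots \<omega>1'' \<Longrightarrow> x \<in> tops \<omega>1' \<Longrightarrow> b_nrm \<omega>1' x = h1 \<pi> \<Longrightarrow> ev2 (B \<pi>) (c x) = b (ev1 \<pi> x)"
    "\<And>t. t \<in> tops \<omega>1'' \<Longrightarrow> \<kappa>2 (A t) = c (\<kappa>1 t)" "\<And>t. t \<in> tops \<omega>1'' \<Longrightarrow> \<alpha>2 (A t) = a (\<alpha>1 t)"
proof -
  interpret c1: composite G \<omega>1 \<omega>1' \<omega>1'' ev1 h1 \<kappa>1 \<alpha>1 by fact
  interpret c2: composite G \<omega>2 \<omega>2' \<omega>2'' ev2 h2 \<kappa>2 \<alpha>2 by fact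
  note ci = bspec[OF inv(1)] bspec[OF inv(2)] and di = bspec[OF inv(3)]
  note m = bispan_mapD[OF m] and m' = bispan_mapD[OF m'] and c' = bispan_mapD(3)[OF assms(8)]
  have v: "gmap G (b_top \<omega>1') (b_bot \<omega>1') (b_nrm \<omega>1')" and g1: "gmap G (b_top \<omega>1'') (b_bot \<omega>1'') (b_nrm \<omega>1'')"
    and g2: "gmap G (b_top \<omega>2'') (b_bot \<omega>2'') (b_nrm \<omega>2'')"
    using bi by (auto simp: is_bispan_def)
  note f = gmap_fin[OF v] gmap_fin[OF g1] gmap_fin[OF g2]
  have over: "c' y \<in> tops \<omega>1'" "b_nrm \<omega>1' (c' y) = h1 \<pi>"
    if \<pi>: "\<pi> \<in> bots \<omega>1''" and y: "y \<in> tops \<omega>2'" "b_nrm \<omega>2' y = d (h1 \<pi>)" for \<pi> y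
  proof -
    show x: "c' y \<in> tops \<omega>1'" using gmap_in[OF c' y(1)] .
    have "d' (d (b_nrm \<omega>1' (c' y))) = d' (d (h1 \<pi>))" using m'(6)[OF x] ci(2)[OF y(1)] y(2) by simp
    then show "b_nrm \<omega>1' (c' y) = h1 \<pi>" using di[OF gmap_in[OF v x]] di[OF gmap_in[OF c1.h \<pi>]] by simp
  qed
  have "\<exists>\<pi>' \<in> bots \<omega>2''. h2 \<pi>' = d (h1 \<pi>) \<and>
      (\<forall>y \<in> tops \<omega>2'. b_nrm \<omega>2' y = d (h1 \<pi>) \<longrightarrow> ev2 \<pi>' y = b (ev1 \<pi> (c' y)))"
    if \<pi>: "\<pi> \<in> bots \<omega>1''" for \<pi>
  proof (rule c2.section_ex[OF gmap_in[OF m'(4) gmap_in[OF c1.h \<pi>]]])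
    fix y assume y: "y \<in> tops \<omega>2'" "b_nrm \<omega>2' y = d (h1 \<pi>)"
    note x = over[OF \<pi> y]
    note e = c1.ev_in[OF \<pi> x]
    show "b (ev1 \<pi> (c' y)) \<in> bots \<omega>2 \<and> b_trf \<omega>2 (b (ev1 \<pi> (c' y))) = b_res \<omega>2' y"
      using gmap_in[OF m(4) e] m(7)[OF e] c1.ev_over[OF \<pi> x] m'(5)[OF x(1)] ci(2)[OF y(1)] by simp
  qed
  then obtain B where B: "\<And>\<pi>. \<pi> \<in> bots \<omega>1'' \<Longrightarrow> B \<pi> \<in> bots \<omega>2''"
    "\<And>\<pi>. \<pi> \<in> bots \<omega>1'' \<Longrightarrow> h2 (B \<pi>) = d (h1 \<pi>)"
    "\<And>\<pi> y. \<pi> \<in> bots \<omega>1'' \<Longrightarrow> y \<in> tops \<omega>2' \<Longrightarrow> b_nrm \<omega>2' y = d (h1 \<pi>) \<Longrightarrow> ev2 (B \<pi>) y = b (ev1 \<pi> (c' y))"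
    by metis
  have B_ev: "ev2 (B \<pi>) (c x) = b (ev1 \<pi> x)"
    if "\<pi> \<in> bots \<omega>1''" "x \<in> tops \<omega>1'" "b_nrm \<omega>1' x = h1 \<pi>" for \<pi> x
    using B(3)[OF that(1) gmap_in[OF m'(3) that(2)]] m'(6)[OF that(2)] ci(1)[OF that(2)] that(3) by simp
  have gB: "gmap G (b_bot \<omega>1'') (b_bot \<omega>2'') B"
  proof (rule gmapI)
    fix g \<pi> assume g: "g \<in> carrier G" and \<pi>: "\<pi> \<in> bots \<omega>1''"
    have g\<pi>: "act (b_bot \<omega>1'') g \<pi> \<in> bots \<omega>1''" using g \<pi> f act_closed by blast
    have gb: "act (b_bot \<omega>2'') g (B \<pi>) \<in> bots \<omega>2''" using g B(1)[OF \<pi>] f act_closed by blast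
    show "B (act (b_bot \<omega>1'') g \<pi>) = act (b_bot \<omega>2'') g (B \<pi>)"
    proof (rule c2.section_unique[OF B(1)[OF g\<pi>] gb])
      show "h2 (B (act (b_bot \<omega>1'') g \<pi>)) = h2 (act (b_bot \<omega>2'') g (B \<pi>))"
        using B(2)[OF g\<pi>] B(2)[OF \<pi>] gmap_act[OF c1.h g \<pi>] gmap_act[OF c2.h g B(1)[OF \<pi>]]
          gmap_act[OF m'(4) g gmap_in[OF c1.h \<pi>]] by simp
      fix y assume y: "y \<in> tops \<omega>2'" "b_nrm \<omega>2' y = h2 (B (act (b_bot \<omega>1'') g \<pi>))"
      note x = over[OF g\<pi> y(1) y(2)[unfolded B(2)[OF g\<pi>]]]
      define x0 where "x0 = act (b_top \<omega>1') (inv g) (c' y)"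
      have x0: "x0 \<in> tops \<omega>1'" "c' y = act (b_top \<omega>1') g x0"
        using x g f by (auto simp: x0_def act_closed act_inv)
      have "act (b_bot \<omega>1') g (b_nrm \<omega>1' x0) = act (b_bot \<omega>1') g (h1 \<pi>)"
        using x x0 gmap_act[OF v g x0(1)] gmap_act[OF c1.h g \<pi>] by simp
      then have vx0: "b_nrm \<omega>1' x0 = h1 \<pi>"
        using act_inject[OF f(2) g] gmap_in[OF v x0(1)] gmap_in[OF c1.h \<pi>] by simp
      have y_eq: "y = act (b_top \<omega>2') g (c x0)"
        using ci(2)[OF y(1)] x0 gmap_act[OF m'(3) g x0(1)] by simp
      have "ev2 (B (act (b_bot \<omega>1'') g \<pi>)) y = b (act (b_bot \<omega>1) g (ev1 \<pi> x0))"
        using B(3)[OF g\<pi> y(1)] y(2) B(2)[OF g\<pi>] c1.ev_act[OF g \<pi> x0(1) vx0] x0(2) by simp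
      also have "\<dots> = act (b_bot \<omega>2) g (ev2 (B \<pi>) (c x0))"
        using gmap_act[OF m(4) g c1.ev_in[OF \<pi> x0(1) vx0]] B_ev[OF \<pi> x0(1) vx0] by simp
      also have "\<dots> = ev2 (act (b_bot \<omega>2'') g (B \<pi>)) y"
        using c2.ev_act[OF g B(1)[OF \<pi>] gmap_in[OF m'(3) x0(1)]] m'(6)[OF x0(1)] vx0 B(2)[OF \<pi>] y_eq
        by simp
      finally show "ev2 (B (act (b_bot \<omega>1'') g \<pi>)) y = ev2 (act (b_bot \<omega>2'') g (B \<pi>)) y" .
    qed
  qed (use B f in auto)
  have "\<exists>t' \<in> tops \<omega>2''. b_nrm \<omega>2'' t' = B (b_nrm \<omega>1'' t) \<and> \<kappa>2 t' = c (\<kappa>1 t) \<and> \<alpha>2 t' = a (\<alpha>1 t)"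
    if t: "t \<in> tops \<omega>1''" for t
  proof -
    note n = gmap_in[OF g1 t] and k = gmap_in[OF c1.\<kappa> t] and al = gmap_in[OF c1.\<alpha> t]
    show ?thesis
    proof (rule c2.top_ex[OF B(1)[OF n] gmap_in[OF m'(3) k] gmap_in[OF m(3) al]])
      show "b_nrm \<omega>2' (c (\<kappa>1 t)) = h2 (B (b_nrm \<omega>1'' t))"
        using m'(6)[OF k] c1.nrm_\<kappa>[OF t] B(2)[OF n] by simp
      show "b_nrm \<omega>2 (a (\<alpha>1 t)) = ev2 (B (b_nrm \<omega>1'' t)) (c (\<kappa>1 t))"
        using m(6)[OF al] c1.nrm_\<alpha>[OF t] B_ev[OF n k c1.nrm_\<kappa>[OF t]] by simp
    qed
  qed
  then obtain A where A: "\<And>t. t \<in> tops \<omega>1'' \<Longrightarrow> A t \<in> tops \<omega>2''"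
    "\<And>t. t \<in> tops \<omega>1'' \<Longrightarrow> b_nrm \<omega>2'' (A t) = B (b_nrm \<omega>1'' t)"
    "\<And>t. t \<in> tops \<omega>1'' \<Longrightarrow> \<kappa>2 (A t) = c (\<kappa>1 t)" "\<And>t. t \<in> tops \<omega>1'' \<Longrightarrow> \<alpha>2 (A t) = a (\<alpha>1 t)"
    by metis
  have gA: "gmap G (b_top \<omega>1'') (b_top \<omega>2'') A"
  proof (rule gmapI)
    fix g t assume g: "g \<in> carrier G" and t: "t \<in> tops \<omega>1''"
    have gt: "act (b_top \<omega>1'') g t \<in> tops \<omega>1''" using g t f act_closed by blast
    have ga: "act (b_top \<omega>2'') g (A t) \<in> tops \<omega>2''" using g A(1)[OF t] f act_closed by blast
    show "A (act (b_top \<omega>1'') g t) = act (b_top \<omega>2'') g (A t)"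
    proof (rule c2.top_unique[OF A(1)[OF gt] ga])
      show "b_nrm \<omega>2'' (A (act (b_top \<omega>1'') g t)) = b_nrm \<omega>2'' (act (b_top \<omega>2'') g (A t))"
        using A(2)[OF gt] A(2)[OF t] gmap_act[OF g1 g t] gmap_act[OF g2 g A(1)[OF t]]
          gmap_act[OF gB g gmap_in[OF g1 t]] by simp
      show "\<kappa>2 (A (act (b_top \<omega>1'') g t)) = \<kappa>2 (act (b_top \<omega>2'') g (A t))"
        using A(3)[OF gt] A(3)[OF t] gmap_act[OF c1.\<kappa> g t] gmap_act[OF c2.\<kappa> g A(1)[OF t]]
          gmap_act[OF m'(3) g gmap_in[OF c1.\<kappa> t]] by simp
      show "\<alpha>2 (A (act (b_top \<omega>1'') g t)) = \<alpha>2 (act (b_top \<omega>2'') g (A t))"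
        using A(4)[OF gt] A(4)[OF t] gmap_act[OF c1.\<alpha> g t] gmap_act[OF c2.\<alpha> g A(1)[OF t]]
          gmap_act[OF m(3) g gmap_in[OF c1.\<alpha> t]] by simp
    qed
  qed (use A f in auto)
  have "b_res \<omega>2'' (A t) = b_res \<omega>1'' t" if "t \<in> tops \<omega>1''" for t
    using c2.res[OF A(1)[OF that]] c1.res[OF that] A(4)[OF that] m(5)[OF gmap_in[OF c1.\<alpha> that]] by simp
  moreover have "b_trf \<omega>2'' (B \<pi>) = b_trf \<omega>1'' \<pi>" if "\<pi> \<in> bots \<omega>1''" for \<pi>
    using c2.trf[OF B(1)[OF that]] c1.trf[OF that] B(2)[OF that] m'(7)[OF gmap_in[OF c1.h that]] by simp
  ultimately have "bispan_map \<omega>1'' \<omega>2'' A B"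
    using gA gB A(2) m(1) m'(2) c1.src c2.src c1.tgt c2.tgt by (simp add: bispan_map_def)
  then show thesis by (rule that[OF _ B(2) B_ev A(3,4)])
qed

lemma composite_unique:
  assumes c1: "composite G \<omega>1 \<omega>1' \<omega>1'' ev1 h1 \<kappa>1 \<alpha>1" and c2: "composite G \<omega>2 \<omega>2' \<omega>2'' ev2 h2 \<kappa>2 \<alpha>2"
    and bi: "is_bispan G \<omega>1" "is_bispan G \<omega>1'" "is_bispan G \<omega>1''" "is_bispan G \<omega>2'" "is_bispan G \<omega>2''"
    and iso: "bispan_iso G \<omega>1 \<omega>2" "bispan_iso G \<omega>1' \<omega>2'"
  shows "bispan_iso G \<omega>1'' \<omega>2''"
proof -
  interpret c1: composite G \<omega>1 \<omega>1' \<omega>1'' ev1 h1 \<kappa>1 \<alpha>1 by fact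
  interpret c2: composite G \<omega>2 \<omega>2' \<omega>2'' ev2 h2 \<kappa>2 \<alpha>2 by fact
  obtain a b a' b' where m: "bispan_map \<omega>1 \<omega>2 a b" "bispan_map \<omega>2 \<omega>1 a' b'" and
    ai: "\<And>x. x \<in> tops \<omega>1 \<Longrightarrow> a' (a x) = x" "\<And>x. x \<in> tops \<omega>2 \<Longrightarrow> a (a' x) = x" and
    bi': "\<And>x. x \<in> bots \<omega>1 \<Longrightarrow> b' (b x) = x" "\<And>x. x \<in> bots \<omega>2 \<Longrightarrow> b (b' x) = x"
    by (rule bispan_isoE[OF iso(1) bi(1)]) (rule that)
  obtain c d c' d' where m': "bispan_map \<omega>1' \<omega>2' c d" "bispan_map \<omega>2' \<omega>1' c' d'" and
    ci: "\<And>x. x \<in> tops \<omega>1' \<Longrightarrow> c' (c x) = x" "\<And>x. x \<in> tops \<omega>2' \<Longrightarrow> c (c' x) = x" and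
    di: "\<And>x. x \<in> bots \<omega>1' \<Longrightarrow> d' (d x) = x" "\<And>x. x \<in> bots \<omega>2' \<Longrightarrow> d (d' x) = x"
    by (rule bispan_isoE[OF iso(2) bi(2)]) (rule that)
  have inv: "\<forall>x \<in> tops \<omega>1'. c' (c x) = x" "\<forall>x \<in> tops \<omega>2'. c (c' x) = x"
    "\<forall>x \<in> bots \<omega>1'. d' (d x) = x" "\<forall>x \<in> bots \<omega>2'. d (d' x) = x"
    using ci di by auto
  obtain A B where M: "bispan_map \<omega>1'' \<omega>2'' A B" and AB: "\<And>\<pi>. \<pi> \<in> bots \<omega>1'' \<Longrightarrow> h2 (B \<pi>) = d (h1 \<pi>)"
    "\<And>\<pi> x. \<pi> \<in> bots \<omega>1'' \<Longrightarrow> x \<in> tops \<omega>1' \<Longrightarrow> b_nrm \<omega>1' x = h1 \<pi> \<Longrightarrow> ev2 (B \<pi>) (c x) = b (ev1 \<pi> x)"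
    "\<And>t. t \<in> tops \<omega>1'' \<Longrightarrow> \<kappa>2 (A t) = c (\<kappa>1 t)" "\<And>t. t \<in> tops \<omega>1'' \<Longrightarrow> \<alpha>2 (A t) = a (\<alpha>1 t)"
    by (rule composite_mediator[OF c1 c2 bi(2,3,5) m(1) m' inv(1,2,3)]) (rule that)
  obtain A' B' where M': "bispan_map \<omega>2'' \<omega>1'' A' B'" and AB': "\<And>\<pi>. \<pi> \<in> bots \<omega>2'' \<Longrightarrow> h1 (B' \<pi>) = d' (h2 \<pi>)"
    "\<And>\<pi> x. \<pi> \<in> bots \<omega>2'' \<Longrightarrow> x \<in> tops \<omega>2' \<Longrightarrow> b_nrm \<omega>2' x = h2 \<pi> \<Longrightarrow> ev1 (B' \<pi>) (c' x) = b' (ev2 \<pi> x)"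
    "\<And>t. t \<in> tops \<omega>2'' \<Longrightarrow> \<kappa>1 (A' t) = c' (\<kappa>2 t)" "\<And>t. t \<in> tops \<omega>2'' \<Longrightarrow> \<alpha>1 (A' t) = a' (\<alpha>2 t)"
    by (rule composite_mediator[OF c2 c1 bi(4,5,3) m(2) m'(2,1) inv(2,1,4)]) (rule that)
  note f = bispan_mapD[OF M] and f' = bispan_mapD[OF M'] and n = bispan_mapD[OF m'(1)] and n' = bispan_mapD[OF m'(2)]
  have B'B: "B' (B \<pi>) = \<pi>" if \<pi>: "\<pi> \<in> bots \<omega>1''" for \<pi>
  proof (rule c1.section_unique[OF gmap_in[OF f'(4) gmap_in[OF f(4) \<pi>]] \<pi>])
    show hh: "h1 (B' (B \<pi>)) = h1 \<pi>"
      using AB'(1)[OF gmap_in[OF f(4) \<pi>]] AB(1)[OF \<pi>] di(1)[OF gmap_in[OF c1.h \<pi>]] by simp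
    fix x assume x: "x \<in> tops \<omega>1'" "b_nrm \<omega>1' x = h1 (B' (B \<pi>))"
    show "ev1 (B' (B \<pi>)) x = ev1 \<pi> x"
      using AB'(2)[OF gmap_in[OF f(4) \<pi>] gmap_in[OF n(3) x(1)]] n(6)[OF x(1)] AB(1)[OF \<pi>] x hh
        AB(2)[OF \<pi> x(1)] ci(1)[OF x(1)] bi'(1)[OF c1.ev_in[OF \<pi> x(1)]] by simp
  qed
  have BB': "B (B' \<pi>) = \<pi>" if \<pi>: "\<pi> \<in> bots \<omega>2''" for \<pi>
  proof (rule c2.section_unique[OF gmap_in[OF f(4) gmap_in[OF f'(4) \<pi>]] \<pi>])
    show hh: "h2 (B (B' \<pi>)) = h2 \<pi>"
      using AB(1)[OF gmap_in[OF f'(4) \<pi>]] AB'(1)[OF \<pi>] di(2)[OF gmap_in[OF c2.h \<pi>]] by simp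
    fix x assume x: "x \<in> tops \<omega>2'" "b_nrm \<omega>2' x = h2 (B (B' \<pi>))"
    show "ev2 (B (B' \<pi>)) x = ev2 \<pi> x"
      using AB(2)[OF gmap_in[OF f'(4) \<pi>] gmap_in[OF n'(3) x(1)]] n'(6)[OF x(1)] AB'(1)[OF \<pi>] x hh
        AB'(2)[OF \<pi> x(1)] ci(2)[OF x(1)] bi'(2)[OF c2.ev_in[OF \<pi> x(1)]] by simp
  qed
  have g1: "gmap G (b_top \<omega>1'') (b_bot \<omega>1'') (b_nrm \<omega>1'')" and g2: "gmap G (b_top \<omega>2'') (b_bot \<omega>2'') (b_nrm \<omega>2'')"
    using bi by (auto simp: is_bispan_def)
  show ?thesis
  proof (rule bispan_isoI[OF M M' _ _ B'B BB'])
    fix t assume t: "t \<in> tops \<omega>1''"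
    note At = gmap_in[OF f(3) t]
    show "A' (A t) = t"
      using f(6)[OF t] f'(6)[OF At] B'B[OF gmap_in[OF g1 t]] AB(3,4)[OF t] AB'(3,4)[OF At]
        ci(1)[OF gmap_in[OF c1.\<kappa> t]] ai(1)[OF gmap_in[OF c1.\<alpha> t]]
      by (intro c1.top_unique[OF gmap_in[OF f'(3) At] t]) simp_all
  next
    fix t assume t: "t \<in> tops \<omega>2''"
    note At = gmap_in[OF f'(3) t]
    show "A (A' t) = t"
      using f'(6)[OF t] f(6)[OF At] BB'[OF gmap_in[OF g2 t]] AB'(3,4)[OF t] AB(3,4)[OF At]
        ci(2)[OF gmap_in[OF c2.\<kappa> t]] ai(2)[OF gmap_in[OF c2.\<alpha> t]]
      by (intro c2.top_unique[OF gmap_in[OF f(3) At] t]) simp_all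
  qed
qed

lemma composite_exists:
  assumes bi: "is_bispan G \<omega>" "is_bispan G \<omega>'" and t: "b_tgt \<omega> = b_src \<omega>'"
  shows "\<exists>\<omega>''. is_composite G \<omega> \<omega>' \<omega>''"
proof -
  have g: "gmap G (b_top \<omega>) (b_bot \<omega>) (b_nrm \<omega>)" "gmap G (b_bot \<omega>) (b_tgt \<omega>) (b_trf \<omega>)"
    "gmap G (b_top \<omega>') (b_tgt \<omega>) (b_res \<omega>')" "gmap G (b_top \<omega>') (b_bot \<omega>') (b_nrm \<omega>')"
    using bi t by (auto simp: is_bispan_def)
  obtain P pB pC where
    P: "pullback_square G P (b_bot \<omega>) (b_top \<omega>') (b_tgt \<omega>) pB pC (b_trf \<omega>) (b_res \<omega>')"
    using pullback_exists[OF g(2,3)] .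
  obtain A' aA aP where A': "pullback_square G A' (b_top \<omega>) P (b_bot \<omega>) aA aP (b_nrm \<omega>) pB"
    using pullback_exists[OF g(1) pullback_gmaps(1)[OF P]] .
  obtain E Q e t h where
    E: "exponential_diagram G P (b_top \<omega>') (b_bot \<omega>') E Q pC (b_nrm \<omega>') e t h"
    using exponential_exists[OF pullback_gmaps(2)[OF P] g(4)] .
  then have "gmap G E P e" by (simp add: exponential_diagram_def)
  then obtain M mA mE where "pullback_square G M A' E P mA mE aP e"
    using pullback_exists[OF pullback_gmaps(2)[OF A']] by metis
  with P A' E show ?thesis unfolding is_composite_def by blast
qed

text \<open>
  Composition of classes is defined as a union over all representatives and all composites of these.
  By the uniqueness of composites the union consists of a single class.
\<close>

lemma bispan_comp_class:
  assumes bi: "is_bispan G \<omega>" "is_bispan G \<omega>'" "is_bispan G \<omega>''" and t: "b_tgt \<omega> = b_src \<omega>'"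
    and comp: "composite G \<omega> \<omega>' \<omega>'' ev h \<kappa> \<alpha>"
  shows "bispan_comp G (bispan_class G \<omega>') (bispan_class G \<omega>) = bispan_class G \<omega>''"
proof -
  have eq: "bispan_class G \<omega>''' = bispan_class G \<omega>''"
    if w: "\<omega>0 \<in> bispan_class G \<omega>" "\<omega>0' \<in> bispan_class G \<omega>'" "is_composite G \<omega>0 \<omega>0' \<omega>'''" for \<omega>0 \<omega>0' \<omega>'''
  proof -
    have bi0: "is_bispan G \<omega>0" "is_bispan G \<omega>0'" and iso: "bispan_iso G \<omega> \<omega>0" "bispan_iso G \<omega>' \<omega>0'"
      using w by (auto simp: bispan_class_def)
    obtain ev1 h1 \<kappa>1 \<alpha>1 where c1: "is_bispan G \<omega>'''" "composite G \<omega>0 \<omega>0' \<omega>''' ev1 h1 \<kappa>1 \<alpha>1"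
      using is_composite_composite[OF w(3) bi0] by blast
    show ?thesis
      using composite_unique[OF comp c1(2) bi bi0(2) c1(1) iso] c1(1) bi(3) by (intro bispan_class_eqI[symmetric])
  qed
  obtain \<omega>c where "is_composite G \<omega> \<omega>' \<omega>c" using composite_exists[OF bi(1,2) t] by blast
  with eq bi(1,2)[THEN bispan_class_self] have "bispan_class G \<omega>'' \<in>
      {bispan_class G \<omega>c | \<omega>0 \<omega>0' \<omega>c. \<omega>0 \<in> bispan_class G \<omega> \<and> \<omega>0' \<in> bispan_class G \<omega>' \<and>
        is_composite G \<omega>0 \<omega>0' \<omega>c}"
    by blast
  then show ?thesis unfolding bispan_comp_def using eq by blast
qed

lemma bispan_comp_hom:
  assumes "\<Phi> \<in> bispan_hom G X Y" "\<Psi> \<in> bispan_hom G Y Z"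
  shows "bispan_comp G \<Psi> \<Phi> \<in> bispan_hom G X Z"
proof -
  obtain \<omega> where w: "is_bispan G \<omega>" "b_src \<omega> = X" "b_tgt \<omega> = Y" "\<Phi> = bispan_class G \<omega>"
    using assms(1) by (rule bispan_homE)
  obtain \<omega>' where w': "is_bispan G \<omega>'" "b_src \<omega>' = Y" "b_tgt \<omega>' = Z" "\<Psi> = bispan_class G \<omega>'"
    using assms(2) by (rule bispan_homE)
  have t: "b_tgt \<omega> = b_src \<omega>'" using w w' by simp
  obtain \<omega>'' where w'': "is_composite G \<omega> \<omega>' \<omega>''" using composite_exists[OF w(1) w'(1) t] by blast
  obtain ev h \<kappa> \<alpha> where c: "is_bispan G \<omega>''" "composite G \<omega> \<omega>' \<omega>'' ev h \<kappa> \<alpha>"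
    using is_composite_composite[OF w'' w(1) w'(1)] by blast
  interpret composite G \<omega> \<omega>' \<omega>'' ev h \<kappa> \<alpha> by fact
  show ?thesis
    using bispan_comp_class[OF w(1) w'(1) c(1) t c(2)] w w' c src tgt
    by (simp add: bispan_hom_classI)
qed

end

section \<open>Disjoint unions are products of bispans\<close>

context group
begin

lemma gmap_if:
  assumes f: "gmap G (subgset X S) Y f" and f': "gmap G (subgset X T) Y f'"
    and X: "fin_gset G X" "pts X = S \<union> T" "S \<inter> T = {}"
  shows "gmap G X Y (\<lambda>x. if x \<in> S then f x else f' x)"
proof (rule gmapI)
  fix x assume "x \<in> pts X"
  then show "(if x \<in> S then f x else f' x) \<in> pts Y"
    using gmap_in[OF f] gmap_in[OF f'] X by auto
  fix g assume g: "g \<in> carrier G"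
  have "act X g x \<in> S" if "x \<in> S" using act_closed[OF gmap_fin(1)[OF f] g, of x] that by simp
  moreover have "act X g x \<in> T" if "x \<in> T" using act_closed[OF gmap_fin(1)[OF f'] g, of x] that by simp
  ultimately show "(if act X g x \<in> S then f (act X g x) else f' (act X g x)) =
      act Y g (if x \<in> S then f x else f' x)"
    using \<open>x \<in> pts X\<close> X gmap_act[OF f g, of x] gmap_act[OF f' g, of x] by auto
qed (use f X gmap_fin in auto)

lemma gmap_from_subgset:
  assumes f: "gmap G X (subgset Y S) f" and Y: "fin_gset G Y" "S \<subseteq> pts Y"
  shows "gmap G X Y f"
proof (rule gmapI)
  show "f (act X g x) = act Y g (f x)" if "g \<in> carrier G" "x \<in> pts X" for g x
    using gmap_act[OF f that] gmap_in[OF f that(2)] by simp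
  show "f x \<in> pts Y" if "x \<in> pts X" for x
    using gmap_in[OF f that] Y by auto
qed (use f Y gmap_fin in auto)

lemma gmap_if_bij:
  assumes f: "gmap G (subgset X S) (subgset Y S') f" and f': "gmap G (subgset X T) (subgset Y T') f'"
    and bij: "bij_betw f S S'" "bij_betw f' T T'"
    and X: "fin_gset G X" "pts X = S \<union> T" and Y: "fin_gset G Y" "pts Y = S' \<union> T'"
    and disj: "S \<inter> T = {}" "S' \<inter> T' = {}"
  shows "gmap G X Y (\<lambda>x. if x \<in> S then f x else f' x)"
    and "bij_betw (\<lambda>x. if x \<in> S then f x else f' x) (pts X) (pts Y)"
proof -
  show "gmap G X Y (\<lambda>x. if x \<in> S then f x else f' x)"
    using Y by (intro gmap_if[OF gmap_from_subgset[OF f] gmap_from_subgset[OF f'] X disj(1)]) auto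
  have "bij_betw (\<lambda>x. if x \<in> S then f x else f' x) S S'" "bij_betw (\<lambda>x. if x \<in> S then f x else f' x) T T'"
    using bij disj(1) by (subst bij_betw_cong; auto)+
  then show "bij_betw (\<lambda>x. if x \<in> S then f x else f' x) (pts X) (pts Y)"
    unfolding X(2) Y(2) using disj(2) by (rule bij_betw_combine)
qed

text \<open>
  The part of a bispan that lies over one summand of its target, where \<open>i\<close> is the inclusion of the
  summand \<open>W\<close>.  The fold map serves as a common left inverse of both inclusions.
\<close>

definition bispan_part :: "'a bispan \<Rightarrow> 'a gset \<Rightarrow> ('a pt \<Rightarrow> 'a pt) \<Rightarrow> 'a bispan" where
  "bispan_part \<omega> W i =
     \<lparr>b_src = b_src \<omega>, b_top = subgset (b_top \<omega>) {a \<in> tops \<omega>. b_trf \<omega> (b_nrm \<omega> a) \<in> i ` pts W},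
      b_bot = subgset (b_bot \<omega>) {b \<in> bots \<omega>. b_trf \<omega> b \<in> i ` pts W}, b_tgt = W,
      b_res = b_res \<omega>, b_nrm = b_nrm \<omega>, b_trf = gfold \<circ> b_trf \<omega>\<rparr>"

text \<open>
  In a composite with a restriction the fibres of the norm leg are single points, so a lift is just a
  point of the bottom that lies over the summand.
\<close>

lemma restriction_comp_part:
  assumes w: "is_bispan G \<omega>" "b_tgt \<omega> = XY"
    and W: "fin_gset G W" and i: "gmap G W XY i" and gi: "\<And>x. gfold (i x) = x"
  shows "bispan_comp G (restriction G W XY i) (bispan_class G \<omega>) = bispan_class G (bispan_part \<omega> W i)"
    and "is_bispan G (bispan_part \<omega> W i)"
proof -
  let ?A = "subgset (b_top \<omega>) {a \<in> tops \<omega>. b_trf \<omega> (b_nrm \<omega> a) \<in> i ` pts W}"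
  let ?B = "subgset (b_bot \<omega>) {b \<in> bots \<omega>. b_trf \<omega> b \<in> i ` pts W}"
  let ?w = "\<lparr>b_src = b_src \<omega>, b_top = ?A, b_bot = ?B, b_tgt = W,
     b_res = b_res \<omega>, b_nrm = b_nrm \<omega>, b_trf = gfold \<circ> b_trf \<omega>\<rparr>"
  have g: "gmap G (b_top \<omega>) (b_src \<omega>) (b_res \<omega>)" "gmap G (b_top \<omega>) (b_bot \<omega>) (b_nrm \<omega>)"
    "gmap G (b_bot \<omega>) XY (b_trf \<omega>)"
    using w by (auto simp: is_bispan_def)
  note fins = gmap_fin[OF g(2)]
  have cl: "b_trf \<omega> (act (b_bot \<omega>) g b) \<in> i ` pts W"
    if "g \<in> carrier G" "b \<in> bots \<omega>" "b_trf \<omega> b \<in> i ` pts W" for g b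
  proof -
    from that obtain x where x: "x \<in> pts W" "b_trf \<omega> b = i x" by blast
    have "b_trf \<omega> (act (b_bot \<omega>) g b) = i (act W g x)"
      using gmap_act[OF g(3) that(1,2)] gmap_act[OF i that(1) x(1)] x by simp
    then show ?thesis using act_closed[OF W that(1) x(1)] by blast
  qed
  have B: "fin_gset G ?B" using fins cl by (intro fin_subgset) (auto simp: act_closed)
  have clA: "act (b_top \<omega>) g a \<in> {a \<in> tops \<omega>. b_trf \<omega> (b_nrm \<omega> a) \<in> i ` pts W}"
    if "g \<in> carrier G" "a \<in> {a \<in> tops \<omega>. b_trf \<omega> (b_nrm \<omega> a) \<in> i ` pts W}" for g a
    using that fins cl[OF that(1), of "b_nrm \<omega> a"]
    by (auto simp: act_closed gmap_act[OF g(2)] gmap_in[OF g(2)])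
  have clB: "act (b_bot \<omega>) g b \<in> {b \<in> bots \<omega>. b_trf \<omega> b \<in> i ` pts W}"
    if "g \<in> carrier G" "b \<in> {b \<in> bots \<omega>. b_trf \<omega> b \<in> i ` pts W}" for g b
    using that fins cl by (auto simp: act_closed)
  have gA: "gmap G ?A (b_src \<omega>) (b_res \<omega>)" by (rule gmap_subgset[OF g(1) _ clA]) auto
  have gAB: "gmap G ?A ?B (b_nrm \<omega>)"
    by (rule gmap_into_subgset[OF _ B]) (auto intro!: gmap_subgset[OF g(2) _ clA] simp: gmap_in[OF g(2)])
  have gBX: "gmap G ?B XY (b_trf \<omega>)" by (rule gmap_subgset[OF g(3) _ clB]) auto
  have gB: "gmap G ?B W (gfold \<circ> b_trf \<omega>)"
  proof (rule gmapI[OF B W])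
    fix g b assume g': "g \<in> carrier G" and b: "b \<in> pts ?B"
    then obtain x where x: "x \<in> pts W" "b_trf \<omega> b = i x" by auto
    show "(gfold \<circ> b_trf \<omega>) (act ?B g b) = act W g ((gfold \<circ> b_trf \<omega>) b)"
      using gmap_act[OF gBX g' b] gmap_act[OF i g' x(1)] x gi
      by (metis comp_apply)
  qed (use gi in auto)
  have w': "is_bispan G ?w" using gA gAB gB by (simp add: is_bispan_def)
  have gAW: "gmap G ?A W (gfold \<circ> b_trf \<omega> \<circ> b_nrm \<omega>)" using gmap_comp[OF gAB gB] .
  have gAA: "gmap G ?A (b_top \<omega>) id" using gmap_subgset[OF gmap_id[OF fins(1)] _ clA] by auto
  have gBB: "gmap G ?B (b_bot \<omega>) id" using gmap_subgset[OF gmap_id[OF fins(2)] _ clB] by auto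
  let ?r = "\<lparr>b_src = XY, b_top = W, b_bot = W, b_tgt = W, b_res = i, b_nrm = id, b_trf = id\<rparr>"
  have r: "is_bispan G ?r" using i W by (simp add: is_bispan_def gmap_id)
  have iW: "i (gfold y) = y" if "y \<in> i ` pts W" for y using that gi by auto
  have "composite G \<omega> ?r ?w (\<lambda>\<pi> c. \<pi>) (gfold \<circ> b_trf \<omega>) (gfold \<circ> b_trf \<omega> \<circ> b_nrm \<omega>) id"
  proof (unfold_locales, goal_cases)
    case (7 d s)
    then have "s d \<in> bots \<omega>" "b_trf \<omega> (s d) = i d" "d \<in> pts W" by auto
    then show ?case using gi by (intro bexI[of _ "s d"]) auto
  next
    case (8 \<pi> \<pi>')
    have "\<pi> = \<pi>'" using 8(4)[of "(gfold \<circ> b_trf \<omega>) \<pi>"] 8(1) gi by auto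
    then show ?case .
  qed (use w gA gAB gB gAW gAA iW gi in \<open>auto simp: gmap_in\<close>)
  then show "bispan_comp G (restriction G W XY i) (bispan_class G \<omega>) = bispan_class G (bispan_part \<omega> W i)"
    using bispan_comp_class[OF w(1) r w'] w(2) by (simp add: restriction_def bispan_part_def)
  show "is_bispan G (bispan_part \<omega> W i)" using w' by (simp add: bispan_part_def)
qed

text \<open>
  The target decides to which part a point belongs, hence isomorphisms of the parts can be put together.
\<close>

lemma bispan_iso_parts:
  assumes w: "is_bispan G \<omega>" "b_tgt \<omega> = gsum X Y" and w': "is_bispan G \<omega>'" "b_tgt \<omega>' = gsum X Y"
    and src: "b_src \<omega> = b_src \<omega>'"
    and iso: "bispan_iso G (bispan_part \<omega> X InL) (bispan_part \<omega>' X InL)"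
      "bispan_iso G (bispan_part \<omega> Y InR) (bispan_part \<omega>' Y InR)"
  shows "bispan_iso G \<omega> \<omega>'"
proof -
  define A where "A i W \<nu> = {a \<in> tops \<nu>. b_trf \<nu> (b_nrm \<nu> a) \<in> i ` pts W}"
    for i :: "'a pt \<Rightarrow> 'a pt" and W :: "'a gset" and \<nu> :: "'a bispan"
  define B where "B i W \<nu> = {b \<in> bots \<nu>. b_trf \<nu> b \<in> i ` pts W}"
    for i :: "'a pt \<Rightarrow> 'a pt" and W :: "'a gset" and \<nu> :: "'a bispan"
  have split: "tops \<nu> = A InL X \<nu> \<union> A InR Y \<nu>" "bots \<nu> = B InL X \<nu> \<union> B InR Y \<nu>"
    "fin_gset G (b_top \<nu>)" "fin_gset G (b_bot \<nu>)" "\<And>x. x \<in> A InL X \<nu> \<Longrightarrow> b_nrm \<nu> x \<in> B InL X \<nu>"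
    "\<And>x. x \<in> A InR Y \<nu> \<Longrightarrow> b_nrm \<nu> x \<in> B InR Y \<nu>"
    if n: "is_bispan G \<nu>" "b_tgt \<nu> = gsum X Y" for \<nu>
  proof -
    have g: "gmap G (b_top \<nu>) (b_bot \<nu>) (b_nrm \<nu>)" "gmap G (b_bot \<nu>) (gsum X Y) (b_trf \<nu>)"
      using n by (auto simp: is_bispan_def)
    have t: "b_trf \<nu> b \<in> InL ` pts X \<union> InR ` pts Y" if "b \<in> bots \<nu>" for b
      using gmap_in[OF g(2) that] by (simp add: pts_gsum)
    show "bots \<nu> = B InL X \<nu> \<union> B InR Y \<nu>" using t unfolding B_def by blast
    show "tops \<nu> = A InL X \<nu> \<union> A InR Y \<nu>" using t[OF gmap_in[OF g(1)]] unfolding A_def by blast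
    show "\<And>x. x \<in> A InL X \<nu> \<Longrightarrow> b_nrm \<nu> x \<in> B InL X \<nu>" "\<And>x. x \<in> A InR Y \<nu> \<Longrightarrow> b_nrm \<nu> x \<in> B InR Y \<nu>"
      using gmap_in[OF g(1)] unfolding A_def B_def by auto
    show "fin_gset G (b_top \<nu>)" "fin_gset G (b_bot \<nu>)" using gmap_fin[OF g(1)] .
  qed
  have disj: "A InL X \<nu> \<inter> A InR Y \<nu> = {}" "B InL X \<nu> \<inter> B InR Y \<nu> = {}" for \<nu>
    unfolding A_def B_def by auto
  have parts: "\<exists>a b. gmap G (subgset (b_top \<omega>) (A i W \<omega>)) (subgset (b_top \<omega>') (A i W \<omega>')) a \<and>
      bij_betw a (A i W \<omega>) (A i W \<omega>') \<and>
      gmap G (subgset (b_bot \<omega>) (B i W \<omega>)) (subgset (b_bot \<omega>') (B i W \<omega>')) b \<and>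
      bij_betw b (B i W \<omega>) (B i W \<omega>') \<and>
      (\<forall>x \<in> A i W \<omega>. b_res \<omega>' (a x) = b_res \<omega> x \<and> b_nrm \<omega>' (a x) = b (b_nrm \<omega> x)) \<and>
      (\<forall>x \<in> B i W \<omega>. b_trf \<omega>' (b x) = b_trf \<omega> x)"
    if iso: "bispan_iso G (bispan_part \<omega> W i) (bispan_part \<omega>' W i)" and gi: "\<And>x. gfold (i x) = x" for W i
  proof -
    obtain a b where ab: "gmap G (subgset (b_top \<omega>) (A i W \<omega>)) (subgset (b_top \<omega>') (A i W \<omega>')) a"
      "bij_betw a (A i W \<omega>) (A i W \<omega>')"
      "gmap G (subgset (b_bot \<omega>) (B i W \<omega>)) (subgset (b_bot \<omega>') (B i W \<omega>')) b"
      "bij_betw b (B i W \<omega>) (B i W \<omega>')"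
      "\<forall>x \<in> A i W \<omega>. b_res \<omega>' (a x) = b_res \<omega> x \<and> b_nrm \<omega>' (a x) = b (b_nrm \<omega> x)"
      and g: "\<forall>x \<in> B i W \<omega>. gfold (b_trf \<omega>' (b x)) = gfold (b_trf \<omega> x)"
      using iso unfolding bispan_iso_def bispan_part_def bispan.simps pts_subgset comp_apply
        A_def[symmetric] B_def[symmetric] by (elim conjE exE) (rule that)
    have "b_trf \<omega>' (b x) = b_trf \<omega> x" if x: "x \<in> B i W \<omega>" for x
    proof -
      have "b x \<in> B i W \<omega>'" using ab(4) x by (rule bij_betwE[rule_format])
      then show ?thesis using x bspec[OF g x] gi by (auto simp: B_def)
    qed
    with ab show ?thesis by blast
  qed
  obtain a1 b1 where L: "gmap G (subgset (b_top \<omega>) (A InL X \<omega>)) (subgset (b_top \<omega>') (A InL X \<omega>')) a1"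
    "bij_betw a1 (A InL X \<omega>) (A InL X \<omega>')"
    "gmap G (subgset (b_bot \<omega>) (B InL X \<omega>)) (subgset (b_bot \<omega>') (B InL X \<omega>')) b1"
    "bij_betw b1 (B InL X \<omega>) (B InL X \<omega>')"
    "\<forall>x \<in> A InL X \<omega>. b_res \<omega>' (a1 x) = b_res \<omega> x \<and> b_nrm \<omega>' (a1 x) = b1 (b_nrm \<omega> x)"
    "\<forall>x \<in> B InL X \<omega>. b_trf \<omega>' (b1 x) = b_trf \<omega> x"
    using parts[OF iso(1) gfold.simps(1)] by (elim conjE exE) (rule that)
  obtain a2 b2 where R: "gmap G (subgset (b_top \<omega>) (A InR Y \<omega>)) (subgset (b_top \<omega>') (A InR Y \<omega>')) a2"
    "bij_betw a2 (A InR Y \<omega>) (A InR Y \<omega>')"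
    "gmap G (subgset (b_bot \<omega>) (B InR Y \<omega>)) (subgset (b_bot \<omega>') (B InR Y \<omega>')) b2"
    "bij_betw b2 (B InR Y \<omega>) (B InR Y \<omega>')"
    "\<forall>x \<in> A InR Y \<omega>. b_res \<omega>' (a2 x) = b_res \<omega> x \<and> b_nrm \<omega>' (a2 x) = b2 (b_nrm \<omega> x)"
    "\<forall>x \<in> B InR Y \<omega>. b_trf \<omega>' (b2 x) = b_trf \<omega> x"
    using parts[OF iso(2) gfold.simps(2)] by (elim conjE exE) (rule that)
  note s = split[OF w] and s' = split[OF w']
  note a = gmap_if_bij[OF L(1) R(1) L(2) R(2) s(3,1) s'(3,1) disj(1) disj(1)]
    and b = gmap_if_bij[OF L(3) R(3) L(4) R(4) s(4,2) s'(4,2) disj(2) disj(2)]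
  have "\<forall>x \<in> tops \<omega>. b_res \<omega>' (if x \<in> A InL X \<omega> then a1 x else a2 x) = b_res \<omega> x \<and>
      b_nrm \<omega>' (if x \<in> A InL X \<omega> then a1 x else a2 x) =
      (if b_nrm \<omega> x \<in> B InL X \<omega> then b1 (b_nrm \<omega> x) else b2 (b_nrm \<omega> x))"
    using L(5) R(5) s(1,5,6) disj[of \<omega>] by (auto simp: disjoint_iff)
  moreover have "\<forall>x \<in> bots \<omega>. b_trf \<omega>' (if x \<in> B InL X \<omega> then b1 x else b2 x) = b_trf \<omega> x"
    using L(6) R(6) s(2) by auto
  ultimately show ?thesis
    unfolding bispan_iso_def using a b src w(2) w'(2) by (intro conjI exI) simp_all
qed

text \<open>
  The bispan with given components is the disjoint union of these.  It is the only one, because its two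
  parts are determined up to isomorphism by the components.
\<close>

lemma bispan_product_gsum:
  assumes X: "fin_gset G X" and Y: "fin_gset G Y"
  shows "bispan_product G (gsum X Y) (restriction G X (gsum X Y) InL)
    (restriction G Y (gsum X Y) InR) X Y"
proof -
  let ?XY = "gsum X Y"
  let ?L = "\<lparr>b_src = ?XY, b_top = X, b_bot = X, b_tgt = X, b_res = InL, b_nrm = id, b_trf = id\<rparr>"
  let ?R = "\<lparr>b_src = ?XY, b_top = Y, b_bot = Y, b_tgt = Y, b_res = InR, b_nrm = id, b_trf = id\<rparr>"
  have L: "is_bispan G ?L" and R: "is_bispan G ?R"
    using assms by (simp_all add: is_bispan_def gmap_id gmap_InL gmap_InR)
  have XY: "fin_gset G ?XY" using assms by (rule fin_gsum)
  show ?thesis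
    unfolding bispan_product_def
  proof (intro conjI allI impI ballI XY)
    show "restriction G X ?XY InL \<in> bispan_hom G ?XY X"
      unfolding restriction_def using L by (rule bispan_hom_classI) auto
    show "restriction G Y ?XY InR \<in> bispan_hom G ?XY Y"
      unfolding restriction_def using R by (rule bispan_hom_classI) auto
    fix Z A B assume Z: "fin_gset G Z" and A: "A \<in> bispan_hom G Z X" and B: "B \<in> bispan_hom G Z Y"
    obtain \<omega>1 where w1: "is_bispan G \<omega>1" "b_src \<omega>1 = Z" "b_tgt \<omega>1 = X" "A = bispan_class G \<omega>1"
      using A by (rule bispan_homE)
    obtain \<omega>2 where w2: "is_bispan G \<omega>2" "b_src \<omega>2 = Z" "b_tgt \<omega>2 = Y" "B = bispan_class G \<omega>2"
      using B by (rule bispan_homE)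
    have g1: "gmap G (b_top \<omega>1) Z (b_res \<omega>1)" "gmap G (b_top \<omega>1) (b_bot \<omega>1) (b_nrm \<omega>1)"
      "gmap G (b_bot \<omega>1) X (b_trf \<omega>1)"
      using w1 by (auto simp: is_bispan_def)
    have g2: "gmap G (b_top \<omega>2) Z (b_res \<omega>2)" "gmap G (b_top \<omega>2) (b_bot \<omega>2) (b_nrm \<omega>2)"
      "gmap G (b_bot \<omega>2) Y (b_trf \<omega>2)"
      using w2 by (auto simp: is_bispan_def)
    note f = gmap_fin[OF g1(2)] gmap_fin[OF g2(2)]
    let ?bot = "gsum (b_bot \<omega>1) (b_bot \<omega>2)" and ?top = "gsum (b_top \<omega>1) (b_top \<omega>2)"
    let ?w = "\<lparr>b_src = Z, b_top = ?top, b_bot = ?bot, b_tgt = ?XY,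
      b_res = (\<lambda>x. case x of InL a \<Rightarrow> b_res \<omega>1 a | InR a \<Rightarrow> b_res \<omega>2 a | Elt h \<Rightarrow> Elt h),
      b_nrm = (\<lambda>x. case x of InL a \<Rightarrow> InL (b_nrm \<omega>1 a) | InR a \<Rightarrow> InR (b_nrm \<omega>2 a) | Elt h \<Rightarrow> Elt h),
      b_trf = (\<lambda>x. case x of InL a \<Rightarrow> InL (b_trf \<omega>1 a) | InR a \<Rightarrow> InR (b_trf \<omega>2 a) | Elt h \<Rightarrow> Elt h)\<rparr>"
    have w: "is_bispan G ?w"
      unfolding is_bispan_def bispan.simps
      using g1 g2 gmap_comp[OF g1(2) gmap_InL[OF f(2,4)]] gmap_comp[OF g2(2) gmap_InR[OF f(2,4)]]
        gmap_comp[OF g1(3) gmap_InL[OF X Y]] gmap_comp[OF g2(3) gmap_InR[OF X Y]]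
      by (intro conjI gmap_gsum) (simp_all add: o_def)
    have cL: "composite G ?w ?L \<omega>1 (\<lambda>\<pi> c. InL \<pi>) (b_trf \<omega>1) (b_trf \<omega>1 \<circ> b_nrm \<omega>1) InL"
    proof (unfold_locales, goal_cases)
      case (7 d s)
      then obtain b where "s d = InL b" "b \<in> bots \<omega>1" "b_trf \<omega>1 b = d"
        by (fastforce simp: pts_gsum)
      then show ?case by auto
    next
      case (8 \<pi> \<pi>')
      then show ?case using 8(4)[of "b_trf \<omega>1 \<pi>"] w1 gmap_in[OF g1(3)] by simp
    qed (use w1 g1 f gmap_comp[OF g1(2,3)] gmap_InL in \<open>auto simp: pts_gsum\<close>)
    have cR: "composite G ?w ?R \<omega>2 (\<lambda>\<pi> c. InR \<pi>) (b_trf \<omega>2) (b_trf \<omega>2 \<circ> b_nrm \<omega>2) InR"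
    proof (unfold_locales, goal_cases)
      case (7 d s)
      then obtain b where "s d = InR b" "b \<in> bots \<omega>2" "b_trf \<omega>2 b = d"
        by (fastforce simp: pts_gsum)
      then show ?case by auto
    next
      case (8 \<pi> \<pi>')
      then show ?case using 8(4)[of "b_trf \<omega>2 \<pi>"] w2 gmap_in[OF g2(3)] by simp
    qed (use w2 g2 f gmap_comp[OF g2(2,3)] gmap_InR in \<open>auto simp: pts_gsum\<close>)
    have ex: "bispan_comp G (restriction G X ?XY InL) (bispan_class G ?w) = A"
      "bispan_comp G (restriction G Y ?XY InR) (bispan_class G ?w) = B"
      unfolding restriction_def w1(4) w2(4)
      using bispan_comp_class[OF w L w1(1) _ cL] bispan_comp_class[OF w R w2(1) _ cR] by simp_all
    show "\<exists>!C. C \<in> bispan_hom G Z ?XY \<and> bispan_comp G (restriction G X ?XY InL) C = A \<and>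
        bispan_comp G (restriction G Y ?XY InR) C = B"
    proof (rule ex_ex1I)
      show "\<exists>C. C \<in> bispan_hom G Z ?XY \<and> bispan_comp G (restriction G X ?XY InL) C = A \<and>
        bispan_comp G (restriction G Y ?XY InR) C = B"
        using ex bispan_hom_classI[OF w] by (intro exI[of _ "bispan_class G ?w"]) simp
    next
      fix C C'
      assume C: "C \<in> bispan_hom G Z ?XY \<and> bispan_comp G (restriction G X ?XY InL) C = A \<and>
          bispan_comp G (restriction G Y ?XY InR) C = B"
        and C': "C' \<in> bispan_hom G Z ?XY \<and> bispan_comp G (restriction G X ?XY InL) C' = A \<and>
          bispan_comp G (restriction G Y ?XY InR) C' = B"
      obtain \<omega> where w: "is_bispan G \<omega>" "b_src \<omega> = Z" "b_tgt \<omega> = ?XY" "C = bispan_class G \<omega>"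
        using C by (blast elim: bispan_homE)
      obtain \<omega>' where w': "is_bispan G \<omega>'" "b_src \<omega>' = Z" "b_tgt \<omega>' = ?XY" "C' = bispan_class G \<omega>'"
        using C' by (blast elim: bispan_homE)
      note iX = gmap_InL[OF X Y] and iY = gmap_InR[OF X Y]
      note p = restriction_comp_part[OF w(1,3) X iX] restriction_comp_part[OF w(1,3) Y iY]
        and p' = restriction_comp_part[OF w'(1,3) X iX] restriction_comp_part[OF w'(1,3) Y iY]
      have "bispan_iso G (bispan_part \<omega> X InL) (bispan_part \<omega>' X InL)"
        "bispan_iso G (bispan_part \<omega> Y InR) (bispan_part \<omega>' Y InR)"
        using p p' C C' w(4) w'(4) by (auto intro!: bispan_class_iso)
      then have "bispan_iso G \<omega> \<omega>'"
        using bispan_iso_parts[OF w(1,3) w'(1,3)] w(2) w'(2) by simp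
      then show "C = C'" using w w' by (simp add: bispan_class_eqI)
    qed
  qed
qed

lemma bispan_terminal_empty:
  assumes "fin_gset G T" "pts T = {}"
  shows "bispan_terminal G T"
  unfolding bispan_terminal_def
proof (intro conjI allI impI assms(1) ex_ex1I)
  fix Z assume Z: "fin_gset G Z"
  let ?w = "\<lparr>b_src = Z, b_top = T, b_bot = T, b_tgt = T, b_res = id, b_nrm = id, b_trf = id\<rparr>"
  have "is_bispan G ?w" using Z assms by (simp add: is_bispan_def gmap_empty)
  then show "\<exists>C. C \<in> bispan_hom G Z T" using bispan_hom_classI by fastforce
  fix C C' assume C: "C \<in> bispan_hom G Z T" and C': "C' \<in> bispan_hom G Z T"
  obtain \<omega> where w: "is_bispan G \<omega>" "b_src \<omega> = Z" "b_tgt \<omega> = T" "C = bispan_class G \<omega>"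
    using C by (rule bispan_homE)
  obtain \<omega>' where w': "is_bispan G \<omega>'" "b_src \<omega>' = Z" "b_tgt \<omega>' = T" "C' = bispan_class G \<omega>'"
    using C' by (rule bispan_homE)
  have e: "tops \<nu> = {} \<and> bots \<nu> = {} \<and> fin_gset G (b_top \<nu>) \<and> fin_gset G (b_bot \<nu>)"
    if "is_bispan G \<nu>" "b_tgt \<nu> = T" for \<nu>
    using that assms by (auto simp: is_bispan_def gmap_def)
  have "bispan_iso G \<omega> \<omega>'"
    by (rule bispan_isoI[where a = id and b = id and a' = id and b' = id]) (use w w' e[of \<omega>] e[of \<omega>'] in \<open>simp_all add: bispan_map_def gmap_empty\<close>)
  then show "C = C'" using w w' by (simp add: bispan_class_eqI)
qed

end

section \<open>Restrictions, norms and transfers\<close>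

locale product_functor = group G for G (structure) +
  fixes R :: "('a, 'u) bifun"
  assumes is_functor: "set_functor G R" and preserves_products: "product_preserving G R"
begin

abbreviation res :: "'a gset \<Rightarrow> 'a gset \<Rightarrow> ('a pt \<Rightarrow> 'a pt) \<Rightarrow> 'u \<Rightarrow> 'u" where
  "res X Y f \<equiv> t_map R (restriction G X Y f)"
abbreviation nrm :: "'a gset \<Rightarrow> 'a gset \<Rightarrow> ('a pt \<Rightarrow> 'a pt) \<Rightarrow> 'u \<Rightarrow> 'u" where
  "nrm X Y f \<equiv> t_map R (norm_along G X Y f)"
abbreviation trf :: "'a gset \<Rightarrow> 'a gset \<Rightarrow> ('a pt \<Rightarrow> 'a pt) \<Rightarrow> 'u \<Rightarrow> 'u" where
  "trf X Y f \<equiv> t_map R (transfer_along G X Y f)"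
abbreviation obj :: "'a gset \<Rightarrow> 'u set" where "obj X \<equiv> t_obj R X"

lemma map_in: "\<Phi> \<in> bispan_hom G X Y \<Longrightarrow> x \<in> obj X \<Longrightarrow> t_map R \<Phi> x \<in> obj Y"
  using is_functor unfolding set_functor_def by blast

lemma map_comp:
  "\<Phi> \<in> bispan_hom G X Y \<Longrightarrow> \<Psi> \<in> bispan_hom G Y Z \<Longrightarrow> x \<in> obj X \<Longrightarrow>
   t_map R (bispan_comp G \<Psi> \<Phi>) x = t_map R \<Psi> (t_map R \<Phi> x)"
  using is_functor unfolding set_functor_def by blast

lemma map_composite:
  assumes "composite G \<omega> \<omega>' \<omega>'' ev h \<kappa> \<alpha>"
    and bi: "is_bispan G \<omega>" "is_bispan G \<omega>'" "is_bispan G \<omega>''" "b_tgt \<omega> = b_src \<omega>'"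
    and "x \<in> obj (b_src \<omega>)"
  shows "t_map R (bispan_class G \<omega>') (t_map R (bispan_class G \<omega>) x) = t_map R (bispan_class G \<omega>'') x"
  using bispan_comp_class[OF bi assms(1)] map_comp[OF bispan_hom_classI[OF bi(1)] bispan_hom_classI[OF bi(2)]]
    assms by metis

lemma restriction_hom: "gmap G X Y f \<Longrightarrow> restriction G X Y f \<in> bispan_hom G Y X"
  and norm_hom: "gmap G X Y f \<Longrightarrow> norm_along G X Y f \<in> bispan_hom G X Y"
  and transfer_hom: "gmap G X Y f \<Longrightarrow> transfer_along G X Y f \<in> bispan_hom G X Y"
  unfolding restriction_def norm_along_def transfer_along_def
  by (rule bispan_hom_classI; simp add: is_bispan_def gmap_id gmap_fin)+

lemma res_in: "gmap G X Y f \<Longrightarrow> y \<in> obj Y \<Longrightarrow> res X Y f y \<in> obj X"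
  and nrm_in: "gmap G X Y f \<Longrightarrow> x \<in> obj X \<Longrightarrow> nrm X Y f x \<in> obj Y"
  and trf_in: "gmap G X Y f \<Longrightarrow> x \<in> obj X \<Longrightarrow> trf X Y f x \<in> obj Y"
  using map_in restriction_hom norm_hom transfer_hom by blast+

lemma res_id: "fin_gset G X \<Longrightarrow> x \<in> obj X \<Longrightarrow> res X X id x = x"
  and nrm_id: "fin_gset G X \<Longrightarrow> x \<in> obj X \<Longrightarrow> nrm X X id x = x"
  and trf_id: "fin_gset G X \<Longrightarrow> x \<in> obj X \<Longrightarrow> trf X X id x = x"
  using is_functor
  unfolding set_functor_def bispan_id_def restriction_def norm_along_def transfer_along_def by blast+

text \<open>
  The composite of two maps is represented by any function \<open>k\<close> with the right values on points, as the
  class of a bispan depends on nothing else.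
\<close>

lemma res_res:
  assumes f: "gmap G X Y f" and f': "gmap G Y Z f'" and k: "\<And>x. x \<in> pts X \<Longrightarrow> k x = f' (f x)"
    and z: "z \<in> obj Z"
  shows "res X Y f (res Y Z f' z) = res X Z k z"
proof -
  have gk: "gmap G X Z k" using gmap_cong[OF gmap_comp[OF f f']] k by simp
  note fins = gmap_fin[OF f] gmap_fin[OF f']
  let ?w = "\<lparr>b_src = Z, b_top = Y, b_bot = Y, b_tgt = Y, b_res = f', b_nrm = id, b_trf = id\<rparr>"
  let ?w' = "\<lparr>b_src = Y, b_top = X, b_bot = X, b_tgt = X, b_res = f, b_nrm = id, b_trf = id\<rparr>"
  let ?w'' = "\<lparr>b_src = Z, b_top = X, b_bot = X, b_tgt = X, b_res = k, b_nrm = id, b_trf = id\<rparr>"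
  have "composite G ?w ?w' ?w'' (\<lambda>\<pi>. f) id id f"
    by unfold_locales (use f f' gk k fins in \<open>auto simp: gmap_id gmap_in gmap_act\<close>)
  then show ?thesis
    unfolding restriction_def
    by (rule map_composite) (use f f' gk fins z in \<open>auto simp: is_bispan_def gmap_id\<close>)
qed

lemma nrm_nrm:
  assumes f: "gmap G X Y f" and f': "gmap G Y Z f'" and k: "\<And>x. x \<in> pts X \<Longrightarrow> k x = f' (f x)"
    and x: "x \<in> obj X"
  shows "nrm Y Z f' (nrm X Y f x) = nrm X Z k x"
proof -
  have gk: "gmap G X Z k" using gmap_cong[OF gmap_comp[OF f f']] k by simp
  note fins = gmap_fin[OF f] gmap_fin[OF f']
  let ?w = "\<lparr>b_src = X, b_top = X, b_bot = Y, b_tgt = Y, b_res = id, b_nrm = f, b_trf = id\<rparr>"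
  let ?w' = "\<lparr>b_src = Y, b_top = Y, b_bot = Z, b_tgt = Z, b_res = id, b_nrm = f', b_trf = id\<rparr>"
  let ?w'' = "\<lparr>b_src = X, b_top = X, b_bot = Z, b_tgt = Z, b_res = id, b_nrm = k, b_trf = id\<rparr>"
  have "composite G ?w ?w' ?w'' (\<lambda>\<pi> c. c) id f id"
    by unfold_locales (use f f' gk k fins in \<open>auto simp: gmap_id gmap_in gmap_act\<close>)
  then show ?thesis
    unfolding norm_along_def
    by (rule map_composite) (use f f' gk fins x in \<open>auto simp: is_bispan_def gmap_id\<close>)
qed

lemma trf_trf:
  assumes f: "gmap G X Y f" and f': "gmap G Y Z f'" and k: "\<And>x. x \<in> pts X \<Longrightarrow> k x = f' (f x)"
    and x: "x \<in> obj X"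
  shows "trf Y Z f' (trf X Y f x) = trf X Z k x"
proof -
  have gk: "gmap G X Z k" using gmap_cong[OF gmap_comp[OF f f']] k by simp
  note fins = gmap_fin[OF f] gmap_fin[OF f']
  let ?w = "\<lparr>b_src = X, b_top = X, b_bot = X, b_tgt = Y, b_res = id, b_nrm = id, b_trf = f\<rparr>"
  let ?w' = "\<lparr>b_src = Y, b_top = Y, b_bot = Y, b_tgt = Z, b_res = id, b_nrm = id, b_trf = f'\<rparr>"
  let ?w'' = "\<lparr>b_src = X, b_top = X, b_bot = X, b_tgt = Z, b_res = id, b_nrm = id, b_trf = k\<rparr>"
  have "composite G ?w ?w' ?w'' (\<lambda>\<pi> c. \<pi>) f f id"
  proof (unfold_locales, goal_cases)
    case (8 \<pi> \<pi>')
    then show ?case using gmap_in[OF f] by auto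
  qed (use f f' gk k fins in \<open>auto simp: gmap_id gmap_in gmap_act\<close>)
  then show ?thesis
    unfolding transfer_along_def
    by (rule map_composite) (use f f' gk fins x in \<open>auto simp: is_bispan_def gmap_id\<close>)
qed

text \<open>Every bispan is a restriction followed by a norm followed by a transfer.\<close>

lemma map_bispan:
  assumes bi: "is_bispan G \<omega>" and x: "x \<in> obj (b_src \<omega>)"
  shows "t_map R (bispan_class G \<omega>) x = trf (b_bot \<omega>) (b_tgt \<omega>) (b_trf \<omega>)
    (nrm (b_top \<omega>) (b_bot \<omega>) (b_nrm \<omega>) (res (b_top \<omega>) (b_src \<omega>) (b_res \<omega>) x))"
proof -
  let ?A = "b_top \<omega>" and ?B = "b_bot \<omega>" and ?X = "b_src \<omega>" and ?Y = "b_tgt \<omega>"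
    and ?f = "b_res \<omega>" and ?n = "b_nrm \<omega>" and ?h = "b_trf \<omega>"
  have g: "gmap G ?A ?X ?f" "gmap G ?A ?B ?n" "gmap G ?B ?Y ?h"
    using bi by (auto simp: is_bispan_def)
  note fins = gmap_fin[OF g(1)] gmap_fin[OF g(2)] gmap_fin[OF g(3)]
  let ?r = "\<lparr>b_src = ?X, b_top = ?A, b_bot = ?A, b_tgt = ?A, b_res = ?f, b_nrm = id, b_trf = id\<rparr>"
  let ?m = "\<lparr>b_src = ?A, b_top = ?A, b_bot = ?B, b_tgt = ?B, b_res = id, b_nrm = ?n, b_trf = id\<rparr>"
  let ?t = "\<lparr>b_src = ?B, b_top = ?B, b_bot = ?B, b_tgt = ?Y, b_res = id, b_nrm = id, b_trf = ?h\<rparr>"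
  let ?rm = "\<lparr>b_src = ?X, b_top = ?A, b_bot = ?B, b_tgt = ?B, b_res = ?f, b_nrm = ?n, b_trf = id\<rparr>"
  have "composite G ?r ?m ?rm (\<lambda>\<pi> c. c) id id id"
    by unfold_locales (use g fins in \<open>auto simp: gmap_id gmap_in gmap_act\<close>)
  then have 1: "t_map R (bispan_class G ?m) (t_map R (bispan_class G ?r) x) = t_map R (bispan_class G ?rm) x"
    by (rule map_composite) (use g fins x in \<open>auto simp: is_bispan_def gmap_id\<close>)
  have "composite G ?rm ?t \<omega> (\<lambda>\<pi> c. \<pi>) id ?n id"
  proof (unfold_locales, goal_cases)
    case (8 \<pi> \<pi>')
    then show ?case by auto
  qed (use g fins in \<open>auto simp: gmap_id gmap_in gmap_act\<close>)
  then have 2: "t_map R (bispan_class G ?t) (t_map R (bispan_class G ?rm) x) = t_map R (bispan_class G \<omega>) x"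
    by (rule map_composite) (use g fins x bi in \<open>auto simp: is_bispan_def gmap_id\<close>)
  show ?thesis
    unfolding restriction_def norm_along_def transfer_along_def 1 2 ..
qed

text \<open>
  A bispan followed by a restriction is the pullback of the bispan, because the norm leg of a restriction
  has one-point fibres.
\<close>

lemma res_nrm:
  assumes P: "pullback_square G P A B C p q f f'" and a: "a \<in> obj A"
  shows "res B C f' (nrm A C f a) = nrm P B q (res P A p a)"
proof -
  note g = pullback_gmaps[OF P]
  note fins = gmap_fin[OF g(1)] gmap_fin[OF g(2)] gmap_fin[OF g(3)]
  let ?w = "\<lparr>b_src = A, b_top = A, b_bot = C, b_tgt = C, b_res = id, b_nrm = f, b_trf = id\<rparr>"
  let ?w' = "\<lparr>b_src = C, b_top = B, b_bot = B, b_tgt = B, b_res = f', b_nrm = id, b_trf = id\<rparr>"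
  let ?w'' = "\<lparr>b_src = A, b_top = P, b_bot = B, b_tgt = B, b_res = p, b_nrm = q, b_trf = id\<rparr>"
  have w'': "is_bispan G ?w''" using g fins by (simp add: is_bispan_def gmap_id)
  have "composite G ?w ?w' ?w'' (\<lambda>\<pi> c. f' c) id q p"
  proof (unfold_locales, goal_cases)
    case (13 m)
    then show ?case using pullback_ex[OF P] by auto
  next
    case (14 m m')
    then show ?case using pullback_unique[OF P] by auto
  qed (use g fins pullback_commutes[OF P] in \<open>auto simp: gmap_id gmap_in gmap_act\<close>)
  then have "res B C f' (nrm A C f a) = t_map R (bispan_class G ?w'') a"
    unfolding restriction_def norm_along_def
    by (rule map_composite) (use g fins a in \<open>auto simp: is_bispan_def gmap_id\<close>)
  also have "\<dots> = nrm P B q (res P A p a)"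
    using map_bispan[OF w''] a trf_id[OF fins(4)] nrm_in[OF g(2)] res_in[OF g(1)] by simp
  finally show ?thesis .
qed

lemma res_trf:
  assumes P: "pullback_square G P A B C p q f f'" and a: "a \<in> obj A"
  shows "res B C f' (trf A C f a) = trf P B q (res P A p a)"
proof -
  note g = pullback_gmaps[OF P]
  note fins = gmap_fin[OF g(1)] gmap_fin[OF g(2)] gmap_fin[OF g(3)]
  let ?w = "\<lparr>b_src = A, b_top = A, b_bot = A, b_tgt = C, b_res = id, b_nrm = id, b_trf = f\<rparr>"
  let ?w' = "\<lparr>b_src = C, b_top = B, b_bot = B, b_tgt = B, b_res = f', b_nrm = id, b_trf = id\<rparr>"
  let ?w'' = "\<lparr>b_src = A, b_top = P, b_bot = P, b_tgt = B, b_res = p, b_nrm = id, b_trf = q\<rparr>"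
  have w'': "is_bispan G ?w''" using g fins by (simp add: is_bispan_def gmap_id)
  have "composite G ?w ?w' ?w'' (\<lambda>\<pi> c. p \<pi>) q q p"
  proof (unfold_locales, goal_cases)
    case (7 d s)
    then show ?case using pullback_ex[OF P, of "s d" d] by auto
  next
    case (8 \<pi> \<pi>')
    then show ?case using pullback_unique[OF P, of \<pi> \<pi>'] gmap_in[OF g(2)] by auto
  next
  qed (use g fins pullback_commutes[OF P] in \<open>auto simp: gmap_id gmap_in gmap_act\<close>)
  then have "res B C f' (trf A C f a) = t_map R (bispan_class G ?w'') a"
    unfolding restriction_def transfer_along_def
    by (rule map_composite) (use g fins a in \<open>auto simp: is_bispan_def gmap_id\<close>)
  also have "\<dots> = trf P B q (res P A p a)"
    using map_bispan[OF w''] a nrm_id[OF fins(1)] res_in[OF g(1)] by simp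
  finally show ?thesis .
qed

text \<open>
  For a transfer followed by a norm, all auxiliary pullbacks in the composite are trivial and only the
  exponential diagram remains.
\<close>

lemma nrm_trf:
  assumes exp: "exponential_diagram G P C D E Q f v e t h" and a: "a \<in> obj P"
  shows "nrm C D v (trf P C f a) = trf Q D h (nrm E Q t (res E P e a))"
proof -
  have f: "gmap G P C f" and v: "gmap G C D v" and e: "gmap G E P e"
    and E: "pullback_square G E C Q D (f \<circ> e) t v h"
    and univ: "\<And>d s. d \<in> pts D \<Longrightarrow> \<forall>c \<in> pts C. v c = d \<longrightarrow> s c \<in> pts P \<and> f (s c) = c \<Longrightarrow>
      \<exists>!\<pi>. \<pi> \<in> pts Q \<and> h \<pi> = d \<and> (\<forall>x \<in> pts E. t x = \<pi> \<longrightarrow> e x = s (f (e x)))"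
    using exp unfolding exponential_diagram_def by blast+
  note g = pullback_gmaps[OF E]
  note fins = gmap_fin[OF f] gmap_fin[OF v] gmap_fin[OF e] gmap_fin[OF g(2)]
  let ?w = "\<lparr>b_src = P, b_top = P, b_bot = P, b_tgt = C, b_res = id, b_nrm = id, b_trf = f\<rparr>"
  let ?w' = "\<lparr>b_src = C, b_top = C, b_bot = D, b_tgt = D, b_res = id, b_nrm = v, b_trf = id\<rparr>"
  let ?w'' = "\<lparr>b_src = P, b_top = E, b_bot = Q, b_tgt = D, b_res = e, b_nrm = t, b_trf = h\<rparr>"
  have bi: "is_bispan G ?w" "is_bispan G ?w'" "is_bispan G ?w''"
    using f v e g fins by (simp_all add: is_bispan_def gmap_id)
  have "is_composite G ?w ?w' ?w''"
    unfolding is_composite_def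
  proof (intro exI conjI)
    show "pullback_square G P (b_bot ?w) (b_top ?w') (b_tgt ?w) id f (b_trf ?w) (b_res ?w')"
      by (rule pullbackI) (use f fins gmap_in[OF f] in \<open>auto simp: gmap_id\<close>)
    show "pullback_square G P (b_top ?w) P (b_bot ?w) id id (b_nrm ?w) id"
      by (rule pullbackI) (use fins in \<open>auto simp: gmap_id\<close>)
    show "exponential_diagram G P (b_top ?w') (b_bot ?w') E Q f (b_nrm ?w') e t h" using exp by simp
    show "pullback_square G E P E P e id id e"
      by (rule pullbackI) (use e fins gmap_in[OF e] in \<open>auto simp: gmap_id\<close>)
  qed simp
  then obtain ev h' \<kappa> \<alpha> where "composite G ?w ?w' ?w'' ev h' \<kappa> \<alpha>"
    using is_composite_composite[OF _ bi(1,2)] by blast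
  then have "nrm C D v (trf P C f a) = t_map R (bispan_class G ?w'') a"
    unfolding norm_along_def transfer_along_def
    by (rule map_composite) (use bi a in auto)
  then show ?thesis using map_bispan[OF bi(3)] a by simp
qed

end

section \<open>Gluing along disjoint unions\<close>

context group
begin

definition coproduct ::
  "'a gset \<Rightarrow> 'a gset \<Rightarrow> 'a gset \<Rightarrow> ('a pt \<Rightarrow> 'a pt) \<Rightarrow> ('a pt \<Rightarrow> 'a pt) \<Rightarrow> bool" where
  "coproduct X1 X2 X i1 i2 \<longleftrightarrow> gmap G X1 X i1 \<and> gmap G X2 X i2 \<and>
     inj_on i1 (pts X1) \<and> inj_on i2 (pts X2) \<and> i1 ` pts X1 \<inter> i2 ` pts X2 = {} \<and>
     pts X = i1 ` pts X1 \<union> i2 ` pts X2"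

lemma coproduct_gmaps: "coproduct X1 X2 X i1 i2 \<Longrightarrow> gmap G X1 X i1" "coproduct X1 X2 X i1 i2 \<Longrightarrow> gmap G X2 X i2"
  by (simp_all add: coproduct_def)

lemma coproduct_commute: "coproduct X1 X2 X i1 i2 \<Longrightarrow> coproduct X2 X1 X i2 i1"
  unfolding coproduct_def by blast

lemma coproduct_gsum: "fin_gset G X \<Longrightarrow> fin_gset G Y \<Longrightarrow> coproduct X Y (gsum X Y) InL InR"
  unfolding coproduct_def by (auto simp: gmap_InL gmap_InR pts_gsum inj_on_def)

lemma coproduct_subgset:
  assumes X: "fin_gset G X" and S: "S \<subseteq> pts X" "\<And>g x. g \<in> carrier G \<Longrightarrow> x \<in> S \<Longrightarrow> act X g x \<in> S"
  shows "coproduct (subgset X S) (subgset X (pts X - S)) X id id"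
proof -
  have cl: "act X g x \<in> pts X - S" if "g \<in> carrier G" "x \<in> pts X - S" for g x
  proof -
    have "act X g x \<notin> S"
    proof
      assume "act X g x \<in> S"
      then have "act X (inv g) (act X g x) \<in> S" using S that by simp
      then show False using that X act_inv by auto
    qed
    then show ?thesis using X that by (simp add: act_closed)
  qed
  show ?thesis
    unfolding coproduct_def
    using gmap_subgset[OF gmap_id[OF X] S] gmap_subgset[OF gmap_id[OF X] _ cl] S(1) by auto
qed

text \<open>
  Sending the two parts of \<open>A\<close> to different copies of \<open>X\<close> factors a map \<open>A \<rightarrow> X\<close> through the fold map.
\<close>

lemma coproduct_restrict_map:
  assumes c: "coproduct A1 A2 A i1 i2" and f: "gmap G A X f"
    and S: "\<And>a. a \<in> pts A1 \<Longrightarrow> k (i1 a) = InL (f (i1 a))" "\<And>a. a \<in> pts A2 \<Longrightarrow> k (i2 a) = InR (f (i2 a))"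
  shows "gmap G A (gsum X X) k"
proof -
  note i = coproduct_gmaps[OF c]
  note fins = gmap_fin[OF f] gmap_fin[OF i(1)] gmap_fin[OF i(2)]
  have A: "pts A = i1 ` pts A1 \<union> i2 ` pts A2" using c by (simp add: coproduct_def)
  show ?thesis
  proof (rule gmapI[OF fins(1) fin_gsum[OF fins(2,2)]])
    fix x assume x: "x \<in> pts A"
    then show "k x \<in> pts (gsum X X)"
      using A S gmap_in[OF f] by (auto simp: pts_gsum)
    fix g assume g: "g \<in> carrier G"
    show "k (act A g x) = act (gsum X X) g (k x)"
    proof (cases "x \<in> i1 ` pts A1")
      case True
      then obtain a where a: "a \<in> pts A1" "x = i1 a" by blast
      have "k (i1 (act A1 g a)) = InL (f (i1 (act A1 g a)))"
        by (rule S(1)) (use a g fins act_closed in blast)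
      then show ?thesis
        using a g x gmap_act[OF i(1) g a(1)] gmap_act[OF f g x] gmap_in[OF f x] S(1)[OF a(1)] by simp
    next
      case False
      then obtain a where a: "a \<in> pts A2" "x = i2 a" using A x by blast
      have "k (i2 (act A2 g a)) = InR (f (i2 (act A2 g a)))"
        by (rule S(2)) (use a g fins act_closed in blast)
      then show ?thesis
        using a g x gmap_act[OF i(2) g a(1)] gmap_act[OF f g x] gmap_in[OF f x] S(2)[OF a(1)] by simp
    qed
  qed
qed

end

context product_functor
begin

lemma gsum_bij:
  assumes "fin_gset G X" "fin_gset G Y"
  shows "bij_betw (\<lambda>z. (res X (gsum X Y) InL z, res Y (gsum X Y) InR z)) (obj (gsum X Y)) (obj X \<times> obj Y)"
  using preserves_products assms bispan_product_gsum[OF assms] unfolding product_preserving_def by blast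

text \<open>
  The disjoint union of the parts is isomorphic to \<open>X\<close>, and a disjoint union is a product of bispans.
\<close>

lemma glue:
  assumes c: "coproduct X1 X2 X i1 i2"
  shows "bij_betw (\<lambda>z. (res X1 X i1 z, res X2 X i2 z)) (obj X) (obj X1 \<times> obj X2)"
proof -
  let ?S = "gsum X1 X2"
  let ?k = "\<lambda>x. case x of InL a \<Rightarrow> i1 a | InR b \<Rightarrow> i2 b | Elt h \<Rightarrow> Elt h"
  note i = coproduct_gmaps[OF c]
  note fins = gmap_fin[OF i(1)] gmap_fin[OF i(2)]
  have k: "gmap G ?S X ?k" using i by (intro gmap_gsum) simp_all
  have "bij_betw ?k (pts ?S) (pts X)"
  proof (rule bij_betw_imageI)
    have ne: "i1 a \<noteq> i2 b" "i2 b \<noteq> i1 a" if "a \<in> pts X1" "b \<in> pts X2" for a b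
      using c that unfolding coproduct_def by blast+
    have inj: "inj_on i1 (pts X1)" "inj_on i2 (pts X2)" using c by (simp_all add: coproduct_def)
    show "inj_on ?k (pts ?S)"
      by (rule inj_onI) (auto simp: pts_gsum ne dest: inj_onD[OF inj(1)] inj_onD[OF inj(2)])
    show "?k ` pts ?S = pts X"
      using c by (simp add: coproduct_def pts_gsum image_Un image_image)
  qed
  from gmap_bij_inverse[OF k this] obtain k' where k': "gmap G X ?S k'"
    "\<And>x. x \<in> pts ?S \<Longrightarrow> k' (?k x) = x" "\<And>y. y \<in> pts X \<Longrightarrow> ?k (k' y) = y" by blast
  have 1: "bij_betw (res ?S X ?k) (obj X) (obj ?S)"
  proof (rule bij_betw_byWitness[where f' = "res X ?S k'"])
    show "\<forall>z \<in> obj X. res X ?S k' (res ?S X ?k z) = z"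
      using res_res[OF k'(1) k, of id] k'(3) res_id[OF fins(2)] by simp
    show "\<forall>z \<in> obj ?S. res ?S X ?k (res X ?S k' z) = z"
      using res_res[OF k k'(1), of id] k'(2) res_id[OF gmap_fin(1)[OF k]] by simp
  qed (use res_in[OF k] res_in[OF k'(1)] in auto)
  show ?thesis
  proof (rule iffD1[OF bij_betw_cong bij_betw_trans[OF 1 gsum_bij[OF fins(1,3)]]])
    fix z assume z: "z \<in> obj X"
    show "((\<lambda>z. (res X1 ?S InL z, res X2 ?S InR z)) \<circ> res ?S X ?k) z = (res X1 X i1 z, res X2 X i2 z)"
      using res_res[OF gmap_InL[OF fins(1,3)] k, of i1] res_res[OF gmap_InR[OF fins(1,3)] k, of i2] z
      by simp
  qed
qed

lemma glue_ex:
  assumes "coproduct X1 X2 X i1 i2" "a \<in> obj X1" "b \<in> obj X2"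
  obtains z where "z \<in> obj X" "res X1 X i1 z = a" "res X2 X i2 z = b"
proof -
  have "(a, b) \<in> (\<lambda>z. (res X1 X i1 z, res X2 X i2 z)) ` obj X"
    using glue[OF assms(1)] assms(2,3) by (simp add: bij_betw_def)
  then show thesis using that by auto
qed

lemma glue_eq:
  assumes "coproduct X1 X2 X i1 i2" "z \<in> obj X" "z' \<in> obj X"
    and "res X1 X i1 z = res X1 X i1 z'" "res X2 X i2 z = res X2 X i2 z'"
  shows "z = z'"
  using inj_onD[OF bij_betw_imp_inj_on[OF glue[OF assms(1)]]] assms by blast

lemma obj_empty: "fin_gset G X \<Longrightarrow> pts X = {} \<Longrightarrow> \<exists>!x. x \<in> obj X"
  using preserves_products bispan_terminal_empty unfolding product_preserving_def by blast

lemma t_pair: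
  assumes X: "fin_gset G X" and "a \<in> obj X" "b \<in> obj X"
  shows "t_pair G R X a b \<in> obj (gsum X X) \<and> res X (gsum X X) InL (t_pair G R X a b) = a \<and>
    res X (gsum X X) InR (t_pair G R X a b) = b"
  unfolding t_pair_def
proof (rule theI')
  note c = coproduct_gsum[OF X X]
  show "\<exists>!z. z \<in> obj (gsum X X) \<and> res X (gsum X X) InL z = a \<and> res X (gsum X X) InR z = b"
    using glue_ex[OF c assms(2,3)] glue_eq[OF c] by (metis (no_types, lifting))
qed

lemma t_pair_eqI:
  assumes X: "fin_gset G X" and z: "z \<in> obj (gsum X X)"
    and "res X (gsum X X) InL z = a" "res X (gsum X X) InR z = b"
  shows "t_pair G R X a b = z"
proof -
  have "a \<in> obj X" "b \<in> obj X"
    using assms res_in[OF gmap_InL[OF X X] z] res_in[OF gmap_InR[OF X X] z] by auto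
  note p = t_pair[OF X this]
  show ?thesis
    by (rule glue_eq[OF coproduct_gsum[OF X X]]) (use p z assms(3,4) in metis)+
qed

end

text \<open>
  Norms and transfers are both functorial and compatible with base change.  This alone makes the
  operation defined by the fold map a commutative monoid structure, natural in restrictions and
  preserved by the push-forward.
\<close>

locale pushforward = product_functor G R for G (structure) and R :: "('a, 'u) bifun" +
  fixes push :: "'a gset \<Rightarrow> 'a gset \<Rightarrow> ('a pt \<Rightarrow> 'a pt) \<Rightarrow> 'u \<Rightarrow> 'u"
  assumes push_in: "gmap G X Y f \<Longrightarrow> x \<in> t_obj R X \<Longrightarrow> push X Y f x \<in> t_obj R Y"
    and push_id: "fin_gset G X \<Longrightarrow> x \<in> t_obj R X \<Longrightarrow> push X X id x = x"
    and push_push: "gmap G X Y f \<Longrightarrow> gmap G Y Z f' \<Longrightarrow> (\<And>x. x \<in> pts X \<Longrightarrow> k x = f' (f x)) \<Longrightarrow>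
      x \<in> t_obj R X \<Longrightarrow> push Y Z f' (push X Y f x) = push X Z k x"
    and res_push: "pullback_square G P A B C p q f f' \<Longrightarrow> a \<in> t_obj R A \<Longrightarrow>
      t_map R (restriction G B C f') (push A C f a) = push P B q (t_map R (restriction G P A p) a)"
begin

definition opr :: "'a gset \<Rightarrow> 'u \<Rightarrow> 'u \<Rightarrow> 'u" where
  "opr X a b = push (gsum X X) X gfold (t_pair G R X a b)"

definition unit :: "'a gset \<Rightarrow> 'u" where
  "unit X = push gempty X id (THE z. z \<in> obj gempty)"

lemma the_empty: "(THE z. z \<in> obj gempty) \<in> obj gempty"
  using theI'[OF obj_empty[OF fin_gempty]] by simp

lemma opr_in: "fin_gset G X \<Longrightarrow> a \<in> obj X \<Longrightarrow> b \<in> obj X \<Longrightarrow> opr X a b \<in> obj X"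
  unfolding opr_def using push_in[OF gmap_gfold] t_pair by blast

lemma unit_in: "fin_gset G X \<Longrightarrow> unit X \<in> obj X"
  unfolding unit_def by (rule push_in[OF gmap_empty[OF fin_gempty _] the_empty]) simp_all

text \<open>
  The map \<open>f\<close> factors through the fold map of \<open>X\<close>, and base change computes the two components of the
  push-forward to \<open>X \<squnion> X\<close>.  All laws of the operation follow by decomposing some source in two ways.
\<close>

lemma push_split:
  assumes c: "coproduct A1 A2 A i1 i2" and f: "gmap G A X f"
    and f1: "\<And>x. x \<in> pts A1 \<Longrightarrow> f1 x = f (i1 x)" and f2: "\<And>x. x \<in> pts A2 \<Longrightarrow> f2 x = f (i2 x)"
    and z: "z \<in> obj A"
  shows "push A X f z = opr X (push A1 X f1 (res A1 A i1 z)) (push A2 X f2 (res A2 A i2 z))"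
proof -
  define k where "k x = (if x \<in> i1 ` pts A1 then InL (f x) else InR (f x))" for x
  note i = coproduct_gmaps[OF c]
  have disj: "i1 ` pts A1 \<inter> i2 ` pts A2 = {}" "pts A = i1 ` pts A1 \<union> i2 ` pts A2"
    and inj: "inj_on i1 (pts A1)" "inj_on i2 (pts A2)"
    using c by (auto simp: coproduct_def)
  have k1: "k (i1 a) = InL (f1 a)" if "a \<in> pts A1" for a using that f1 by (simp add: k_def)
  have k2: "k (i2 a) = InR (f2 a)" if "a \<in> pts A2" for a using that f2 disj by (auto simp: k_def)
  have k: "gmap G A (gsum X X) k"
    by (rule coproduct_restrict_map[OF c f]) (simp_all add: k1 k2 f1 f2)
  note X = gmap_fin(2)[OF f]
  have g1: "gmap G A1 X f1" and g2: "gmap G A2 X f2"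
    using gmap_cong[OF gmap_comp[OF i(1) f]] gmap_cong[OF gmap_comp[OF i(2) f]] f1 f2 by simp_all
  have kz: "push A (gsum X X) k z \<in> obj (gsum X X)" by (rule push_in[OF k z])
  have in1: "\<exists>a \<in> pts A1. i1 a = x \<and> f1 a = b" if "x \<in> pts A" "k x = InL b" for x b
    using that disj by (auto simp: k1 k2)
  have in2: "\<exists>a \<in> pts A2. i2 a = x \<and> f2 a = b" if "x \<in> pts A" "k x = InR b" for x b
    using that disj by (auto simp: k1 k2)
  have P1: "pullback_square G A1 A X (gsum X X) i1 f1 k InL"
    by (rule pullbackI[OF i(1) g1 k gmap_InL[OF X X] k1]) (use in1 inj in \<open>auto dest: inj_onD\<close>)
  have P2: "pullback_square G A2 A X (gsum X X) i2 f2 k InR"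
    by (rule pullbackI[OF i(2) g2 k gmap_InR[OF X X] k2]) (use in2 inj in \<open>auto dest: inj_onD\<close>)
  have "t_pair G R X (push A1 X f1 (res A1 A i1 z)) (push A2 X f2 (res A2 A i2 z)) = push A (gsum X X) k z"
    using res_push[OF P1 z] res_push[OF P2 z] by (intro t_pair_eqI[OF X kz])
  then show ?thesis
    unfolding opr_def using push_push[OF k gmap_gfold[OF X], of f z] z by (simp add: k_def)
qed

lemma push_empty:
  assumes f: "gmap G A X f" and e: "pts A = {}" and z: "z \<in> obj A"
  shows "push A X f z = unit X"
proof -
  note fins = gmap_fin[OF f]
  have i: "gmap G gempty A id" by (rule gmap_empty) (simp_all add: fins fin_gempty)
  have "push gempty A id (THE z. z \<in> obj gempty) \<in> obj A" using push_in[OF i the_empty] .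
  then have "z = push gempty A id (THE z. z \<in> obj gempty)"
    using obj_empty[OF fins(1) e] z by blast
  then show ?thesis
    unfolding unit_def using push_push[OF i f, of id] the_empty by simp
qed

lemma opr_commute:
  assumes X: "fin_gset G X" and a: "a \<in> obj X" "b \<in> obj X"
  shows "opr X a b = opr X b a"
proof -
  note p = t_pair[OF X a]
  have "opr X a b = opr X (push X X id (res X (gsum X X) InR (t_pair G R X a b)))
      (push X X id (res X (gsum X X) InL (t_pair G R X a b)))"
    unfolding opr_def[of X a b]
    by (rule push_split[OF coproduct_commute[OF coproduct_gsum[OF X X]] gmap_gfold[OF X]])
      (use p in simp_all)
  then show ?thesis using p a push_id[OF X] by simp
qed

text \<open>
  Both sides are the push-forward along \<open>(X \<squnion> X) \<squnion> X \<rightarrow> X\<close> of the element with components \<open>a\<close>, \<open>b\<close>, \<open>c\<close>; they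
  result from splitting off the last and the first summand.
\<close>

lemma opr_assoc:
  assumes X: "fin_gset G X" and abc: "a \<in> obj X" "b \<in> obj X" "c \<in> obj X"
  shows "opr X (opr X a b) c = opr X a (opr X b c)"
proof -
  let ?S = "gsum X X"
  let ?W = "gsum ?S X"
  let ?f = "\<lambda>w. case w of InL s \<Rightarrow> gfold s | InR x \<Rightarrow> x | Elt h \<Rightarrow> Elt h"
  let ?j = "\<lambda>w. case w of InL x \<Rightarrow> InL (InR x) | InR x \<Rightarrow> InR x | Elt h \<Rightarrow> Elt h"
  have S: "fin_gset G ?S" and W: "fin_gset G ?W" using X by (simp_all add: fin_gsum)
  note ab = t_pair[OF X abc(1,2)] and bc = t_pair[OF X abc(2,3)]
  obtain z where z: "z \<in> obj ?W" "res ?S ?W InL z = t_pair G R X a b" "res X ?W InR z = c"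
    using glue_ex[OF coproduct_gsum[OF S X]] ab abc(3) by metis
  have f: "gmap G ?W X ?f"
    using gmap_gfold[OF X] gmap_id[OF X] by (intro gmap_gsum) (simp_all add: id_def)
  note LL = gmap_comp[OF gmap_InL[OF X X] gmap_InL[OF S X]]
    and LR = gmap_comp[OF gmap_InR[OF X X] gmap_InL[OF S X]]
  have j: "gmap G ?S ?W ?j"
    using LR gmap_InR[OF S X] by (intro gmap_gsum) (simp_all add: o_def)
  have c2: "coproduct X ?S ?W (InL \<circ> InL) ?j"
    unfolding coproduct_def using LL j by (auto simp: pts_gsum inj_on_def image_Un image_image)
  have "push ?W X ?f z = opr X (opr X a b) c"
    unfolding opr_def[of X a b]
    using push_split[OF coproduct_gsum[OF S X] f, of gfold id z] z push_id[OF X] abc by simp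
  moreover
  have "res X ?W (InL \<circ> InL) z = a"
    using res_res[OF gmap_InL[OF X X] gmap_InL[OF S X], of "InL \<circ> InL" z] z ab by simp
  moreover have "t_pair G R X b c = res ?S ?W ?j z"
  proof (rule t_pair_eqI[OF X res_in[OF j z(1)]])
    show "res X ?S InL (res ?S ?W ?j z) = b"
      using res_res[OF gmap_InL[OF X X] j, of "InL \<circ> InR" z]
        res_res[OF gmap_InR[OF X X] gmap_InL[OF S X], of "InL \<circ> InR" z] z ab by simp
    show "res X ?S InR (res ?S ?W ?j z) = c"
      using res_res[OF gmap_InR[OF X X] j, of InR z] z by simp
  qed
  then have "push ?W X ?f z = opr X (res X ?W (InL \<circ> InL) z) (opr X b c)"
    unfolding opr_def[of X b c]
    using push_split[OF c2 f, of id gfold z] z push_id[OF X] res_in[OF LL z(1)]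
    by (simp add: pts_gsum image_iff split: pt.splits)
  ultimately show ?thesis by simp
qed

lemma unit_opr:
  assumes X: "fin_gset G X" and a: "a \<in> obj X"
  shows "opr X (unit X) a = a"
proof -
  have g: "gmap G gempty X id" by (rule gmap_empty) (simp_all add: X fin_gempty)
  have "coproduct gempty X X id id"
    unfolding coproduct_def using g gmap_id[OF X] by simp
  from push_split[OF this gmap_id[OF X], of id id a]
  show ?thesis using a push_id[OF X] res_id[OF X] push_empty[OF g _ res_in[OF g]] by simp
qed

lemma opr_unit: "fin_gset G X \<Longrightarrow> a \<in> obj X \<Longrightarrow> opr X a (unit X) = a"
  using unit_opr opr_commute unit_in by metis

lemma res_opr:
  assumes f: "gmap G Y X f" and a: "a \<in> obj X" "b \<in> obj X"
  shows "res Y X f (opr X a b) = opr Y (res Y X f a) (res Y X f b)"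
proof -
  note fins = gmap_fin[OF f]
  let ?SX = "gsum X X" and ?SY = "gsum Y Y"
  let ?ff = "\<lambda>w. case w of InL y \<Rightarrow> InL (f y) | InR y \<Rightarrow> InR (f y) | Elt h \<Rightarrow> Elt h"
  note iX = gmap_InL[OF fins(2,2)] gmap_InR[OF fins(2,2)] and iY = gmap_InL[OF fins(1,1)] gmap_InR[OF fins(1,1)]
  have ff: "gmap G ?SY ?SX ?ff"
    using gmap_comp[OF f iX(1)] gmap_comp[OF f iX(2)] by (intro gmap_gsum) (simp_all add: o_def)
  have P: "pullback_square G ?SY ?SX Y X ?ff gfold gfold f"
  proof (rule pullbackI[OF ff gmap_gfold[OF fins(1)] gmap_gfold[OF fins(2)] f])
    fix a b assume ab: "a \<in> pts ?SX" "b \<in> pts Y" "gfold a = f b"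
    show "\<exists>x \<in> pts ?SY. ?ff x = a \<and> gfold x = b"
    proof (cases "a \<in> InL ` pts X")
      case True
      then show ?thesis using ab by (intro bexI[of _ "InL b"]) (auto simp: pts_gsum)
    next
      case False
      then show ?thesis using ab by (intro bexI[of _ "InR b"]) (auto simp: pts_gsum)
    qed
  qed (auto simp: pts_gsum)
  note p = t_pair[OF fins(2) a]
  have "t_pair G R Y (res Y X f a) (res Y X f b) = res ?SY ?SX ?ff (t_pair G R X a b)"
  proof (rule t_pair_eqI[OF fins(1) res_in[OF ff]])
    show "res Y ?SY InL (res ?SY ?SX ?ff (t_pair G R X a b)) = res Y X f a"
      using res_res[OF iY(1) ff, of "InL \<circ> f"] res_res[OF f iX(1), of "InL \<circ> f" "t_pair G R X a b"] p by simp
    show "res Y ?SY InR (res ?SY ?SX ?ff (t_pair G R X a b)) = res Y X f b"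
      using res_res[OF iY(2) ff, of "InR \<circ> f"] res_res[OF f iX(2), of "InR \<circ> f" "t_pair G R X a b"] p by simp
  qed (use p in simp)
  then show ?thesis unfolding opr_def using res_push[OF P] p by simp
qed

lemma res_unit:
  assumes f: "gmap G Y X f"
  shows "res Y X f (unit X) = unit Y"
proof -
  note fins = gmap_fin[OF f]
  have g: "gmap G gempty Y id" "gmap G gempty X id" "gmap G gempty gempty id"
    by (rule gmap_empty; simp add: fins fin_gempty)+
  have P: "pullback_square G gempty gempty Y X id id id f"
    by (rule pullbackI) (use g f in auto)
  show ?thesis
    unfolding unit_def using res_push[OF P the_empty] res_id[OF fin_gempty the_empty] by simp
qed

lemma push_opr:
  assumes f: "gmap G X Y f" and a: "a \<in> obj X" "b \<in> obj X"
  shows "push X Y f (opr X a b) = opr Y (push X Y f a) (push X Y f b)"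
proof -
  note fins = gmap_fin[OF f]
  note p = t_pair[OF fins(1) a]
  have "push X Y f (opr X a b) = push (gsum X X) Y (f \<circ> gfold) (t_pair G R X a b)"
    unfolding opr_def using push_push[OF gmap_gfold[OF fins(1)] f, of "f \<circ> gfold"] p by simp
  also have "\<dots> = opr Y (push X Y f (res X (gsum X X) InL (t_pair G R X a b)))
      (push X Y f (res X (gsum X X) InR (t_pair G R X a b)))"
    by (rule push_split[OF coproduct_gsum[OF fins(1,1)] gmap_comp[OF gmap_gfold[OF fins(1)] f]])
      (use p in simp_all)
  also have "\<dots> = opr Y (push X Y f a) (push X Y f b)" using p by simp
  finally show ?thesis .
qed

lemma push_unit:
  assumes f: "gmap G X Y f"
  shows "push X Y f (unit X) = unit Y"
proof -
  have "gmap G gempty X id" by (rule gmap_empty) (simp_all add: gmap_fin[OF f] fin_gempty)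
  from push_push[OF this, of Y "\<lambda>x. f x" f] show ?thesis
    using push_empty[of gempty Y f] unfolding unit_def
    using f the_empty gmap_empty[OF fin_gempty gmap_fin(2)[OF f], of f] push_empty[of gempty Y f]
    unfolding unit_def by simp
qed

lemma push_inj:
  assumes f: "gmap G X Y f" and inj: "inj_on f (pts X)" and x: "x \<in> obj X"
  shows "res X Y f (push X Y f x) = x"
proof -
  note fins = gmap_fin[OF f]
  have "pullback_square G X X X Y id id f f"
    by (rule pullbackI) (use f fins inj in \<open>auto simp: gmap_id dest: inj_onD\<close>)
  from res_push[OF this x] show ?thesis using push_id[OF fins(1)] res_id[OF fins(1)] x by simp
qed

lemma push_bij:
  assumes f: "gmap G X Y f" and bij: "bij_betw f (pts X) (pts Y)" and y: "y \<in> obj Y"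
  shows "push X Y f (res X Y f y) = y"
proof -
  obtain f' where f': "gmap G Y X f'" "\<And>x. x \<in> pts X \<Longrightarrow> f' (f x) = x" "\<And>y. y \<in> pts Y \<Longrightarrow> f (f' y) = y"
    using gmap_bij_inverse[OF f bij] by blast
  have "pullback_square G Y X Y Y f' id f id"
    by (rule pullbackI) (use f f' gmap_fin[OF f] in \<open>auto simp: gmap_id\<close>)
  from res_push[OF this res_in[OF f y]]
  have "push X Y f (res X Y f y) = res Y X f' (res X Y f y)"
    using res_id push_id push_in[OF f res_in[OF f y]] gmap_fin[OF f] res_in[OF f'(1) res_in[OF f y]] by simp
  also have "\<dots> = y"
    using res_res[OF f'(1) f, of id y] f'(3) y res_id[OF gmap_fin(2)[OF f]] by simp
  finally show ?thesis .
qed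

end

sublocale product_functor \<subseteq> mul: pushforward G R "\<lambda>X Y f. t_map R (norm_along G X Y f)"
  by unfold_locales (fact nrm_in nrm_id nrm_nrm res_nrm)+

sublocale product_functor \<subseteq> add: pushforward G R "\<lambda>X Y f. t_map R (transfer_along G X Y f)"
  by unfold_locales (fact trf_in trf_id trf_trf res_trf)+

context product_functor
begin

lemma level_ring_simps [simp]:
  "carrier (level_ring G R X) = obj X"
  "mult (level_ring G R X) = mul.opr X" "one (level_ring G R X) = mul.unit X"
  "add (level_ring G R X) = add.opr X" "zero (level_ring G R X) = add.unit X"
  by (auto simp: level_ring_def mul.opr_def add.opr_def mul.unit_def add.unit_def fun_eq_iff)

end

section \<open>Frobenius reciprocity and distributivity\<close>

context product_functor
begin

text \<open>
  Frobenius reciprocity.  The product on the left is a norm along the fold map of a transfer along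
  \<open>f \<squnion> id\<close>.  A section of \<open>f \<squnion> id : X \<squnion> Y \<rightarrow> Y \<squnion> Y\<close> over the two points above \<open>y\<close> is a point of \<open>X\<close> over \<open>y\<close>, so
  the dependent product is \<open>X\<close> itself.
\<close>

lemma trf_mul:
  assumes f: "gmap G X Y f" and a: "a \<in> obj X" and b: "b \<in> obj Y"
  shows "mul.opr Y (trf X Y f a) b = trf X Y f (mul.opr X a (res X Y f b))"
proof -
  note fins = gmap_fin[OF f]
  let ?P = "gsum X Y" and ?C = "gsum Y Y" and ?E = "gsum X X"
  let ?ff = "\<lambda>w. case w of InL x \<Rightarrow> InL (f x) | InR y \<Rightarrow> InR y | Elt h \<Rightarrow> Elt h"
  let ?e = "\<lambda>w. case w of InL x \<Rightarrow> InL x | InR x \<Rightarrow> InR (f x) | Elt h \<Rightarrow> Elt h"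
  note iP = gmap_InL[OF fins] gmap_InR[OF fins] and iC = gmap_InL[OF fins(2,2)] gmap_InR[OF fins(2,2)]
    and iE = gmap_InL[OF fins(1,1)] gmap_InR[OF fins(1,1)]
  have ff: "gmap G ?P ?C ?ff"
    using gmap_comp[OF f iC(1)] iC(2) by (intro gmap_gsum) (simp_all add: o_def)
  have e: "gmap G ?E ?P ?e"
    using gmap_comp[OF f iP(2)] iP(1) by (intro gmap_gsum) (simp_all add: o_def)
  note vC = gmap_gfold[OF fins(2)] and vE = gmap_gfold[OF fins(1)]
  obtain z where z: "z \<in> obj ?P" "res X ?P InL z = a" "res Y ?P InR z = b"
    using glue_ex[OF coproduct_gsum[OF fins] a b] .
  have P1: "pullback_square G X ?P Y ?C InL f ?ff InL"
    by (rule pullbackI[OF iP(1) f ff iC(1)]) (auto simp: pts_gsum)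
  have P2: "pullback_square G Y ?P Y ?C InR id ?ff InR"
    by (rule pullbackI[OF iP(2) gmap_id[OF fins(2)] ff iC(2)]) (auto simp: pts_gsum)
  have exp: "exponential_diagram G ?P ?C Y ?E X ?ff gfold ?e gfold f"
    unfolding exponential_diagram_def
  proof (intro conjI allI ballI impI ff vC e)
    show "pullback_square G ?E ?C X Y (?ff \<circ> ?e) gfold gfold f"
    proof (rule pullbackI[OF gmap_comp[OF e ff] vE vC f])
      fix c x assume c: "c \<in> pts ?C" and x: "x \<in> pts X" and eq: "gfold c = f x"
      show "\<exists>w \<in> pts ?E. (?ff \<circ> ?e) w = c \<and> gfold w = x"
      proof (cases "c \<in> InL ` pts Y")
        case True
        then show ?thesis using x eq by (intro bexI[of _ "InL x"]) (auto simp: pts_gsum)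
      next
        case False
        then show ?thesis using c x eq by (intro bexI[of _ "InR x"]) (auto simp: pts_gsum)
      qed
    qed (auto simp: pts_gsum)
    fix d s assume d: "d \<in> pts Y" and s: "\<forall>c \<in> pts ?C. gfold c = d \<longrightarrow> s c \<in> pts ?P \<and> ?ff (s c) = c"
    have "s (InL d) \<in> pts ?P" "?ff (s (InL d)) = InL d"
      using s d by (auto simp: pts_gsum)
    then obtain x where x: "x \<in> pts X" "s (InL d) = InL x" "f x = d"
      by (auto simp: pts_gsum)
    have "s (InR d) \<in> pts ?P" "?ff (s (InR d)) = InR d"
      using s d by (auto simp: pts_gsum)
    then have y: "s (InR d) = InR d" by (auto simp: pts_gsum)
    show "\<exists>!\<pi>. \<pi> \<in> pts X \<and> f \<pi> = d \<and> (\<forall>w \<in> pts ?E. gfold w = \<pi> \<longrightarrow> ?e w = s (?ff (?e w)))"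
    proof (rule ex1I[of _ x])
      show "x \<in> pts X \<and> f x = d \<and> (\<forall>w \<in> pts ?E. gfold w = x \<longrightarrow> ?e w = s (?ff (?e w)))"
        using x y by (auto simp: pts_gsum)
      fix \<pi> assume \<pi>: "\<pi> \<in> pts X \<and> f \<pi> = d \<and> (\<forall>w \<in> pts ?E. gfold w = \<pi> \<longrightarrow> ?e w = s (?ff (?e w)))"
      then have "InL \<pi> \<in> pts ?E" by (simp add: pts_gsum)
      with \<pi> have "?e (InL \<pi>) = s (?ff (?e (InL \<pi>)))" by (metis gfold.simps(1))
      then show "\<pi> = x" using \<pi> x by simp
    qed
  qed
  have tp: "t_pair G R X a (res X Y f b) = res ?E ?P ?e z"
    using res_res[OF iE(1) e, of InL z] res_res[OF iE(2) e, of "InR \<circ> f" z]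
      res_res[OF f iP(2), of "InR \<circ> f" z] z
    by (intro t_pair_eqI[OF fins(1) res_in[OF e z(1)]]) simp_all
  have "t_pair G R Y (trf X Y f a) b = trf ?P ?C ?ff z"
    using res_trf[OF P1 z(1)] res_trf[OF P2 z(1)] z trf_id[OF fins(2) b]
    by (intro t_pair_eqI[OF fins(2) trf_in[OF ff z(1)]]) simp_all
  then have "mul.opr Y (trf X Y f a) b = nrm ?C Y gfold (trf ?P ?C ?ff z)"
    by (simp add: mul.opr_def)
  also have "nrm ?C Y gfold (trf ?P ?C ?ff z) = trf X Y f (nrm ?E X gfold (res ?E ?P ?e z))"
    using exp z(1) by (rule nrm_trf)
  also have "nrm ?E X gfold (res ?E ?P ?e z) = mul.opr X a (res X Y f b)"
    using tp by (simp add: mul.opr_def)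
  finally show ?thesis .
qed

text \<open>
  This is Frobenius reciprocity for the fold map, along which the sum is a transfer.
\<close>

lemma distrib:
  assumes X: "fin_gset G X" and abc: "a \<in> obj X" "b \<in> obj X" "c \<in> obj X"
  shows "mul.opr X (add.opr X a b) c = add.opr X (mul.opr X a c) (mul.opr X b c)"
proof -
  let ?S = "gsum X X" and ?t = "t_pair G R X a b"
  note t = t_pair[OF X abc(1,2)] and S = fin_gsum[OF X X]
  note fold = gmap_gfold[OF X] and i = gmap_InL[OF X X] gmap_InR[OF X X]
  let ?m = "mul.opr ?S ?t (res ?S X gfold c)"
  have c': "res ?S X gfold c \<in> obj ?S" by (rule res_in[OF fold abc(3)])
  have m: "?m \<in> obj ?S" using mul.opr_in[OF S] t c' by blast
  have "res X ?S InL ?m = mul.opr X a c"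
    using mul.res_opr[OF i(1) _ c'] t res_res[OF i(1) fold, of id c] abc res_id[OF X] by simp
  moreover have "res X ?S InR ?m = mul.opr X b c"
    using mul.res_opr[OF i(2) _ c'] t res_res[OF i(2) fold, of id c] abc res_id[OF X] by simp
  ultimately have "t_pair G R X (mul.opr X a c) (mul.opr X b c) = ?m"
    using m by (intro t_pair_eqI[OF X])
  then show ?thesis
    unfolding add.opr_def using trf_mul[OF fold _ abc(3)] t by simp
qed

lemma zero_mul:
  assumes X: "fin_gset G X" and b: "b \<in> obj X"
  shows "mul.opr X (add.unit X) b = add.unit X"
proof -
  have g: "gmap G gempty X id" by (rule gmap_empty) (simp_all add: X fin_gempty)
  have "mul.opr X (add.unit X) b =
      trf gempty X id (mul.opr gempty (THE z. z \<in> obj gempty) (res gempty X id b))"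
    unfolding add.unit_def by (rule trf_mul[OF g mul.the_empty b])
  then show ?thesis
    using add.push_empty[OF g _ mul.opr_in[OF fin_gempty mul.the_empty res_in[OF g b]]] by simp
qed

text \<open>
  Zero is a transfer from the empty set, and \<open>\<emptyset> \<rightarrow> C\<close> has no section over a nonempty fibre.
\<close>

lemma nrm_zero:
  assumes v: "gmap G C D v" and surj: "v ` pts C = pts D"
  shows "nrm C D v (add.unit C) = add.unit D"
proof -
  note fins = gmap_fin[OF v]
  have g: "gmap G gempty C id" "gmap G gempty D id" "gmap G gempty gempty id"
    by (rule gmap_empty; simp add: fins fin_gempty)+
  have "exponential_diagram G gempty C D gempty gempty id v id id id"
    unfolding exponential_diagram_def
  proof (intro conjI allI ballI impI g v)
    show "pullback_square G gempty C gempty D (id \<circ> id) id v id"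
      by (rule pullbackI) (use g v in auto)
    fix d s assume d: "d \<in> pts D" and s: "\<forall>c \<in> pts C. v c = d \<longrightarrow> s c \<in> pts gempty \<and> id (s c) = c"
    obtain c where "c \<in> pts C" "v c = d" using surj d by (metis imageE)
    with s show "\<exists>!\<pi>. \<pi> \<in> pts gempty \<and> id \<pi> = d \<and> (\<forall>x \<in> pts gempty. id x = \<pi> \<longrightarrow> id x = s (id (id x)))"
      by simp
  qed
  from nrm_trf[OF this add.the_empty] show ?thesis
    unfolding add.unit_def using res_id[OF fin_gempty] nrm_id[OF fin_gempty] add.the_empty by simp
qed

end


section \<open>Lifting idempotents from the bottom level\<close>

context group
begin

text \<open>
  A finite G-set is free exactly if it admits a map to \<open>G/e\<close>.  Keeping this map as part of the data allows
  elements of \<open>R(G/e)\<close> to be restricted to \<open>A\<close>.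
\<close>

definition free_cover ::
  "'a gset \<Rightarrow> ('a pt \<Rightarrow> 'a pt) \<Rightarrow> ('a pt \<Rightarrow> 'a pt) \<Rightarrow> 'a gset \<Rightarrow> bool" where
  "free_cover A v \<gamma> X \<longleftrightarrow> gmap G A X v \<and> v ` pts A = pts X \<and> gmap G A (free_orbit G) \<gamma>"

lemma free_cover_exists:
  assumes fin: "finite (carrier G)" and X: "fin_gset G X"
  obtains A v \<gamma> where "free_cover A v \<gamma> X"
proof -
  let ?\<Gamma> = "free_orbit G"
  let ?S = "pts ?\<Gamma> \<times> pts X" and ?\<alpha> = "\<lambda>g. map_prod (act ?\<Gamma> g) (act X g)"
  note \<Gamma> = fin_free_orbit[OF fin]
  have finS: "finite ?S" using \<Gamma> X by (simp add: fin_gset_finite)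
  have closed: "\<forall>g \<in> carrier G. \<forall>s \<in> ?S. ?\<alpha> g s \<in> ?S"
    and one: "\<forall>s \<in> ?S. ?\<alpha> \<one> s = s"
    and mult: "\<forall>g \<in> carrier G. \<forall>h \<in> carrier G. \<forall>s \<in> ?S. ?\<alpha> (g \<otimes> h) s = ?\<alpha> g (?\<alpha> h s)"
    using \<Gamma> X by (auto simp del: act_free_orbit simp: act_closed act_one act_mult)
  obtain A dec where real: "fin_gset G A \<and> bij_betw dec (pts A) ?S \<and>
      (\<forall>g \<in> carrier G. \<forall>x \<in> pts A. dec (act A g x) = ?\<alpha> g (dec x))"
    using gset_realization[OF finS closed one mult] by (elim exE) (rule that)
  then have A: "fin_gset G A" "bij_betw dec (pts A) ?S"
    "\<And>g x. g \<in> carrier G \<Longrightarrow> x \<in> pts A \<Longrightarrow> dec (act A g x) = ?\<alpha> g (dec x)"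
    by simp_all
  have dec: "dec x \<in> ?S" if "x \<in> pts A" for x using bspec[OF bij_betwE[OF A(2)] that] .
  have "gmap G A X (snd \<circ> dec)"
    by (rule gmapI) (use A(1,3) X dec in \<open>auto simp: mem_Times_iff\<close>)
  moreover have "gmap G A ?\<Gamma> (fst \<circ> dec)"
    by (rule gmapI) (use A(1,3) \<Gamma> dec in \<open>auto simp: mem_Times_iff\<close>)
  moreover have "(snd \<circ> dec) ` pts A = pts X"
  proof -
    have "(snd \<circ> dec) ` pts A = snd ` ?S"
      unfolding image_comp[symmetric] bij_betw_imp_surj_on[OF A(2)] ..
    moreover have "pts ?\<Gamma> \<noteq> {}" using one_closed by (auto simp: pts_free_orbit)
    ultimately show ?thesis by simp
  qed
  ultimately show thesis using that unfolding free_cover_def by blast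
qed

lemma free_orbit_act_inject:
  assumes "\<gamma> \<in> pts (free_orbit G)" "g \<in> carrier G" "h \<in> carrier G"
    and "act (free_orbit G) g \<gamma> = act (free_orbit G) h \<gamma>"
  shows "g = h"
  using assms by (auto simp: pts_free_orbit)

end

locale bottom_idempotent = product_functor G R for G (structure) and R :: "('a, 'u) bifun" +
  fixes e :: 'u
  assumes finite_group: "finite (carrier G)"
    and e_in: "e \<in> t_obj R (free_orbit G)"
    and e_idem: "mul.opr (free_orbit G) e e = e"
    and e_inv: "k \<in> carrier G \<Longrightarrow>
      t_map R (restriction G (free_orbit G) (free_orbit G) (right_mult G k)) e = e"
begin

abbreviation "\<Gamma> \<equiv> free_orbit G"

lemma res_e_idem:
  assumes "gmap G A \<Gamma> \<gamma>"
  shows "mul.opr A (res A \<Gamma> \<gamma> e) (res A \<Gamma> \<gamma> e) = res A \<Gamma> \<gamma> e"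
  using mul.res_opr[OF assms e_in e_in] e_idem by simp

text \<open>
  On the image of \<open>l\<close> the norm restricts to \<open>s\<close>, and on the complement to the empty product \<open>1\<close>.
\<close>

lemma idem_mul_nrm_inj:
  assumes s: "s \<in> obj A" "mul.opr A s s = s" and l: "gmap G W A l" and inj: "inj_on l (pts W)"
  shows "mul.opr A s (nrm W A l (res W A l s)) = s"
proof -
  note fins = gmap_fin[OF l]
  let ?C = "subgset A (pts A - l ` pts W)"
  have cl: "act A g x \<in> l ` pts W" if "g \<in> carrier G" "x \<in> l ` pts W" for g x
    using that gmap_act[OF l that(1), symmetric] act_closed[OF fins(1) that(1)] by auto
  have "coproduct (subgset A (l ` pts W)) ?C A id id"
    by (rule coproduct_subgset[OF fins(2) _ cl]) (use gmap_in[OF l] in auto)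
  then have c: "coproduct W ?C A l id"
    using l inj by (simp add: coproduct_def)
  note i = coproduct_gmaps[OF c]
  have ls: "res W A l s \<in> obj W" by (rule res_in[OF l s(1)])
  have n: "nrm W A l (res W A l s) \<in> obj A" by (rule nrm_in[OF l ls])
  have C: "fin_gset G ?C" using gmap_fin(1)[OF i(2)] .
  have g: "gmap G gempty W id" "gmap G gempty ?C id"
    by (rule gmap_empty; simp add: fins C fin_gempty)+
  have "pullback_square G gempty W ?C A id id l id"
    by (rule pullbackI[OF g l i(2)]) auto
  from res_nrm[OF this ls] have "res ?C A id (nrm W A l (res W A l s)) = mul.unit ?C"
    using mul.push_empty[OF g(2) _ res_in[OF g(1) ls]] by simp
  then have 2: "res ?C A id (mul.opr A s (nrm W A l (res W A l s))) = res ?C A id s"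
    using mul.res_opr[OF i(2) s(1) n] mul.opr_unit[OF C res_in[OF i(2) s(1)]] by simp
  have 1: "res W A l (mul.opr A s (nrm W A l (res W A l s))) = res W A l s"
    using mul.res_opr[OF l s(1) n] mul.push_inj[OF l inj ls] mul.res_opr[OF l s(1) s(1)] s(2) by simp
  show ?thesis
    by (rule glue_eq[OF c mul.opr_in[OF fins(2) s(1) n] s(1) 1 2])
qed

text \<open>
  On a single orbit, two maps to \<open>G/e\<close> differ by a right multiplication, and this fixes \<open>e\<close>.
\<close>

lemma res_e_transitive:
  assumes \<gamma>: "gmap G W \<Gamma> \<gamma>" and \<gamma>': "gmap G W \<Gamma> \<gamma>'"
    and x0: "x0 \<in> pts W" "\<And>x. x \<in> pts W \<Longrightarrow> \<exists>g \<in> carrier G. x = act W g x0"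
  shows "res W \<Gamma> \<gamma> e = res W \<Gamma> \<gamma>' e"
proof -
  obtain h where h: "h \<in> carrier G" "\<gamma> x0 = Elt h" using gmap_in[OF \<gamma> x0(1)] by (auto simp: pts_free_orbit)
  obtain h' where h': "h' \<in> carrier G" "\<gamma>' x0 = Elt h'" using gmap_in[OF \<gamma>' x0(1)] by (auto simp: pts_free_orbit)
  let ?k = "inv h \<otimes> h'"
  have k: "?k \<in> carrier G" using h h' by simp
  have "\<gamma>' x = right_mult G ?k (\<gamma> x)" if x: "x \<in> pts W" for x
  proof -
    obtain g where g: "g \<in> carrier G" "x = act W g x0" using x0(2)[OF x] by blast
    then have "\<gamma> x = Elt (g \<otimes> h)" "\<gamma>' x = Elt (g \<otimes> h')"
      using gmap_act[OF \<gamma> g(1) x0(1)] gmap_act[OF \<gamma>' g(1) x0(1)] h h' by simp_all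
    moreover have "g \<otimes> h \<otimes> (inv h \<otimes> h') = g \<otimes> h'"
      using g h h' by (metis inv_closed m_assoc m_closed r_inv r_one)
    ultimately show ?thesis by simp
  qed
  from res_res[OF \<gamma> gmap_right_mult[OF finite_group k] this e_in]
  show ?thesis using e_inv[OF k] by simp
qed

text \<open>
  A norm of \<open>e\<close> along a surjection absorbs every other norm of \<open>e\<close>.  Each orbit of the second source
  is free, hence it can be moved into \<open>A\<close>, where \<open>e\<close> is idempotent.
\<close>

lemma nrm_absorb:
  assumes A: "free_cover A v \<gamma> X" and f': "gmap G A' X f'" and \<gamma>': "gmap G A' \<Gamma> \<gamma>'"
  shows "mul.opr X (nrm A X v (res A \<Gamma> \<gamma> e)) (nrm A' X f' (res A' \<Gamma> \<gamma>' e)) = nrm A X v (res A \<Gamma> \<gamma> e)"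
  using f' \<gamma>'
proof (induction "card (pts A')" arbitrary: A' rule: less_induct)
  case less
  note f' = less.prems(1) and \<gamma>' = less.prems(2)
  have v: "gmap G A X v" and surj: "v ` pts A = pts X" and \<gamma>: "gmap G A \<Gamma> \<gamma>"
    using A by (simp_all add: free_cover_def)
  note fins = gmap_fin[OF v] gmap_fin[OF \<gamma>'] and X = gmap_fin(2)[OF v]
  let ?s = "res A \<Gamma> \<gamma> e" and ?z = "res A' \<Gamma> \<gamma>' e"
  have s: "?s \<in> obj A" and z: "?z \<in> obj A'" using res_in \<gamma> \<gamma>' e_in by blast+
  let ?u = "nrm A X v ?s"
  have u: "?u \<in> obj X" by (rule nrm_in[OF v s])
  show ?case
  proof (cases "pts A' = {}")
    case True
    then show ?thesis using mul.push_empty[OF f' True z] mul.opr_unit[OF X u] by simp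
  next
    case False
    then obtain a' where a': "a' \<in> pts A'" by blast
    define S where "S = (\<lambda>g. act A' g a') ` carrier G"
    have S_sub: "S \<subseteq> pts A'" using a' fins act_closed by (auto simp: S_def)
    have a'S: "a' \<in> S"
      unfolding S_def using act_one[OF fins(3) a'] by (intro image_eqI[of _ _ \<one>]) simp_all
    have S_cl: "act A' g x \<in> S" if "g \<in> carrier G" "x \<in> S" for g x
    proof -
      obtain h where h: "h \<in> carrier G" "x = act A' h a'" using \<open>x \<in> S\<close> by (auto simp: S_def)
      then have "act A' g x = act A' (g \<otimes> h) a'" using that fins a' by (simp add: act_mult)
      then show ?thesis using h that by (auto simp: S_def)
    qed
    let ?O = "subgset A' S" and ?C = "subgset A' (pts A' - S)"
    have c: "coproduct ?O ?C A' id id" by (rule coproduct_subgset[OF fins(3) S_sub S_cl])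
    note i = coproduct_gmaps[OF c]
    have O: "gmap G ?O X f'" "gmap G ?O \<Gamma> \<gamma>'" and C: "gmap G ?C X f'" "gmap G ?C \<Gamma> \<gamma>'"
      using gmap_comp[OF i(1) f'] gmap_comp[OF i(1) \<gamma>'] gmap_comp[OF i(2) f'] gmap_comp[OF i(2) \<gamma>']
      by simp_all
    have resO: "res ?O A' id ?z = res ?O \<Gamma> \<gamma>' e" and resC: "res ?C A' id ?z = res ?C \<Gamma> \<gamma>' e"
      using res_res[OF i(1) \<gamma>' _ e_in] res_res[OF i(2) \<gamma>' _ e_in] by simp_all
    let ?p = "nrm ?O X f' (res ?O \<Gamma> \<gamma>' e)" and ?q = "nrm ?C X f' (res ?C \<Gamma> \<gamma>' e)"
    have pq: "?p \<in> obj X" "?q \<in> obj X"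
      using nrm_in[OF O(1) res_in[OF O(2) e_in]] nrm_in[OF C(1) res_in[OF C(2) e_in]] by simp_all
    have split: "nrm A' X f' ?z = mul.opr X ?p ?q"
      using mul.push_split[OF c f' _ _ z, of f' f'] resO resC by simp
    have IH: "mul.opr X ?u ?q = ?u"
    proof (rule less.hyps[OF _ C])
      show "card (pts ?C) < card (pts A')"
        using a' a'S fins fin_gset_finite by (auto intro!: psubset_card_mono)
    qed
    obtain a where a: "a \<in> pts A" "v a = f' a'" using surj gmap_in[OF f' a'] by (metis imageE)
    have inj': "g = h" if "g \<in> carrier G" "h \<in> carrier G" "act A' g a' = act A' h a'" for g h
      by (rule free_orbit_act_inject[OF gmap_in[OF \<gamma>' a'] that(1,2)])
        (use that a' in \<open>simp flip: gmap_act[OF \<gamma>']\<close>)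
    have inj: "g = h" if "g \<in> carrier G" "h \<in> carrier G" "act A g a = act A h a" for g h
      by (rule free_orbit_act_inject[OF gmap_in[OF \<gamma> a(1)] that(1,2)])
        (use that a in \<open>simp flip: gmap_act[OF \<gamma>]\<close>)
    \<comment> \<open>The orbit of \<open>a'\<close> is free, so \<open>g a' \<mapsto> g a\<close> is well defined and moves it into \<open>A\<close>, over \<open>X\<close>.\<close>
    define l where "l x = act A (THE g. g \<in> carrier G \<and> act A' g a' = x) a" for x
    have l_act: "l (act A' g a') = act A g a" if "g \<in> carrier G" for g
    proof -
      have "(THE h. h \<in> carrier G \<and> act A' h a' = act A' g a') = g"
        using that inj' by (intro the_equality) auto
      then show ?thesis by (simp add: l_def)
    qed
    have l: "gmap G ?O A l"
    proof (rule gmapI[OF gmap_fin(1)[OF i(1)] fins(1)])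
      fix x assume "x \<in> pts ?O"
      then obtain h where h: "h \<in> carrier G" "x = act A' h a'" by (auto simp: S_def)
      then show "l x \<in> pts A" using a fins by (simp add: l_act act_closed)
      fix g assume g: "g \<in> carrier G"
      have "act ?O g x = act A' (g \<otimes> h) a'"
        using g h \<open>x \<in> pts ?O\<close> fins a' by (simp add: act_mult)
      then show "l (act ?O g x) = act A g (l x)"
        using g h fins a by (simp add: l_act act_mult)
    qed
    have l_inj: "inj_on l (pts ?O)"
      by (rule inj_onI) (auto simp: S_def l_act dest: inj)
    have vl: "f' x = v (l x)" if x: "x \<in> pts ?O" for x
    proof -
      obtain h where h: "h \<in> carrier G" "x = act A' h a'" using x by (auto simp: S_def)
      then show ?thesis
        using gmap_act[OF f' h(1) a'] gmap_act[OF v h(1) a(1)] a(2) by (simp add: l_act)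
    qed
    have "res ?O \<Gamma> \<gamma>' e = res ?O \<Gamma> (\<gamma> \<circ> l) e"
    proof (rule res_e_transitive[OF O(2) gmap_comp[OF l \<gamma>]])
      show "a' \<in> pts ?O" using a'S by simp
      show "\<exists>g \<in> carrier G. x = act ?O g a'" if "x \<in> pts ?O" for x
        using that a'S by (auto simp: S_def)
    qed
    also have "\<dots> = res ?O A l ?s" using res_res[OF l \<gamma> _ e_in, of "\<gamma> \<circ> l"] by simp
    finally have "?p = nrm A X v (nrm ?O A l (res ?O A l ?s))"
      using nrm_nrm[OF l v vl res_in[OF l s]] by simp
    then have "mul.opr X ?u ?p = nrm A X v (mul.opr A ?s (nrm ?O A l (res ?O A l ?s)))"
      using mul.push_opr[OF v s nrm_in[OF l res_in[OF l s]]] by simp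
    also have "\<dots> = ?u" using idem_mul_nrm_inj[OF s res_e_idem[OF \<gamma>] l l_inj] by simp
    finally have "mul.opr X ?u ?p = ?u" .
    then show ?thesis using mul.opr_assoc[OF X u pq] IH by (simp add: split)
  qed
qed

text \<open>
  One can take \<open>A = G \<times> X\<close>.  By absorption every free cover gives the same element, so the
  choice does not affect the value.
\<close>

definition lift :: "'a gset \<Rightarrow> 'u" where
  "lift X = (SOME u. \<exists>A v \<gamma>. free_cover A v \<gamma> X \<and> u = nrm A X v (res A \<Gamma> \<gamma> e))"

lemma lift_eq:
  assumes "free_cover A v \<gamma> X"
  shows "lift X = nrm A X v (res A \<Gamma> \<gamma> e)"
proof -
  have "\<exists>A v \<gamma>. free_cover A v \<gamma> X \<and> lift X = nrm A X v (res A \<Gamma> \<gamma> e)"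
    unfolding lift_def by (rule someI_ex) (use assms in blast)
  then obtain A' v' \<gamma>' where A': "free_cover A' v' \<gamma>' X" "lift X = nrm A' X v' (res A' \<Gamma> \<gamma>' e)"
    by blast
  have g: "gmap G A X v" "gmap G A \<Gamma> \<gamma>" "gmap G A' X v'" "gmap G A' \<Gamma> \<gamma>'"
    using assms A' by (simp_all add: free_cover_def)
  have "mul.opr X (nrm A X v (res A \<Gamma> \<gamma> e)) (lift X) = mul.opr X (lift X) (nrm A X v (res A \<Gamma> \<gamma> e))"
    using mul.opr_commute[OF gmap_fin(2)[OF g(1)]] nrm_in res_in g e_in A'(2) by simp
  then show ?thesis using nrm_absorb[OF assms g(3,4)] nrm_absorb[OF A'(1) g(1,2)] A'(2) by simp
qed

lemma lift_in: "fin_gset G X \<Longrightarrow> lift X \<in> obj X"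
proof -
  assume "fin_gset G X"
  then obtain A v \<gamma> where A: "free_cover A v \<gamma> X" using free_cover_exists[OF finite_group] by blast
  then show ?thesis using lift_eq[OF A] nrm_in res_in e_in unfolding free_cover_def by metis
qed

lemma lift_idem:
  assumes "fin_gset G X"
  shows "mul.opr X (lift X) (lift X) = lift X"
proof -
  obtain A v \<gamma> where A: "free_cover A v \<gamma> X" using free_cover_exists[OF finite_group assms] .
  then show ?thesis using lift_eq[OF A] nrm_absorb[OF A] by (simp add: free_cover_def)
qed

lemma lift_mul_nrm:
  assumes f: "gmap G X Y f"
  shows "mul.opr Y (lift Y) (nrm X Y f (lift X)) = lift Y"
proof -
  obtain A v \<gamma> where A: "free_cover A v \<gamma> X" using free_cover_exists[OF finite_group gmap_fin(1)[OF f]] .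
  obtain B w \<delta> where B: "free_cover B w \<delta> Y" using free_cover_exists[OF finite_group gmap_fin(2)[OF f]] .
  have g: "gmap G A X v" "gmap G A \<Gamma> \<gamma>" using A by (simp_all add: free_cover_def)
  have "nrm X Y f (lift X) = nrm A Y (f \<circ> v) (res A \<Gamma> \<gamma> e)"
    using nrm_nrm[OF g(1) f _ res_in[OF g(2) e_in], of "f \<circ> v"] lift_eq[OF A] by simp
  then show ?thesis using nrm_absorb[OF B gmap_comp[OF g(1) f] g(2)] lift_eq[OF B] by simp
qed

lemma res_lift:
  assumes f: "gmap G X Y f"
  shows "res X Y f (lift Y) = lift X"
proof -
  obtain A v \<gamma> where A: "free_cover A v \<gamma> Y" using free_cover_exists[OF finite_group gmap_fin(2)[OF f]] .
  have g: "gmap G A Y v" "gmap G A \<Gamma> \<gamma>" and surj: "v ` pts A = pts Y"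
    using A by (simp_all add: free_cover_def)
  obtain P p q where P: "pullback_square G P A X Y p q v f" using pullback_exists[OF g(1) f] .
  note gP = pullback_gmaps[OF P]
  have "pts X \<subseteq> q ` pts P"
  proof
    fix x assume x: "x \<in> pts X"
    then obtain a where "a \<in> pts A" "v a = f x" using surj gmap_in[OF f x] by (metis imageE)
    then show "x \<in> q ` pts P" using pullback_ex[OF P _ x] by blast
  qed
  then have cov: "free_cover P q (\<gamma> \<circ> p) X"
    using gP(2) gmap_comp[OF gP(1) g(2)] gmap_in[OF gP(2)] by (auto simp: free_cover_def)
  show ?thesis
    using lift_eq[OF A] lift_eq[OF cov] res_nrm[OF P res_in[OF g(2) e_in]]
      res_res[OF gP(1) g(2) _ e_in, of "\<gamma> \<circ> p"] by simp
qed

lemma lift_bottom: "lift \<Gamma> = e"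
proof -
  have \<Gamma>: "fin_gset G \<Gamma>" by (rule fin_free_orbit[OF finite_group])
  have "free_cover \<Gamma> id id \<Gamma>" by (simp add: free_cover_def gmap_id[OF \<Gamma>])
  from lift_eq[OF this] show ?thesis using e_in nrm_id[OF \<Gamma>] res_id[OF \<Gamma>] by simp
qed

end

context group
begin

lemma subgset_subgset: "S' \<subseteq> S \<Longrightarrow> subgset (subgset X S) S' = subgset X S'"
  by (auto simp: subgset_def fun_eq_iff restrict_def)

end

context product_functor
begin

lemma res_nrm_subgset:
  assumes t: "gmap G E Q t" and z: "z \<in> obj E"
    and N: "N \<subseteq> pts Q" "\<And>g \<pi>. g \<in> carrier G \<Longrightarrow> \<pi> \<in> N \<Longrightarrow> act Q g \<pi> \<in> N"
  defines "EN \<equiv> subgset E {x \<in> pts E. t x \<in> N}"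
  shows "res (subgset Q N) Q id (nrm E Q t z) = nrm EN (subgset Q N) t (res EN E id z)"
    and "gmap G EN E id" "gmap G EN (subgset Q N) t" "gmap G (subgset Q N) Q id"
proof -
  note fins = gmap_fin[OF t]
  have cl: "act E g x \<in> {x \<in> pts E. t x \<in> N}" if "g \<in> carrier G" "x \<in> {x \<in> pts E. t x \<in> N}" for g x
    using that N(2) fins by (simp add: act_closed gmap_act[OF t])
  show g: "gmap G EN E id" "gmap G (subgset Q N) Q id"
    unfolding EN_def using gmap_subgset[OF gmap_id[OF fins(1)] _ cl] gmap_subgset[OF gmap_id[OF fins(2)] N]
    by auto
  show g': "gmap G EN (subgset Q N) t"
    unfolding EN_def
    by (rule gmap_into_subgset[OF gmap_subgset[OF t _ cl] gmap_fin(1)[OF g(2)]]) auto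
  have "pullback_square G EN E (subgset Q N) Q id t t id"
    by (rule pullbackI[OF g(1) g' t g(2)]) (auto simp: EN_def)
  from res_nrm[OF this z] show "res (subgset Q N) Q id (nrm E Q t z) = nrm EN (subgset Q N) t (res EN E id z)" .
qed

end

context bottom_idempotent
begin

text \<open>
  If \<open>\<epsilon>\<close> takes values in only one summand, then \<open>w\<close> is pulled back from its component \<open>e\<close>, and the norm is taken
  along a free cover of \<open>T\<close>.
\<close>

lemma nrm_pure:
  assumes \<gamma>: "gmap G A \<Gamma> \<gamma>" and i: "gmap G A (gsum A A) i" "\<And>c. gfold (i c) = c"
    and w: "w \<in> obj (gsum A A)" "res A (gsum A A) i w = res A \<Gamma> \<gamma> e"
    and \<epsilon>: "gmap G B (gsum A A) \<epsilon>" "\<And>x. x \<in> pts B \<Longrightarrow> \<epsilon> x \<in> i ` pts A"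
    and t: "gmap G B T t" "t ` pts B = pts T"
  shows "nrm B T t (res B (gsum A A) \<epsilon> w) = lift T"
proof -
  note g = gmap_comp[OF \<epsilon>(1) gmap_gfold[OF gmap_fin(1)[OF i(1)]]]
  have \<epsilon>': "\<epsilon> x = i ((gfold \<circ> \<epsilon>) x)" if "x \<in> pts B" for x
    using \<epsilon>(2)[OF that] i(2) by auto
  have "res B (gsum A A) \<epsilon> w = res B A (gfold \<circ> \<epsilon>) (res A \<Gamma> \<gamma> e)"
    using res_res[OF g i(1) \<epsilon>' w(1)] unfolding w(2) by (rule sym)
  also have "\<dots> = res B \<Gamma> (\<gamma> \<circ> (gfold \<circ> \<epsilon>)) e"
    by (rule res_res[OF g \<gamma> _ e_in]) simp
  finally show ?thesis
    using lift_eq[of B t "\<gamma> \<circ> (gfold \<circ> \<epsilon>)" T] t gmap_comp[OF g \<gamma>] by (simp add: free_cover_def)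
qed

text \<open>
  In the exponential diagram of the fold map \<open>A \<squnion> A \<rightarrow> A\<close> along a free cover, the constant sections
  with values in one summand form a copy of \<open>X\<close>, and contribute the lift of \<open>e\<close>.
\<close>

lemma pure_part:
  assumes exp: "exponential_diagram G (gsum A A) A X E Q gfold v \<epsilon> t h"
    and cov: "free_cover A v \<gamma> X" and i: "gmap G A (gsum A A) i" "\<And>c. gfold (i c) = c"
    and w: "w \<in> obj (gsum A A)" "res A (gsum A A) i w = res A \<Gamma> \<gamma> e"
  defines "N \<equiv> {\<pi> \<in> pts Q. \<forall>x \<in> pts E. t x = \<pi> \<longrightarrow> \<epsilon> x \<in> i ` pts A}"
  shows "trf (subgset Q N) X h (res (subgset Q N) Q id (nrm E Q t (res E (gsum A A) \<epsilon> w))) = lift X"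
    and "\<And>g \<pi>. g \<in> carrier G \<Longrightarrow> \<pi> \<in> N \<Longrightarrow> act Q g \<pi> \<in> N"
proof -
  have \<epsilon>: "gmap G E (gsum A A) \<epsilon>" and Epb: "pullback_square G E A Q X (gfold \<circ> \<epsilon>) t v h"
    and univ: "\<And>d s. d \<in> pts X \<Longrightarrow> \<forall>c \<in> pts A. v c = d \<longrightarrow> s c \<in> pts (gsum A A) \<and> gfold (s c) = c \<Longrightarrow>
      \<exists>!\<pi>. \<pi> \<in> pts Q \<and> h \<pi> = d \<and> (\<forall>x \<in> pts E. t x = \<pi> \<longrightarrow> \<epsilon> x = s (gfold (\<epsilon> x)))"
    using exp unfolding exponential_diagram_def by blast+
  have v: "v ` pts A = pts X" and \<gamma>: "gmap G A \<Gamma> \<gamma>" using cov by (simp_all add: free_cover_def)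
  note gE = pullback_gmaps[OF Epb]
  note fins = gmap_fin[OF gE(2)] gmap_fin[OF i(1)]
  have N_sub: "N \<subseteq> pts Q" by (auto simp: N_def)
  show cl: "act Q g \<pi> \<in> N" if g: "g \<in> carrier G" and \<pi>: "\<pi> \<in> N" for g \<pi>
  proof -
    have \<pi>Q: "\<pi> \<in> pts Q" using \<pi> N_sub by blast
    have "\<epsilon> x \<in> i ` pts A" if x: "x \<in> pts E" and tx: "t x = act Q g \<pi>" for x
    proof -
      let ?x = "act E (inv g) x"
      have xE: "?x \<in> pts E" using x g fins by (simp add: act_closed)
      have "t ?x = \<pi>" using gmap_act[OF gE(2) _ x, of "inv g"] g tx \<pi>Q fins by (simp add: act_inv)
      then obtain a where a: "a \<in> pts A" "\<epsilon> ?x = i a" using \<pi> xE unfolding N_def by blast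
      have "\<epsilon> x = \<epsilon> (act E g ?x)" using g x fins by (simp add: act_inv)
      also have "\<dots> = i (act A g a)" using gmap_act[OF \<epsilon> g xE] gmap_act[OF i(1) g a(1)] a by simp
      finally show ?thesis using act_closed[OF fins(3) g a(1)] by blast
    qed
    then show ?thesis using \<pi>Q g fins by (simp add: N_def act_closed)
  qed
  let ?N = "subgset Q N" and ?EN = "subgset E {x \<in> pts E. t x \<in> N}"
  have z: "res E (gsum A A) \<epsilon> w \<in> obj E" by (rule res_in[OF \<epsilon> w(1)])
  note r = res_nrm_subgset[OF gE(2) z N_sub cl]
  have t_surj: "\<exists>x \<in> pts E. t x = \<pi>" if \<pi>: "\<pi> \<in> pts Q" for \<pi>
  proof -
    obtain a where "a \<in> pts A" "v a = h \<pi>" using v gmap_in[OF gE(4) \<pi>] by (metis imageE)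
    then show ?thesis using pullback_ex[OF Epb _ \<pi>] by blast
  qed
  have h: "gmap G ?N X h" using gmap_comp[OF r(4) gE(4)] by simp
  have pure_iff: "\<pi> \<in> N \<longleftrightarrow> (\<forall>x \<in> pts E. t x = \<pi> \<longrightarrow> \<epsilon> x = i (gfold (\<epsilon> x)))" if "\<pi> \<in> pts Q" for \<pi>
  proof -
    have "\<epsilon> x \<in> i ` pts A \<longleftrightarrow> \<epsilon> x = i (gfold (\<epsilon> x))" if "x \<in> pts E" for x
      using gmap_in[OF gE(1) that] i(2) by (auto simp: image_iff)
    then show ?thesis using that by (auto simp: N_def)
  qed
  have sec: "\<exists>!\<pi>. \<pi> \<in> pts Q \<and> h \<pi> = d \<and> (\<forall>x \<in> pts E. t x = \<pi> \<longrightarrow> \<epsilon> x = i (gfold (\<epsilon> x)))"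
    if "d \<in> pts X" for d
    using univ[OF that, of i] gmap_in[OF i(1)] i(2) by simp
  have "bij_betw h N (pts X)"
  proof (rule bij_betw_imageI)
    show "inj_on h N"
    proof (rule inj_onI)
      fix \<pi> \<pi>' assume \<pi>: "\<pi> \<in> N" "\<pi>' \<in> N" "h \<pi> = h \<pi>'"
      then have q: "\<pi> \<in> pts Q" "\<pi>' \<in> pts Q" using N_sub by auto
      show "\<pi> = \<pi>'"
        using sec[OF gmap_in[OF gE(4) q(1)]] q \<pi> pure_iff by (metis (no_types, lifting))
    qed
    show "h ` N = pts X"
    proof
      show "h ` N \<subseteq> pts X" using gmap_in[OF gE(4)] N_sub by blast
      show "pts X \<subseteq> h ` N"
      proof
        fix d assume "d \<in> pts X"
        then obtain \<pi> where "\<pi> \<in> pts Q" "h \<pi> = d" "\<forall>x \<in> pts E. t x = \<pi> \<longrightarrow> \<epsilon> x = i (gfold (\<epsilon> x))"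
          using sec by blast
        then show "d \<in> h ` N" using pure_iff by blast
      qed
    qed
  qed
  then have bij: "bij_betw h (pts ?N) (pts X)" by simp
  have \<epsilon>N: "gmap G ?EN (gsum A A) \<epsilon>" using gmap_comp[OF r(2) \<epsilon>] by simp
  have "t ` pts ?EN = pts ?N" using t_surj N_sub by auto
  then have "nrm ?EN ?N t (res ?EN (gsum A A) \<epsilon> w) = lift ?N"
    by (intro nrm_pure[OF \<gamma> i w \<epsilon>N _ r(3)]) (auto simp: N_def)
  then have "res ?N Q id (nrm E Q t (res E (gsum A A) \<epsilon> w)) = lift ?N"
    using r(1) res_res[OF r(2) \<epsilon> _ w(1), of \<epsilon>] by simp
  also have "\<dots> = res ?N X h (lift X)" using res_lift[OF h] by simp
  finally show "trf ?N X h (res ?N Q id (nrm E Q t (res E (gsum A A) \<epsilon> w))) = lift X"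
    using add.push_bij[OF h bij lift_in] gmap_fin(2)[OF h] by simp
qed

end

locale complementary_idempotents = product_functor G R +
  idem1: bottom_idempotent G R e1 + idem2: bottom_idempotent G R e2
  for G (structure) and R :: "('a, 'u) bifun" and e1 e2 +
  assumes orthogonal: "mul.opr (free_orbit G) e1 e2 = add.unit (free_orbit G)"
    and complete: "add.opr (free_orbit G) e1 e2 = mul.unit (free_orbit G)"
begin

abbreviation "\<Gamma> \<equiv> free_orbit G"

lemma lift_orthogonal:
  assumes X: "fin_gset G X"
  shows "mul.opr X (idem1.lift X) (idem2.lift X) = add.unit X"
proof -
  obtain A v \<gamma> where A: "free_cover A v \<gamma> X" using free_cover_exists[OF idem1.finite_group X] .
  then have g: "gmap G A X v" "gmap G A \<Gamma> \<gamma>" and surj: "v ` pts A = pts X" by (simp_all add: free_cover_def)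
  have s: "res A \<Gamma> \<gamma> e1 \<in> obj A" "res A \<Gamma> \<gamma> e2 \<in> obj A" using res_in[OF g(2)] idem1.e_in idem2.e_in by auto
  have "mul.opr A (res A \<Gamma> \<gamma> e1) (res A \<Gamma> \<gamma> e2) = add.unit A"
    using mul.res_opr[OF g(2) idem1.e_in idem2.e_in] add.res_unit[OF g(2)] orthogonal by simp
  then show ?thesis
    using idem1.lift_eq[OF A] idem2.lift_eq[OF A] mul.push_opr[OF g(1) s] nrm_zero[OF g(1) surj] by simp
qed

text \<open>
  The norm of \<open>1 = e1 + e2\<close> along a free cover is a transfer from the set \<open>Q\<close> of all functions from the fibres
  to the two summands.  The constant functions \<open>N1\<close> and \<open>N2\<close> contribute the two lifts.  On the
  remaining functions \<open>M\<close> the norm is the product of a lift of \<open>e1\<close> and a lift of \<open>e2\<close>, because both values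
  occur in every fibre, and so it is zero.
\<close>

lemma lift_complete:
  assumes X: "fin_gset G X"
  shows "add.opr X (idem1.lift X) (idem2.lift X) = mul.unit X"
proof -
  obtain A v \<gamma> where cov: "free_cover A v \<gamma> X" using free_cover_exists[OF idem1.finite_group X] .
  then have v: "gmap G A X v" and \<gamma>: "gmap G A \<Gamma> \<gamma>" and surj: "v ` pts A = pts X"
    by (simp_all add: free_cover_def)
  have A: "fin_gset G A" using gmap_fin(1)[OF v] .
  let ?S = "gsum A A"
  let ?s1 = "res A \<Gamma> \<gamma> e1" and ?s2 = "res A \<Gamma> \<gamma> e2"
  have s: "?s1 \<in> obj A" "?s2 \<in> obj A" using res_in[OF \<gamma>] idem1.e_in idem2.e_in by auto
  define w where "w = t_pair G R A ?s1 ?s2"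
  have w: "w \<in> obj ?S" "res A ?S InL w = ?s1" "res A ?S InR w = ?s2"
    using t_pair[OF A s] by (simp_all add: w_def)
  obtain E Q \<epsilon> t h where exp: "exponential_diagram G ?S A X E Q gfold v \<epsilon> t h"
    using exponential_exists[OF gmap_gfold[OF A] v] .
  then have \<epsilon>: "gmap G E ?S \<epsilon>" and Epb: "pullback_square G E A Q X (gfold \<circ> \<epsilon>) t v h"
    by (simp_all add: exponential_diagram_def)
  note gE = pullback_gmaps[OF Epb]
  note t = gE(2) and h = gE(4)
  have Q: "fin_gset G Q" using gmap_fin(1)[OF h] .
  have t_surj: "\<exists>x \<in> pts E. t x = \<pi>" if \<pi>: "\<pi> \<in> pts Q" for \<pi>
  proof -
    obtain a where "a \<in> pts A" "v a = h \<pi>" using surj gmap_in[OF h \<pi>] by (metis imageE)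
    then show ?thesis using pullback_ex[OF Epb _ \<pi>] by blast
  qed
  define y where "y = nrm E Q t (res E ?S \<epsilon> w)"
  have z: "res E ?S \<epsilon> w \<in> obj E" by (rule res_in[OF \<epsilon> w(1)])
  have y: "y \<in> obj Q" unfolding y_def by (rule nrm_in[OF t z])
  have "add.opr A ?s1 ?s2 = mul.unit A"
    using add.res_opr[OF \<gamma> idem1.e_in idem2.e_in] mul.res_unit[OF \<gamma>] complete by simp
  then have one: "trf Q X h y = mul.unit X"
    using nrm_trf[OF exp w(1)] mul.push_unit[OF v] by (simp add: y_def add.opr_def flip: w_def)
  define N1 where "N1 = {\<pi> \<in> pts Q. \<forall>x \<in> pts E. t x = \<pi> \<longrightarrow> \<epsilon> x \<in> InL ` pts A}"
  define N2 where "N2 = {\<pi> \<in> pts Q. \<forall>x \<in> pts E. t x = \<pi> \<longrightarrow> \<epsilon> x \<in> InR ` pts A}"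
  define M where "M = pts Q - N1 - N2"
  have N1: "trf (subgset Q N1) X h (res (subgset Q N1) Q id y) = idem1.lift X"
    and cl1: "\<And>g \<pi>. g \<in> carrier G \<Longrightarrow> \<pi> \<in> N1 \<Longrightarrow> act Q g \<pi> \<in> N1"
    unfolding N1_def y_def using idem1.pure_part[OF exp cov gmap_InL[OF A A] _ w(1,2)] by simp_all
  have N2: "trf (subgset Q N2) X h (res (subgset Q N2) Q id y) = idem2.lift X"
    and cl2: "\<And>g \<pi>. g \<in> carrier G \<Longrightarrow> \<pi> \<in> N2 \<Longrightarrow> act Q g \<pi> \<in> N2"
    unfolding N2_def y_def using idem2.pure_part[OF exp cov gmap_InR[OF A A] _ w(1,3)] by simp_all
  have disj: "\<pi> \<notin> N2" if \<pi>: "\<pi> \<in> N1" for \<pi>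
  proof -
    obtain x where "x \<in> pts E" "t x = \<pi>" using t_surj \<pi> by (auto simp: N1_def)
    with \<pi> have "x \<in> pts E" "t x = \<pi>" "\<epsilon> x \<notin> InR ` pts A" by (auto simp: N1_def)
    then show ?thesis by (auto simp: N2_def)
  qed
  let ?Q2 = "subgset Q (pts Q - N1)"
  have c1: "coproduct (subgset Q N1) ?Q2 Q id id"
    by (rule coproduct_subgset[OF Q _ cl1]) (auto simp: N1_def)
  note i1 = coproduct_gmaps[OF c1]
  have "coproduct (subgset ?Q2 N2) (subgset ?Q2 (pts ?Q2 - N2)) ?Q2 id id"
  proof (rule coproduct_subgset)
    show "fin_gset G ?Q2" using gmap_fin(1)[OF i1(2)] .
    show "N2 \<subseteq> pts ?Q2" using disj by (auto simp: N2_def)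
    then show "act ?Q2 g x \<in> N2" if "g \<in> carrier G" "x \<in> N2" for g x using that cl2 by auto
  qed
  moreover have "N2 \<subseteq> pts Q - N1" using disj by (auto simp: N2_def)
  ultimately have c2: "coproduct (subgset Q N2) (subgset Q M) ?Q2 id id"
    by (simp add: subgset_subgset M_def)
  note i2 = coproduct_gmaps[OF c2]
  have gM: "gmap G (subgset Q M) Q id" using gmap_comp[OF i2(2) i1(2)] by simp
  have hM: "gmap G (subgset Q M) X h" and h2: "gmap G ?Q2 X h"
    using gmap_comp[OF gM h] gmap_comp[OF i1(2) h] by simp_all
  have M_cl: "act Q g \<pi> \<in> M" if "g \<in> carrier G" "\<pi> \<in> M" for g \<pi>
    using act_closed[OF gmap_fin(1)[OF gM] that(1), of \<pi>] that by simp
  have "res (subgset Q M) Q id y = add.unit (subgset Q M)"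
  proof -
    let ?EM = "subgset E {x \<in> pts E. t x \<in> M}"
    have M_sub: "M \<subseteq> pts Q" by (auto simp: M_def)
    note r = res_nrm_subgset[OF t z M_sub M_cl]
    let ?F = "{x \<in> pts ?EM. \<epsilon> x \<in> InL ` pts A}"
    have \<epsilon>M: "gmap G ?EM ?S \<epsilon>" using gmap_comp[OF r(2) \<epsilon>] by simp
    have c: "coproduct (subgset ?EM ?F) (subgset ?EM (pts ?EM - ?F)) ?EM id id"
    proof (rule coproduct_subgset)
      show "fin_gset G ?EM" using gmap_fin(1)[OF r(2)] .
      fix g x assume g: "g \<in> carrier G" and x: "x \<in> ?F"
      then obtain a where a: "a \<in> pts A" "\<epsilon> x = InL a" by blast
      have "\<epsilon> (act ?EM g x) = InL (act A g a)"
        using gmap_act[OF \<epsilon>M g, of x] x a by simp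
      then show "act ?EM g x \<in> ?F"
        using act_closed[OF gmap_fin(1)[OF r(2)] g, of x] x act_closed[OF A g a(1)] by auto
    qed blast
    note i = coproduct_gmaps[OF c]
    have F1: "gmap G (subgset ?EM ?F) ?S \<epsilon>" "gmap G (subgset ?EM ?F) (subgset Q M) t"
      and F2: "gmap G (subgset ?EM (pts ?EM - ?F)) ?S \<epsilon>"
        "gmap G (subgset ?EM (pts ?EM - ?F)) (subgset Q M) t"
      using gmap_comp[OF i(1) \<epsilon>M] gmap_comp[OF i(1) r(3)] gmap_comp[OF i(2) \<epsilon>M] gmap_comp[OF i(2) r(3)]
      by simp_all
    have S_cases: "\<epsilon> x \<in> InL ` pts A \<or> \<epsilon> x \<in> InR ` pts A" if "x \<in> pts E" for x
      using gmap_in[OF \<epsilon> that] by (simp add: pts_gsum)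
    have "M \<subseteq> t ` ?F"
    proof
      fix \<pi> assume "\<pi> \<in> M"
      then obtain x where x: "x \<in> pts E" "t x = \<pi>" "\<epsilon> x \<notin> InR ` pts A" by (auto simp: M_def N2_def)
      then have "x \<in> ?F" using S_cases[OF x(1)] \<open>\<pi> \<in> M\<close> by simp
      then show "\<pi> \<in> t ` ?F" using x(2) by blast
    qed
    then have t1: "t ` pts (subgset ?EM ?F) = pts (subgset Q M)" by auto
    have "M \<subseteq> t ` (pts ?EM - ?F)"
    proof
      fix \<pi> assume "\<pi> \<in> M"
      then obtain x where "x \<in> pts E" "t x = \<pi>" "\<epsilon> x \<notin> InL ` pts A" by (auto simp: M_def N1_def)
      then show "\<pi> \<in> t ` (pts ?EM - ?F)" using \<open>\<pi> \<in> M\<close> by auto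
    qed
    then have t2: "t ` pts (subgset ?EM (pts ?EM - ?F)) = pts (subgset Q M)" by auto
    have zM: "res ?EM ?S \<epsilon> w \<in> obj ?EM" by (rule res_in[OF \<epsilon>M w(1)])
    have "res (subgset Q M) Q id y = nrm ?EM (subgset Q M) t (res ?EM ?S \<epsilon> w)"
      using r(1) res_res[OF r(2) \<epsilon> _ w(1), of \<epsilon>] by (simp add: y_def)
    also have "\<dots> = mul.opr (subgset Q M)
        (nrm (subgset ?EM ?F) (subgset Q M) t (res (subgset ?EM ?F) ?EM id (res ?EM ?S \<epsilon> w)))
        (nrm (subgset ?EM (pts ?EM - ?F)) (subgset Q M) t
          (res (subgset ?EM (pts ?EM - ?F)) ?EM id (res ?EM ?S \<epsilon> w)))"
      by (rule mul.push_split[OF c r(3) _ _ zM]) simp_all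
    also have "res (subgset ?EM ?F) ?EM id (res ?EM ?S \<epsilon> w) = res (subgset ?EM ?F) ?S \<epsilon> w"
      by (rule res_res[OF i(1) \<epsilon>M _ w(1)]) simp
    also have "res (subgset ?EM (pts ?EM - ?F)) ?EM id (res ?EM ?S \<epsilon> w) =
        res (subgset ?EM (pts ?EM - ?F)) ?S \<epsilon> w"
      by (rule res_res[OF i(2) \<epsilon>M _ w(1)]) simp
    also have "nrm (subgset ?EM ?F) (subgset Q M) t (res (subgset ?EM ?F) ?S \<epsilon> w) =
        idem1.lift (subgset Q M)"
      by (rule idem1.nrm_pure[OF \<gamma> gmap_InL[OF A A] _ w(1,2) F1(1) _ F1(2) t1]) auto
    also have "nrm (subgset ?EM (pts ?EM - ?F)) (subgset Q M) t
        (res (subgset ?EM (pts ?EM - ?F)) ?S \<epsilon> w) = idem2.lift (subgset Q M)"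
      by (rule idem2.nrm_pure[OF \<gamma> gmap_InR[OF A A] _ w(1,3) F2(1) _ F2(2) t2]) (use S_cases in auto)
    also have "mul.opr (subgset Q M) (idem1.lift (subgset Q M)) (idem2.lift (subgset Q M)) =
        add.unit (subgset Q M)"
      by (rule lift_orthogonal[OF gmap_fin(1)[OF gM]])
    finally show ?thesis .
  qed
  then have M0: "trf (subgset Q M) X h (res (subgset Q M) Q id y) = add.unit X"
    using add.push_unit[OF hM] by simp
  have y2: "res ?Q2 Q id y \<in> obj ?Q2" by (rule res_in[OF i1(2) y])
  have "res (subgset Q N2) ?Q2 id (res ?Q2 Q id y) = res (subgset Q N2) Q id y"
    "res (subgset Q M) ?Q2 id (res ?Q2 Q id y) = res (subgset Q M) Q id y"
    using res_res[OF i2(1) i1(2) _ y, of id] res_res[OF i2(2) i1(2) _ y, of id] by simp_all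
  then have "trf ?Q2 X h (res ?Q2 Q id y) = idem2.lift X"
    using add.push_split[OF c2 h2 _ _ y2, of h h] N2 M0 add.opr_unit[OF X idem2.lift_in[OF X]] by simp
  moreover have "trf Q X h y = add.opr X (trf (subgset Q N1) X h (res (subgset Q N1) Q id y))
      (trf ?Q2 X h (res ?Q2 Q id y))"
    by (rule add.push_split[OF c1 h _ _ y]) simp_all
  ultimately show ?thesis using one N1 by simp
qed

end

section \<open>Splitting off a factor\<close>

context bottom_idempotent
begin

text \<open>
  Multiplication by the lifted idempotent commutes with restrictions since these preserve lifts, and
  with transfers by Frobenius reciprocity.  For norms, \<open>lift Y\<close> absorbs the factor by which the norms of
  \<open>x\<close> and of \<open>lift X\<cdot>x\<close> differ.
\<close>

lemma lift_mul_cong: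
  assumes \<Phi>: "\<Phi> \<in> bispan_hom G X Y" and x: "x \<in> obj X" "x' \<in> obj X"
    and eq: "mul.opr X (lift X) x = mul.opr X (lift X) x'"
  shows "mul.opr Y (lift Y) (t_map R \<Phi> x) = mul.opr Y (lift Y) (t_map R \<Phi> x')"
proof -
  have res: "mul.opr V (lift V) (res V W f y) = mul.opr V (lift V) (res V W f y')"
    if f: "gmap G V W f" and y: "y \<in> obj W" "y' \<in> obj W" "mul.opr W (lift W) y = mul.opr W (lift W) y'"
    for V W f y y'
    using mul.res_opr[OF f lift_in y(1)] mul.res_opr[OF f lift_in y(2)] y(3) res_lift[OF f]
      gmap_fin(2)[OF f] by simp
  have nrm: "mul.opr W (lift W) (nrm V W f y) = mul.opr W (lift W) (nrm V W f y')"
    if f: "gmap G V W f" and y: "y \<in> obj V" "y' \<in> obj V" "mul.opr V (lift V) y = mul.opr V (lift V) y'"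
    for V W f y y'
  proof -
    note fins = gmap_fin[OF f]
    have "mul.opr W (lift W) (nrm V W f x) = mul.opr W (lift W) (nrm V W f (mul.opr V (lift V) x))"
      if x: "x \<in> obj V" for x
      using mul.push_opr[OF f lift_in[OF fins(1)] x] lift_mul_nrm[OF f]
        mul.opr_assoc[OF fins(2) lift_in[OF fins(2)] nrm_in[OF f lift_in[OF fins(1)]] nrm_in[OF f x]]
      by simp
    then show ?thesis using y by simp
  qed
  have trf: "mul.opr W (lift W) (trf V W f y) = mul.opr W (lift W) (trf V W f y')"
    if f: "gmap G V W f" and y: "y \<in> obj V" "y' \<in> obj V" "mul.opr V (lift V) y = mul.opr V (lift V) y'"
    for V W f y y'
  proof -
    note fins = gmap_fin[OF f]
    have "mul.opr W (lift W) (trf V W f x) = trf V W f (mul.opr V (lift V) x)" if x: "x \<in> obj V" for x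
      using trf_mul[OF f x lift_in[OF fins(2)]] res_lift[OF f]
        mul.opr_commute[OF fins(2) lift_in[OF fins(2)] trf_in[OF f x]]
        mul.opr_commute[OF fins(1) lift_in[OF fins(1)] x] by simp
    then show ?thesis using y by simp
  qed
  obtain \<omega> where w: "is_bispan G \<omega>" "b_src \<omega> = X" "b_tgt \<omega> = Y" "\<Phi> = bispan_class G \<omega>"
    using \<Phi> by (rule bispan_homE)
  have g: "gmap G (b_top \<omega>) X (b_res \<omega>)" "gmap G (b_top \<omega>) (b_bot \<omega>) (b_nrm \<omega>)"
    "gmap G (b_bot \<omega>) Y (b_trf \<omega>)"
    using w by (auto simp: is_bispan_def)
  show ?thesis
    using map_bispan[OF w(1)] w x
      trf[OF g(3) nrm_in[OF g(2) res_in[OF g(1) x(1)]] nrm_in[OF g(2) res_in[OF g(1) x(2)]]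
        nrm[OF g(2) res_in[OF g(1) x(1)] res_in[OF g(1) x(2)] res[OF g(1) x eq]]]
    by simp
qed

end

context complementary_idempotents
begin

lemma lift_split:
  assumes X: "fin_gset G X" and x: "x \<in> obj X"
  shows "add.opr X (mul.opr X (idem1.lift X) x) (mul.opr X (idem2.lift X) x) = x"
  using distrib[OF X idem1.lift_in[OF X] idem2.lift_in[OF X] x] lift_complete[OF X] mul.unit_opr[OF X x]
  by simp

lemma lift_glue:
  assumes X: "fin_gset G X" and x: "x \<in> obj X" "x' \<in> obj X"
  defines "z \<equiv> add.opr X (mul.opr X (idem1.lift X) x) (mul.opr X (idem2.lift X) x')"
  shows "mul.opr X (idem1.lift X) z = mul.opr X (idem1.lift X) x"
    and "mul.opr X (idem2.lift X) z = mul.opr X (idem2.lift X) x'"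
proof -
  note l1 = idem1.lift_in[OF X] and l2 = idem2.lift_in[OF X]
  note 1 = mul.opr_in[OF X l1 x(1)] and 2 = mul.opr_in[OF X l2 x(2)]
  have z: "z \<in> obj X" unfolding z_def by (rule add.opr_in[OF X 1 2])
  have comm: "mul.opr X u z = add.opr X (mul.opr X u (mul.opr X (idem1.lift X) x))
      (mul.opr X u (mul.opr X (idem2.lift X) x'))" if u: "u \<in> obj X" for u
    using distrib[OF X 1 2 u] mul.opr_commute[OF X u z] mul.opr_commute[OF X u 1]
      mul.opr_commute[OF X u 2] by (simp flip: z_def)
  have 21: "mul.opr X (idem2.lift X) (idem1.lift X) = add.unit X"
    using mul.opr_commute[OF X l2 l1] lift_orthogonal[OF X] by simp
  show "mul.opr X (idem1.lift X) z = mul.opr X (idem1.lift X) x"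
    using comm[OF l1] mul.opr_assoc[OF X l1 l1 x(1)] mul.opr_assoc[OF X l1 l2 x(2)]
      idem1.lift_idem[OF X] lift_orthogonal[OF X] zero_mul[OF X x(2)] add.opr_unit[OF X 1] by simp
  show "mul.opr X (idem2.lift X) z = mul.opr X (idem2.lift X) x'"
    using comm[OF l2] mul.opr_assoc[OF X l2 l1 x(1)] mul.opr_assoc[OF X l2 l2 x(2)]
      idem2.lift_idem[OF X] 21 zero_mul[OF X x(1)] add.unit_opr[OF X 2] by simp
qed

end


section \<open>Quotients of Tambara functors\<close>

text \<open>
  The two factors of \<open>R\<close> and their product are all levelwise images of \<open>R\<close> under natural maps.
  Functoriality and the level rings pass to such images.
\<close>

locale natural_image = group G for G :: "('a, 'b) monoid_scheme" (structure) +
  fixes R :: "('a, 'u) bifun" and R' :: "('a, 'v) bifun" and \<eta> :: "'a gset \<Rightarrow> 'u \<Rightarrow> 'v"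
  assumes surj: "fin_gset G X \<Longrightarrow> \<eta> X ` t_obj R X = t_obj R' X"
    and nat: "\<Phi> \<in> bispan_hom G X Y \<Longrightarrow> x \<in> t_obj R X \<Longrightarrow> \<eta> Y (t_map R \<Phi> x) = t_map R' \<Phi> (\<eta> X x)"
begin

lemma t_pair_natural:
  assumes R: "product_functor G R" and R': "product_functor G R'" and X: "fin_gset G X"
    and a: "a \<in> t_obj R X" "b \<in> t_obj R X"
  shows "t_pair G R' X (\<eta> X a) (\<eta> X b) = \<eta> (gsum X X) (t_pair G R X a b)"
proof -
  interpret R: product_functor G R by fact
  interpret R': product_functor G R' by fact
  note p = R.t_pair[OF X a]
  note i = R.restriction_hom[OF gmap_InL[OF X X]] R.restriction_hom[OF gmap_InR[OF X X]]
  show ?thesis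
    using p surj[OF fin_gsum[OF X X]] nat[OF i(1)] nat[OF i(2)]
    by (intro R'.t_pair_eqI[OF X]) (auto simp flip: nat[OF i(1)] nat[OF i(2)])
qed

lemma level_ring_natural:
  assumes R: "product_functor G R" and R': "product_functor G R'" and X: "fin_gset G X"
  shows "a \<in> t_obj R X \<Longrightarrow> b \<in> t_obj R X \<Longrightarrow>
      mult (level_ring G R' X) (\<eta> X a) (\<eta> X b) = \<eta> X (mult (level_ring G R X) a b)"
    and "a \<in> t_obj R X \<Longrightarrow> b \<in> t_obj R X \<Longrightarrow>
      add (level_ring G R' X) (\<eta> X a) (\<eta> X b) = \<eta> X (add (level_ring G R X) a b)"
    and "one (level_ring G R' X) = \<eta> X (one (level_ring G R X))"
    and "zero (level_ring G R' X) = \<eta> X (zero (level_ring G R X))"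
proof -
  interpret R: product_functor G R by fact
  interpret R': product_functor G R' by fact
  note fold = gmap_gfold[OF X] and n = gmap_empty[OF fin_gempty X, of id]
  note pair = t_pair_natural[OF R R' X]
  show "a \<in> t_obj R X \<Longrightarrow> b \<in> t_obj R X \<Longrightarrow>
      mult (level_ring G R' X) (\<eta> X a) (\<eta> X b) = \<eta> X (mult (level_ring G R X) a b)"
    using pair[of a b] nat[OF R.norm_hom[OF fold]] R.t_pair[OF X] by (simp add: level_ring_def)
  show "a \<in> t_obj R X \<Longrightarrow> b \<in> t_obj R X \<Longrightarrow>
      add (level_ring G R' X) (\<eta> X a) (\<eta> X b) = \<eta> X (add (level_ring G R X) a b)"
    using pair[of a b] nat[OF R.transfer_hom[OF fold]] R.t_pair[OF X] by (simp add: level_ring_def)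
  have "\<eta> gempty (THE z. z \<in> t_obj R gempty) \<in> t_obj R' gempty"
    using surj[OF fin_gempty] R.mul.the_empty by blast
  then have e: "(THE z. z \<in> t_obj R' gempty) = \<eta> gempty (THE z. z \<in> t_obj R gempty)"
    using R'.obj_empty[OF fin_gempty] R'.mul.the_empty by auto
  show "one (level_ring G R' X) = \<eta> X (one (level_ring G R X))"
    using nat[OF R.norm_hom[OF n] R.mul.the_empty] e by (simp add: level_ring_def)
  show "zero (level_ring G R' X) = \<eta> X (zero (level_ring G R X))"
    using nat[OF R.transfer_hom[OF n] R.mul.the_empty] e by (simp add: level_ring_def)
qed

lemma set_functor_image:
  assumes R: "set_functor G R"
  shows "set_functor G R'"
proof -
  have map_in: "t_map R \<Phi> x \<in> t_obj R Y" if "\<Phi> \<in> bispan_hom G X Y" "x \<in> t_obj R X" for \<Phi> X Y x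
    using R that unfolding set_functor_def by blast
  show ?thesis
    unfolding set_functor_def
  proof (intro conjI allI ballI impI)
    fix X Y \<Phi> assume \<Phi>: "\<Phi> \<in> bispan_hom G X Y"
    show "t_map R' \<Phi> \<in> t_obj R' X \<rightarrow> t_obj R' Y"
    proof
      fix x' assume "x' \<in> t_obj R' X"
      then obtain x where x: "x \<in> t_obj R X" "x' = \<eta> X x" using surj bispan_hom_fin[OF \<Phi>] by blast
      then show "t_map R' \<Phi> x' \<in> t_obj R' Y"
        using nat[OF \<Phi> x(1)] map_in[OF \<Phi> x(1)] surj bispan_hom_fin[OF \<Phi>] by (metis imageI)
    qed
  next
    fix X x' assume X: "fin_gset G X" and "x' \<in> t_obj R' X"
    then obtain x where x: "x \<in> t_obj R X" "x' = \<eta> X x" using surj by blast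
    have "bispan_id G X \<in> bispan_hom G X X"
      unfolding bispan_id_def by (rule bispan_hom_classI) (simp_all add: is_bispan_def gmap_id X)
    from nat[OF this x(1)] show "t_map R' (bispan_id G X) x' = x'"
      using R X x by (simp add: set_functor_def)
  next
    fix X Y Z \<Phi> \<Psi> x'
    assume \<Phi>: "\<Phi> \<in> bispan_hom G X Y" and \<Psi>: "\<Psi> \<in> bispan_hom G Y Z" and "x' \<in> t_obj R' X"
    then obtain x where x: "x \<in> t_obj R X" "x' = \<eta> X x" using surj bispan_hom_fin[OF \<Phi>] by blast
    have "t_map R (bispan_comp G \<Psi> \<Phi>) x = t_map R \<Psi> (t_map R \<Phi> x)"
      using R \<Phi> \<Psi> x(1) unfolding set_functor_def by blast
    then show "t_map R' (bispan_comp G \<Psi> \<Phi>) x' = t_map R' \<Psi> (t_map R' \<Phi> x')"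
      using nat[OF bispan_comp_hom[OF \<Phi> \<Psi>] x(1)] nat[OF \<Phi> x(1)] nat[OF \<Psi> map_in[OF \<Phi> x(1)]] x(2) by simp
  qed
qed

text \<open>
  A factor \<open>R'\<close> of a product-preserving functor preserves products.  Here \<open>\<zeta>\<close> is the projection to the
  complementary factor.  To see injectivity, lift two elements of \<open>R' P\<close> to elements of \<open>R P\<close> that agree in the
  complementary factor; then all their components agree, and so do they.
\<close>

lemma product_preserving_factor:
  fixes \<zeta> :: "'a gset \<Rightarrow> 'u \<Rightarrow> 'w"
  assumes R: "set_functor G R" "product_preserving G R"
    and cong: "\<And>X Y \<Phi> x x'. \<Phi> \<in> bispan_hom G X Y \<Longrightarrow> x \<in> t_obj R X \<Longrightarrow> x' \<in> t_obj R X \<Longrightarrow>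
      \<zeta> X x = \<zeta> X x' \<Longrightarrow> \<zeta> Y (t_map R \<Phi> x) = \<zeta> Y (t_map R \<Phi> x')"
    and inj: "\<And>X x x'. fin_gset G X \<Longrightarrow> x \<in> t_obj R X \<Longrightarrow> x' \<in> t_obj R X \<Longrightarrow>
      \<eta> X x = \<eta> X x' \<Longrightarrow> \<zeta> X x = \<zeta> X x' \<Longrightarrow> x = x'"
    and joint: "\<And>X x x'. fin_gset G X \<Longrightarrow> x \<in> t_obj R X \<Longrightarrow> x' \<in> t_obj R X \<Longrightarrow>
      \<exists>z \<in> t_obj R X. \<eta> X z = \<eta> X x \<and> \<zeta> X z = \<zeta> X x'"
  shows "product_preserving G R'"
proof -
  have map_in: "t_map R \<Phi> x \<in> t_obj R Y" if "\<Phi> \<in> bispan_hom G X Y" "x \<in> t_obj R X" for \<Phi> X Y x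
    using R(1) that unfolding set_functor_def by blast
  show ?thesis
    unfolding product_preserving_def
  proof (intro conjI allI impI)
    fix T assume T: "bispan_terminal G T"
    then have "fin_gset G T" by (simp add: bispan_terminal_def)
    moreover have "\<exists>!x. x \<in> t_obj R T" using R(2) T unfolding product_preserving_def by blast
    ultimately show "\<exists>!x. x \<in> t_obj R' T" by (auto simp flip: surj)
  next
    fix P \<Phi> \<Psi> X Y assume X: "fin_gset G X" and Y: "fin_gset G Y" and pr: "bispan_product G P \<Phi> \<Psi> X Y"
    then have P: "fin_gset G P" and \<Phi>: "\<Phi> \<in> bispan_hom G P X" and \<Psi>: "\<Psi> \<in> bispan_hom G P Y"
      by (simp_all add: bispan_product_def)
    have bij: "bij_betw (\<lambda>z. (t_map R \<Phi> z, t_map R \<Psi> z)) (t_obj R P) (t_obj R X \<times> t_obj R Y)"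
      using R(2) X Y pr unfolding product_preserving_def by blast
    show "bij_betw (\<lambda>z. (t_map R' \<Phi> z, t_map R' \<Psi> z)) (t_obj R' P) (t_obj R' X \<times> t_obj R' Y)"
      unfolding bij_betw_def surj[OF P, symmetric]
    proof (intro conjI inj_onI)
      fix z z' assume "z \<in> \<eta> P ` t_obj R P" "z' \<in> \<eta> P ` t_obj R P"
        and eq: "(t_map R' \<Phi> z, t_map R' \<Psi> z) = (t_map R' \<Phi> z', t_map R' \<Psi> z')"
      then obtain p p' where p: "p \<in> t_obj R P" "z = \<eta> P p" and p': "p' \<in> t_obj R P" "z' = \<eta> P p'" by blast
      obtain q where q: "q \<in> t_obj R P" "\<eta> P q = \<eta> P p'" "\<zeta> P q = \<zeta> P p" using joint[OF P p'(1) p(1)] by blast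
      have "t_map R \<Omega> p = t_map R \<Omega> q"
        if \<Omega>: "\<Omega> \<in> bispan_hom G P Z" "t_map R' \<Omega> z = t_map R' \<Omega> z'" for \<Omega> Z
      proof (rule inj)
        show "fin_gset G Z" using bispan_hom_fin[OF \<Omega>(1)] by simp
        show "\<eta> Z (t_map R \<Omega> p) = \<eta> Z (t_map R \<Omega> q)"
          using nat[OF \<Omega>(1) p(1)] nat[OF \<Omega>(1) q(1)] \<Omega>(2) p p' q by simp
        show "\<zeta> Z (t_map R \<Omega> p) = \<zeta> Z (t_map R \<Omega> q)"
          using cong[OF \<Omega>(1) p(1) q(1)] q by simp
      qed (use map_in \<Omega> p q in auto)
      then have "(t_map R \<Phi> p, t_map R \<Psi> p) = (t_map R \<Phi> q, t_map R \<Psi> q)" using \<Phi> \<Psi> eq by simp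
      then have "p = q" using inj_onD[OF bij_betw_imp_inj_on[OF bij]] p q by blast
      then show "z = z'" using p p' q by simp
    next
      have "(\<lambda>z. (t_map R' \<Phi> z, t_map R' \<Psi> z)) ` \<eta> P ` t_obj R P =
          map_prod (\<eta> X) (\<eta> Y) ` (\<lambda>z. (t_map R \<Phi> z, t_map R \<Psi> z)) ` t_obj R P"
        unfolding image_image using nat[OF \<Phi>] nat[OF \<Psi>] by (intro image_cong) auto
      also have "\<dots> = map_prod (\<eta> X) (\<eta> Y) ` (t_obj R X \<times> t_obj R Y)"
        using bij by (simp add: bij_betw_def)
      also have "\<dots> = t_obj R' X \<times> t_obj R' Y"
        using surj[OF X] surj[OF Y] by (simp add: map_prod_surj_on)
      finally show "(\<lambda>z. (t_map R' \<Phi> z, t_map R' \<Psi> z)) ` \<eta> P ` t_obj R P = t_obj R' X \<times> t_obj R' Y" .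
    qed
  qed
qed

lemma tambara_image:
  assumes R: "tambara_functor G R" and R': "product_preserving G R'"
  shows "tambara_functor G R'"
proof -
  have sf: "set_functor G R" and pp: "product_preserving G R"
    and gr: "\<And>X. fin_gset G X \<Longrightarrow> group (add_monoid (level_ring G R X))"
    using R by (auto simp: tambara_functor_def)
  have sf': "set_functor G R'" by (rule set_functor_image[OF sf])
  interpret R: product_functor G R using sf pp by unfold_locales
  interpret R': product_functor G R' using sf' R' by unfold_locales
  have "group (add_monoid (level_ring G R' X))" if X: "fin_gset G X" for X
  proof -
    note nt = level_ring_natural[OF R.product_functor_axioms R'.product_functor_axioms X]
    have "\<eta> X \<in> hom (add_monoid (level_ring G R X)) (add_monoid (level_ring G R' X))"
      using surj[OF X] nt(2) by (auto simp: hom_def)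
    from group.hom_imp_img_group[OF gr[OF X] this]
    show ?thesis using surj[OF X] nt(4) by simp
  qed
  then show ?thesis using sf' R' by (simp add: tambara_functor_def)
qed

text \<open>
  At the bottom level it suffices to compare with a given G-ring \<open>S\<close> on the source of \<open>\<eta>\<close>, since \<open>\<eta>\<close> is
  surjective.
\<close>

lemma G_ring_eq_image:
  assumes R: "tambara_functor G R" and R': "tambara_functor G R'" and fin: "finite (carrier G)"
    and carr: "\<eta> (free_orbit G) ` t_obj R (free_orbit G) = carrier S"
    and ring: "\<And>a b. a \<in> t_obj R (free_orbit G) \<Longrightarrow> b \<in> t_obj R (free_orbit G) \<Longrightarrow>
        \<eta> (free_orbit G) (mult (underlying_ring G R) a b) = mult S (\<eta> (free_orbit G) a) (\<eta> (free_orbit G) b) \<and>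
        \<eta> (free_orbit G) (add (underlying_ring G R) a b) = add S (\<eta> (free_orbit G) a) (\<eta> (free_orbit G) b)"
      "\<eta> (free_orbit G) (one (underlying_ring G R)) = one S"
      "\<eta> (free_orbit G) (zero (underlying_ring G R)) = zero S"
    and act: "\<And>g a. g \<in> carrier G \<Longrightarrow> a \<in> t_obj R (free_orbit G) \<Longrightarrow>
        \<eta> (free_orbit G) (underlying_act G R g a) = \<rho> g (\<eta> (free_orbit G) a)"
  shows "G_ring_eq G (underlying_ring G R') (underlying_act G R') S \<rho>"
proof -
  interpret R: product_functor G R using R by unfold_locales (simp_all add: tambara_functor_def)
  interpret R': product_functor G R' using R' by unfold_locales (simp_all add: tambara_functor_def)
  note \<Gamma> = fin_free_orbit[OF fin]
  note nt = level_ring_natural[OF R.product_functor_axioms R'.product_functor_axioms \<Gamma>]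
  have S: "carrier (underlying_ring G R') = carrier S" "t_obj R' (free_orbit G) = carrier S"
    using surj[OF \<Gamma>] carr by (simp_all add: underlying_ring_def)
  show ?thesis
    unfolding G_ring_eq_def S(1)
  proof (intro conjI ballI)
    show "\<one>\<^bsub>underlying_ring G R'\<^esub> = \<one>\<^bsub>S\<^esub>" "\<zero>\<^bsub>underlying_ring G R'\<^esub> = \<zero>\<^bsub>S\<^esub>"
      using nt(3,4) ring(2,3) by (simp_all add: underlying_ring_def)
    fix x assume x: "x \<in> carrier S"
    then obtain a where a: "a \<in> t_obj R (free_orbit G)" "x = \<eta> (free_orbit G) a" using carr by blast
    { fix y assume "y \<in> carrier S"
      then obtain b where b: "b \<in> t_obj R (free_orbit G)" "y = \<eta> (free_orbit G) b" using carr by blast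
      show "x \<oplus>\<^bsub>underlying_ring G R'\<^esub> y = x \<oplus>\<^bsub>S\<^esub> y" "x \<otimes>\<^bsub>underlying_ring G R'\<^esub> y = x \<otimes>\<^bsub>S\<^esub> y"
        using nt(1,2)[OF a(1) b(1)] ring(1)[OF a(1) b(1)] a b by (simp_all add: underlying_ring_def) }
    fix g assume g: "g \<in> carrier G"
    show "underlying_act G R' g x = \<rho> g x"
      using nat[OF R.restriction_hom[OF gmap_right_mult[OF fin g]] a(1)] act[OF g a(1)] a x S(2)
      by (simp add: underlying_act_def)
  qed simp
qed

end

text \<open>
  The image of \<open>R\<close> under levelwise maps \<open>\<eta>\<close>.  The level at \<open>X\<close> is the literal image of \<open>\<eta> X\<close>, so it can be
  prescribed as a set.  Source and target of a morphism are read off from a representative.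
\<close>

definition quotient_functor :: "('g, 'u) bifun \<Rightarrow> ('g gset \<Rightarrow> 'u \<Rightarrow> 'v) \<Rightarrow> ('g, 'v) bifun" where
  "quotient_functor R \<eta> = \<lparr>t_obj = (\<lambda>X. \<eta> X ` t_obj R X),
     t_map = (\<lambda>\<Phi> y. let \<omega> = (SOME \<omega>. \<omega> \<in> \<Phi>) in
       \<eta> (b_tgt \<omega>) (t_map R \<Phi> (SOME x. x \<in> t_obj R (b_src \<omega>) \<and> \<eta> (b_src \<omega>) x = y)))\<rparr>"

lemma t_obj_quotient: "t_obj (quotient_functor R \<eta>) X = \<eta> X ` t_obj R X"
  by (simp add: quotient_functor_def)

lemma t_map_quotient:
  assumes "group G" and \<Phi>: "\<Phi> \<in> bispan_hom G X Y" and x: "x \<in> t_obj R X"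
    and cong: "\<And>x x'. x \<in> t_obj R X \<Longrightarrow> x' \<in> t_obj R X \<Longrightarrow> \<eta> X x = \<eta> X x' \<Longrightarrow>
      \<eta> Y (t_map R \<Phi> x) = \<eta> Y (t_map R \<Phi> x')"
  shows "\<eta> Y (t_map R \<Phi> x) = t_map (quotient_functor R \<eta>) \<Phi> (\<eta> X x)"
proof -
  interpret group G by fact
  obtain \<omega>0 where w0: "is_bispan G \<omega>0" "b_src \<omega>0 = X" "b_tgt \<omega>0 = Y" "\<Phi> = bispan_class G \<omega>0"
    using \<Phi> by (rule bispan_homE)
  let ?w = "SOME \<omega>. \<omega> \<in> \<Phi>"
  have "?w \<in> \<Phi>" using bispan_class_self[OF w0(1)] w0(4) by (intro someI[of "\<lambda>\<omega>. \<omega> \<in> \<Phi>"]) simp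
  then have w: "b_src ?w = X" "b_tgt ?w = Y"
    using w0 by (auto simp: bispan_class_def bispan_iso_def)
  let ?x = "SOME x'. x' \<in> t_obj R X \<and> \<eta> X x' = \<eta> X x"
  have "?x \<in> t_obj R X \<and> \<eta> X ?x = \<eta> X x"
    using x by (intro someI[of "\<lambda>x'. x' \<in> t_obj R X \<and> \<eta> X x' = \<eta> X x"]) simp
  then have "\<eta> Y (t_map R \<Phi> ?x) = \<eta> Y (t_map R \<Phi> x)" using cong x by blast
  then show ?thesis by (simp add: quotient_functor_def Let_def w)
qed

section \<open>The decomposition of a Tambara functor\<close>

lemma RDirProd_simps:
  "mult (RDirProd A B) (a, b) (a', b') = (mult A a a', mult B b b')"
  "add (RDirProd A B) (a, b) (a', b') = (add A a a', add B b b')"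
  "one (RDirProd A B) = (one A, one B)" "zero (RDirProd A B) = (zero A, zero B)"
  by (simp_all add: RDirProd_def DirProd_def monoid.defs)

theorem proposition3p6:
  fixes G :: "('g, 'm) monoid_scheme"
    and R :: "('g, 'u) bifun"
    and S1 :: "('u, 'k) ring_scheme" and S2 :: "('u, 'l) ring_scheme"
    and \<rho>1 \<rho>2 :: "'g \<Rightarrow> 'u \<Rightarrow> 'u"
    and \<phi> :: "'u \<Rightarrow> 'u \<times> 'u"
  assumes "group G" and "finite (carrier G)"
    and "tambara_functor G R"
    and "G_ring G S1 \<rho>1" and "G_ring G S2 \<rho>2"
    and "\<phi> \<in> G_ring_iso G (underlying_ring G R) (underlying_act G R)
               (RDirProd S1 S2) (prod_act \<rho>1 \<rho>2)"
  shows "\<exists>(R1 :: ('g, 'u) bifun) (R2 :: ('g, 'u) bifun) \<eta>.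
           tambara_functor G R1 \<and> tambara_functor G R2 \<and>
           G_ring_eq G (underlying_ring G R1) (underlying_act G R1) S1 \<rho>1 \<and>
           G_ring_eq G (underlying_ring G R2) (underlying_act G R2) S2 \<rho>2 \<and>
           tambara_iso G R (tambara_prod R1 R2) \<eta> \<and>
           (\<forall>x \<in> carrier (underlying_ring G R). \<eta> (free_orbit G) x = \<phi> x)"
proof -
  interpret group G by fact
  interpret product_functor G R
    using assms(3) by unfold_locales (simp_all add: tambara_functor_def)
  let ?\<Gamma> = "free_orbit G"
  have \<Gamma>: "fin_gset G ?\<Gamma>" by (rule fin_free_orbit[OF assms(2)])
  interpret S1: cring S1 using assms(4) by (simp add: G_ring_def)
  interpret S2: cring S2 using assms(5) by (simp add: G_ring_def)
  have L: "carrier (underlying_ring G R) = obj ?\<Gamma>" "mult (underlying_ring G R) = mul.opr ?\<Gamma>"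
    "add (underlying_ring G R) = add.opr ?\<Gamma>" "one (underlying_ring G R) = mul.unit ?\<Gamma>"
    "zero (underlying_ring G R) = add.unit ?\<Gamma>"
    by (simp_all add: underlying_ring_def)
  have iso: "\<phi> \<in> ring_iso (underlying_ring G R) (RDirProd S1 S2)"
    and \<phi>_act: "\<And>g s. g \<in> carrier G \<Longrightarrow> s \<in> obj ?\<Gamma> \<Longrightarrow>
      \<phi> (underlying_act G R g s) = map_prod (\<rho>1 g) (\<rho>2 g) (\<phi> s)"
    using assms(6) L by (auto simp: G_ring_iso_def prod_act_def)
  note \<phi> = ring_iso_memE[OF iso, unfolded L RDirProd_carrier RDirProd_simps]
  have \<phi>_bij: "bij_betw \<phi> (obj ?\<Gamma>) (carrier S1 \<times> carrier S2)" using \<phi>(5) .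
  have act_eq: "underlying_act G R g s = res ?\<Gamma> ?\<Gamma> (right_mult G g) s" if "s \<in> obj ?\<Gamma>" for g s
    using that by (simp add: underlying_act_def)
  have zero_in: "add.unit ?\<Gamma> \<in> obj ?\<Gamma>" by (rule add.unit_in[OF \<Gamma>])
  have mult: "fst (\<phi> (mul.opr ?\<Gamma> x y)) = fst (\<phi> x) \<otimes>\<^bsub>S1\<^esub> fst (\<phi> y)"
    "snd (\<phi> (mul.opr ?\<Gamma> x y)) = snd (\<phi> x) \<otimes>\<^bsub>S2\<^esub> snd (\<phi> y)" if "x \<in> obj ?\<Gamma>" "y \<in> obj ?\<Gamma>" for x y
    using \<phi>(2)[OF that] by (metis RDirProd_simps(1) fst_conv snd_conv surj_pair)+
  have plus: "fst (\<phi> (add.opr ?\<Gamma> x y)) = fst (\<phi> x) \<oplus>\<^bsub>S1\<^esub> fst (\<phi> y)"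
    "snd (\<phi> (add.opr ?\<Gamma> x y)) = snd (\<phi> x) \<oplus>\<^bsub>S2\<^esub> snd (\<phi> y)" if "x \<in> obj ?\<Gamma>" "y \<in> obj ?\<Gamma>" for x y
    using \<phi>(3)[OF that] by (metis RDirProd_simps(2) fst_conv snd_conv surj_pair)+
  have in1: "fst (\<phi> x) \<in> carrier S1" and in2: "snd (\<phi> x) \<in> carrier S2" if "x \<in> obj ?\<Gamma>" for x
    using \<phi>(1)[OF that] by auto
  have \<phi>_zero: "\<phi> (add.unit ?\<Gamma>) = (\<zero>\<^bsub>S1\<^esub>, \<zero>\<^bsub>S2\<^esub>)"
  proof (rule prod_eqI)
    show "fst (\<phi> (add.unit ?\<Gamma>)) = fst (\<zero>\<^bsub>S1\<^esub>, \<zero>\<^bsub>S2\<^esub>)" "snd (\<phi> (add.unit ?\<Gamma>)) = snd (\<zero>\<^bsub>S1\<^esub>, \<zero>\<^bsub>S2\<^esub>)"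
      using plus[OF zero_in zero_in] add.unit_opr[OF \<Gamma> zero_in] in1[OF zero_in] in2[OF zero_in]
      by simp_all
  qed
  have ex: "\<exists>x \<in> obj ?\<Gamma>. \<phi> x = (a, b)" if "a \<in> carrier S1" "b \<in> carrier S2" for a b
  proof -
    have "(a, b) \<in> \<phi> ` obj ?\<Gamma>" using bij_betw_imp_surj_on[OF \<phi>_bij] that by simp
    then show ?thesis by (simp add: image_iff eq_commute)
  qed
  have \<phi>_eqI: "x = y" if "x \<in> obj ?\<Gamma>" "y \<in> obj ?\<Gamma>" "fst (\<phi> x) = fst (\<phi> y)" "snd (\<phi> x) = snd (\<phi> y)" for x y
    using inj_onD[OF bij_betw_imp_inj_on[OF \<phi>_bij] prod_eqI] that by simp
  have \<rho>1: "\<rho>1 g \<in> ring_iso S1 S1" and \<rho>2: "\<rho>2 g \<in> ring_iso S2 S2" if "g \<in> carrier G" for g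
    using assms(4,5) that by (simp_all add: G_ring_def)
  have \<rho>_one: "\<rho>1 g \<one>\<^bsub>S1\<^esub> = \<one>\<^bsub>S1\<^esub>" "\<rho>2 g \<one>\<^bsub>S2\<^esub> = \<one>\<^bsub>S2\<^esub>" if "g \<in> carrier G" for g
    using ring_iso_memE(4)[OF \<rho>1[OF that]] ring_iso_memE(4)[OF \<rho>2[OF that]] .
  have \<rho>_zero: "\<rho>1 g \<zero>\<^bsub>S1\<^esub> = \<zero>\<^bsub>S1\<^esub>" "\<rho>2 g \<zero>\<^bsub>S2\<^esub> = \<zero>\<^bsub>S2\<^esub>" if "g \<in> carrier G" for g
    using ring_hom_zero[of "\<rho>1 g" S1 S1] ring_hom_zero[of "\<rho>2 g" S2 S2] \<rho>1[OF that] \<rho>2[OF that]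
      S1.ring_axioms S2.ring_axioms by (simp_all add: ring_iso_def)
  \<comment> \<open>The idempotents are \<open>G\<close>-invariant because \<open>G\<close> acts on both factors by ring automorphisms.\<close>
  obtain e1 where e1: "e1 \<in> obj ?\<Gamma>" "\<phi> e1 = (\<one>\<^bsub>S1\<^esub>, \<zero>\<^bsub>S2\<^esub>)" using ex by blast
  obtain e2 where e2: "e2 \<in> obj ?\<Gamma>" "\<phi> e2 = (\<zero>\<^bsub>S1\<^esub>, \<one>\<^bsub>S2\<^esub>)" using ex by blast
  have res_in': "res ?\<Gamma> ?\<Gamma> (right_mult G k) x \<in> obj ?\<Gamma>" if "k \<in> carrier G" "x \<in> obj ?\<Gamma>" for k x
    by (rule res_in[OF gmap_right_mult[OF assms(2) that(1)] that(2)])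
  interpret complementary_idempotents G R e1 e2
  proof unfold_locales
    show "mul.opr ?\<Gamma> e1 e1 = e1"
      by (rule \<phi>_eqI) (use e1 mult[OF e1(1) e1(1)] mul.opr_in[OF \<Gamma> e1(1) e1(1)] in simp_all)
    show "mul.opr ?\<Gamma> e2 e2 = e2"
      by (rule \<phi>_eqI) (use e2 mult[OF e2(1) e2(1)] mul.opr_in[OF \<Gamma> e2(1) e2(1)] in simp_all)
    show "mul.opr ?\<Gamma> e1 e2 = add.unit ?\<Gamma>"
      by (rule \<phi>_eqI)
        (use e1 e2 mult[OF e1(1) e2(1)] mul.opr_in[OF \<Gamma> e1(1) e2(1)] zero_in \<phi>_zero in simp_all)
    show "add.opr ?\<Gamma> e1 e2 = mul.unit ?\<Gamma>"
      by (rule \<phi>_eqI)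
        (use e1 e2 plus[OF e1(1) e2(1)] add.opr_in[OF \<Gamma> e1(1) e2(1)] mul.unit_in[OF \<Gamma>] \<phi>(4) in simp_all)
    fix k assume k: "k \<in> carrier G"
    show "res ?\<Gamma> ?\<Gamma> (right_mult G k) e1 = e1"
      by (rule \<phi>_eqI)
        (use \<phi>_act[OF k e1(1)] e1 res_in'[OF k e1(1)] act_eq[OF e1(1)] \<rho>_one[OF k] \<rho>_zero[OF k] in simp_all)
    show "res ?\<Gamma> ?\<Gamma> (right_mult G k) e2 = e2"
      by (rule \<phi>_eqI)
        (use \<phi>_act[OF k e2(1)] e2 res_in'[OF k e2(1)] act_eq[OF e2(1)] \<rho>_one[OF k] \<rho>_zero[OF k] in simp_all)
  qed (use assms(2) e1 e2 in auto)
  \<comment> \<open>At the bottom level the quotient map is the given projection, so that the factor has \<open>S1\<close> as its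
      ring there; both definitions have the kernel of multiplication by the lift.\<close>
  define \<eta>1 where "\<eta>1 X = (if X = ?\<Gamma> then fst \<circ> \<phi> else mul.opr X (idem1.lift X))" for X
  define \<eta>2 where "\<eta>2 X = (if X = ?\<Gamma> then snd \<circ> \<phi> else mul.opr X (idem2.lift X))" for X
  have ker1: "\<eta>1 X x = \<eta>1 X x' \<longleftrightarrow> mul.opr X (idem1.lift X) x = mul.opr X (idem1.lift X) x'"
    if x: "x \<in> obj X" "x' \<in> obj X" for X x x'
  proof (cases "X = ?\<Gamma>")
    case True
    have "mul.opr ?\<Gamma> e1 x = mul.opr ?\<Gamma> e1 x' \<longleftrightarrow> \<phi> (mul.opr ?\<Gamma> e1 x) = \<phi> (mul.opr ?\<Gamma> e1 x')"
      using x True mul.opr_in[OF \<Gamma> e1(1)] \<phi>_eqI by metis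
    also have "\<dots> \<longleftrightarrow> fst (\<phi> x) = fst (\<phi> x')"
      using x True mult[OF e1(1)] e1 in1 in2 by (simp add: prod_eq_iff)
    finally show ?thesis using True by (simp add: \<eta>1_def idem1.lift_bottom)
  qed (simp add: \<eta>1_def)
  have ker2: "\<eta>2 X x = \<eta>2 X x' \<longleftrightarrow> mul.opr X (idem2.lift X) x = mul.opr X (idem2.lift X) x'"
    if x: "x \<in> obj X" "x' \<in> obj X" for X x x'
  proof (cases "X = ?\<Gamma>")
    case True
    have "mul.opr ?\<Gamma> e2 x = mul.opr ?\<Gamma> e2 x' \<longleftrightarrow> \<phi> (mul.opr ?\<Gamma> e2 x) = \<phi> (mul.opr ?\<Gamma> e2 x')"
      using x True mul.opr_in[OF \<Gamma> e2(1)] \<phi>_eqI by metis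
    also have "\<dots> \<longleftrightarrow> snd (\<phi> x) = snd (\<phi> x')"
      using x True mult[OF e2(1)] e2 in1 in2 by (simp add: prod_eq_iff)
    finally show ?thesis using True by (simp add: \<eta>2_def idem2.lift_bottom)
  qed (simp add: \<eta>2_def)
  have cong1: "\<eta>1 Y (t_map R \<Phi> x) = \<eta>1 Y (t_map R \<Phi> x')"
    if "\<Phi> \<in> bispan_hom G X Y" "x \<in> obj X" "x' \<in> obj X" "\<eta>1 X x = \<eta>1 X x'" for X Y \<Phi> x x'
    using idem1.lift_mul_cong[OF that(1-3)] that ker1 map_in by simp
  have cong2: "\<eta>2 Y (t_map R \<Phi> x) = \<eta>2 Y (t_map R \<Phi> x')"
    if "\<Phi> \<in> bispan_hom G X Y" "x \<in> obj X" "x' \<in> obj X" "\<eta>2 X x = \<eta>2 X x'" for X Y \<Phi> x x'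
    using idem2.lift_mul_cong[OF that(1-3)] that ker2 map_in by simp
  have inj: "x = x'" if X: "fin_gset G X" and x: "x \<in> obj X" "x' \<in> obj X"
    and eq: "\<eta>1 X x = \<eta>1 X x'" "\<eta>2 X x = \<eta>2 X x'" for X x x'
    using lift_split[OF X x(1)] lift_split[OF X x(2)] iffD1[OF ker1[OF x] eq(1)] iffD1[OF ker2[OF x] eq(2)]
    by metis
  have joint: "\<exists>z \<in> obj X. \<eta>1 X z = \<eta>1 X x \<and> \<eta>2 X z = \<eta>2 X x'"
    if X: "fin_gset G X" and x: "x \<in> obj X" "x' \<in> obj X" for X x x'
  proof -
    let ?z = "add.opr X (mul.opr X (idem1.lift X) x) (mul.opr X (idem2.lift X) x')"
    have z: "?z \<in> obj X"
      using x X idem1.lift_in[OF X] idem2.lift_in[OF X] by (intro add.opr_in mul.opr_in)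
    show ?thesis using lift_glue[OF X x] ker1[OF z x(1)] ker2[OF z x(2)] z by blast
  qed
  define R1 where "R1 = quotient_functor R \<eta>1"
  define R2 where "R2 = quotient_functor R \<eta>2"
  have surj1: "\<eta>1 X ` obj X = t_obj R1 X" and surj2: "\<eta>2 X ` obj X = t_obj R2 X" for X
    by (simp_all add: R1_def R2_def t_obj_quotient)
  have nat1: "\<eta>1 Y (t_map R \<Phi> x) = t_map R1 \<Phi> (\<eta>1 X x)"
    if "\<Phi> \<in> bispan_hom G X Y" "x \<in> obj X" for X Y \<Phi> x
    unfolding R1_def by (rule t_map_quotient[where \<eta> = \<eta>1, OF assms(1) that cong1[OF that(1)]])
  have nat2: "\<eta>2 Y (t_map R \<Phi> x) = t_map R2 \<Phi> (\<eta>2 X x)"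
    if "\<Phi> \<in> bispan_hom G X Y" "x \<in> obj X" for X Y \<Phi> x
    unfolding R2_def by (rule t_map_quotient[where \<eta> = \<eta>2, OF assms(1) that cong2[OF that(1)]])
  interpret q1: natural_image G R R1 \<eta>1 by unfold_locales (use surj1 nat1 in auto)
  interpret q2: natural_image G R R2 \<eta>2 by unfold_locales (use surj2 nat2 in auto)
  have pp1: "product_preserving G R1"
    by (rule q1.product_preserving_factor[where \<zeta> = \<eta>2, OF is_functor preserves_products cong2 inj joint])
  have inj': "x = x'" if "fin_gset G X" "x \<in> obj X" "x' \<in> obj X" "\<eta>2 X x = \<eta>2 X x'" "\<eta>1 X x = \<eta>1 X x'"
    for X x x'
    using inj[OF that(1-3,5,4)] .
  have joint': "\<exists>z \<in> obj X. \<eta>2 X z = \<eta>2 X x \<and> \<eta>1 X z = \<eta>1 X x'"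
    if "fin_gset G X" "x \<in> obj X" "x' \<in> obj X" for X x x'
    using joint[OF that(1,3,2)] by blast
  have pp2: "product_preserving G R2"
    by (rule q2.product_preserving_factor[where \<zeta> = \<eta>1, OF is_functor preserves_products cong1 inj' joint'])
  have T1: "tambara_functor G R1" by (rule q1.tambara_image[OF assms(3) pp1])
  have T2: "tambara_functor G R2" by (rule q2.tambara_image[OF assms(3) pp2])
  have carr: "fst ` (\<phi> ` obj ?\<Gamma>) = carrier S1" "snd ` (\<phi> ` obj ?\<Gamma>) = carrier S2"
    unfolding bij_betw_imp_surj_on[OF \<phi>_bij] using S1.zero_closed S2.zero_closed by force+
  have bottom1: "G_ring_eq G (underlying_ring G R1) (underlying_act G R1) S1 \<rho>1"
    by (rule q1.G_ring_eq_image[OF assms(3) T1 assms(2)])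
      (use carr(1) mult(1) plus(1) \<phi>(4) \<phi>_zero \<phi>_act in \<open>simp_all add: \<eta>1_def L image_comp\<close>)
  have bottom2: "G_ring_eq G (underlying_ring G R2) (underlying_act G R2) S2 \<rho>2"
    by (rule q2.G_ring_eq_image[OF assms(3) T2 assms(2)])
      (use carr(2) mult(2) plus(2) \<phi>(4) \<phi>_zero \<phi>_act in \<open>simp_all add: \<eta>2_def L image_comp\<close>)
  define \<eta> where "\<eta> X x = (\<eta>1 X x, \<eta>2 X x)" for X x
  have bij: "bij_betw (\<eta> X) (obj X) (t_obj (tambara_prod R1 R2) X)" if X: "fin_gset G X" for X
  proof (rule bij_betw_imageI)
    show "inj_on (\<eta> X) (obj X)" by (rule inj_onI) (use inj[OF X] in \<open>auto simp: \<eta>_def\<close>)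
    show "\<eta> X ` obj X = t_obj (tambara_prod R1 R2) X"
    proof
      show "\<eta> X ` obj X \<subseteq> t_obj (tambara_prod R1 R2) X"
        by (auto simp: \<eta>_def tambara_prod_def simp flip: surj1 surj2)
      show "t_obj (tambara_prod R1 R2) X \<subseteq> \<eta> X ` obj X"
      proof
        fix p assume "p \<in> t_obj (tambara_prod R1 R2) X"
        then obtain x x' where x: "x \<in> obj X" "x' \<in> obj X" "p = (\<eta>1 X x, \<eta>2 X x')"
          by (auto simp: tambara_prod_def simp flip: surj1 surj2)
        obtain z where "z \<in> obj X" "\<eta>1 X z = \<eta>1 X x" "\<eta>2 X z = \<eta>2 X x'"
          using joint[OF X x(1,2)] by blast
        then show "p \<in> \<eta> X ` obj X" using x by (auto simp: \<eta>_def image_iff intro!: bexI[of _ z])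
      qed
    qed
  qed
  have nat: "\<eta> Y (t_map R \<Phi> x) = t_map (tambara_prod R1 R2) \<Phi> (\<eta> X x)"
    if "\<Phi> \<in> bispan_hom G X Y" "x \<in> obj X" for X Y \<Phi> x
    using nat1[OF that] nat2[OF that] by (simp add: \<eta>_def tambara_prod_def)
  interpret q: natural_image G R "tambara_prod R1 R2" \<eta>
    by unfold_locales (use bij_betw_imp_surj_on[OF bij] nat in auto)
  \<comment> \<open>The product is \<open>R\<close> up to isomorphism, hence a factor whose complement has one point at each level.\<close>
  have "product_preserving G (tambara_prod R1 R2)"
  proof (rule q.product_preserving_factor[where \<zeta> = "\<lambda>X x. ()", OF is_functor preserves_products refl])
    show "x = x'" if "fin_gset G X" "x \<in> obj X" "x' \<in> obj X" "\<eta> X x = \<eta> X x'" for X x x'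
      using inj_onD[OF bij_betw_imp_inj_on[OF bij[OF that(1)]] that(4,2,3)] .
  qed auto
  then have TP: "tambara_functor G (tambara_prod R1 R2)"
    by (rule q.tambara_image[OF assms(3)])
  have "tambara_iso G R (tambara_prod R1 R2) \<eta>"
    unfolding tambara_iso_def tambara_hom_def
    using assms(3) TP bij nat bij_betw_imp_funcset by blast
  moreover have "\<forall>x \<in> carrier (underlying_ring G R). \<eta> ?\<Gamma> x = \<phi> x"
    by (simp add: \<eta>_def \<eta>1_def \<eta>2_def)
  ultimately show ?thesis using T1 T2 bottom1 bottom2 by blast
qed

end
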